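(* Let $\lambda \vdash n$ be a hook partition, i.e. $\lambda = (k,1,1,\ldots,1)$. Then the invariant Hilbert scheme $\mathcal{H}_{M^\lambda}=\mathrm{Hilb}^{S_n}_{M^\lambda}(\mathbb{C}^n)$ is irreducible.
   Context: Let $P=\mathbb{C}[x_1,\dots,x_n]$ with $S_n$ permuting the variables. For a finite-dimensional complex $S_n$-representation $\rho$, the invariant Hilbert scheme $\mathcal{H}_\rho=\mathrm{Hilb}^{S_n}_\rho(\mathbb{C}^n)$ is the quasi-projective $\mathbb{C}$-scheme parametrizing $S_n$-stable closed subschemes $Z\subseteq \mathbb{C}^n$ with $\Gamma(\mathcal{O}_Z)\cong\rho$ as $S_n$-representations (it is the union of those connected components of the $S_n$-fixed point subscheme of the usual Hilbert scheme $\mathrm{Hilb}_{\dim\rho}(\mathbb{C}^n)$ of points on which the coordinate rings of the parametrized subschemes are isomorphic to $\rho$). Its closed points are the $S_n$-stable ideals $I\subseteq P$ with $P/I\cong\rho$. For a partition $\lambda=(\lambda_1\ge\dots\ge\lambda_m\ge 1)\vdash n$, $M^\lambda=\mathrm{Ind}_{S_{\lambda_1}\times\cdots\times S_{\lambda_m}}^{S_n}\mathbf 1$ is the permutation module of $S_n$ on the cosets of the Young subgroup $S_{\lambda_1}\times\cdots\times S_{\lambda_m}$. Irreducibility refers to the underlying topological space. *)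

theory Defs
  imports
    "HOL-Algebra.Sym_Groups"
    "HOL-Algebra.QuotRing"
    "HOL-Algebra.Left_Coset"
    "HOL-Library.Poly_Mapping"
    "HOL-Analysis.Abstract_Topology"
begin

section \<open>Irreducible spaces, and the space of a scheme over its closed points\<close>

definition irreducible_space :: "'a topology \<Rightarrow> bool" where
  "irreducible_space X \<longleftrightarrow> topspace X \<noteq> {} \<and>
     (\<forall>A B. closedin X A \<longrightarrow> closedin X B \<longrightarrow> A \<union> B = topspace X \<longrightarrow>
        A = topspace X \<or> B = topspace X)"

text \<open>
  A scheme that is locally of finite type over a field is recovered, as a topological space, from
  its closed points: its points are the irreducible closed subsets \<open>C\<close> of the space \<open>X\<close> of closed
  points (a point corresponds to the set of closed points in its closure), and its open sets are
  the sets of all \<open>C\<close> meeting a given open subset of \<open>X\<close>.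
\<close>

definition scheme_points :: "'a topology \<Rightarrow> 'a set set" where
  "scheme_points X = {C. closedin X C \<and> irreducible_space (subtopology X C)}"

definition scheme_space :: "'a topology \<Rightarrow> 'a set topology" where
  "scheme_space X =
     topology (\<lambda>W. \<exists>U. openin X U \<and> W = {C \<in> scheme_points X. C \<inter> U \<noteq> {}})"

lemma irreducible_openin_Int:
  assumes C: "C \<in> scheme_points X" and U: "openin X U" and V: "openin X V"
    and "C \<inter> U \<noteq> {}" "C \<inter> V \<noteq> {}"
  shows "C \<inter> (U \<inter> V) \<noteq> {}"
proof
  assume empty: "C \<inter> (U \<inter> V) = {}"
  have cl: "closedin X C" and irr: "irreducible_space (subtopology X C)"
    using C by (auto simp: scheme_points_def)
  have sub: "C \<subseteq> topspace X" using cl closedin_subset by blast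
  have top: "topspace (subtopology X C) = C" using sub by auto
  have "closedin (subtopology X C) (C - U)" "closedin (subtopology X C) (C - V)"
    using cl U V closedin_diff by (auto simp: closedin_closed_subtopology)
  moreover have "(C - U) \<union> (C - V) = C" using empty by blast
  ultimately have "C - U = C \<or> C - V = C"
    using irr unfolding irreducible_space_def top by blast
  then show False using assms by blast
qed

lemma openin_scheme_space:
  "openin (scheme_space X) W \<longleftrightarrow>
     (\<exists>U. openin X U \<and> W = {C \<in> scheme_points X. C \<inter> U \<noteq> {}})"
proof -
  let ?P = "\<lambda>W. \<exists>U. openin X U \<and> W = {C \<in> scheme_points X. C \<inter> U \<noteq> {}}"
  have "istopology ?P"
    unfolding istopology_def
  proof (intro conjI allI impI)
    fix S T assume "?P S" "?P T"
    then obtain U V where U: "openin X U" "S = {C \<in> scheme_points X. C \<inter> U \<noteq> {}}"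
      and V: "openin X V" "T = {C \<in> scheme_points X. C \<inter> V \<noteq> {}}" by blast
    have "S \<inter> T = {C \<in> scheme_points X. C \<inter> (U \<inter> V) \<noteq> {}}"
      unfolding U(2) V(2) using irreducible_openin_Int[OF _ U(1) V(1)] by blast
    then show "?P (S \<inter> T)" using U(1) V(1) by blast
  next
    fix K assume "\<forall>S\<in>K. ?P S"
    then have "\<exists>u. \<forall>S\<in>K. openin X (u S) \<and> S = {C \<in> scheme_points X. C \<inter> u S \<noteq> {}}"
      by (rule bchoice)
    then obtain u where u':
      "\<forall>S\<in>K. openin X (u S) \<and> S = {C \<in> scheme_points X. C \<inter> u S \<noteq> {}}" ..
    note u = bspec[OF u', THEN conjunct1] bspec[OF u', THEN conjunct2]
    have mem: "C \<in> S \<longleftrightarrow> C \<in> scheme_points X \<and> C \<inter> u S \<noteq> {}" if "S \<in> K" for C S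
      using arg_cong[OF u(2)[OF that], of "\<lambda>T. C \<in> T"] by simp
    have "\<Union>K = {C. \<exists>S\<in>K. C \<in> S}" by blast
    also have "\<dots> = {C. \<exists>S\<in>K. C \<in> scheme_points X \<and> C \<inter> u S \<noteq> {}}"
      using mem by (metis (no_types, lifting))
    also have "\<dots> = {C \<in> scheme_points X. C \<inter> (\<Union>S\<in>K. u S) \<noteq> {}}" by blast
    finally have "\<Union>K = {C \<in> scheme_points X. C \<inter> (\<Union>S\<in>K. u S) \<noteq> {}}" .
    moreover have "openin X (\<Union>S\<in>K. u S)" using u(1) by blast
    ultimately show "?P (\<Union>K)" by blast
  qed
  then show ?thesis
    unfolding scheme_space_def by (simp add: topology_inverse')
qed


section \<open>Polynomials and the action of the symmetric group\<close>

type_synonym monom = "nat \<Rightarrow>\<^sub>0 nat"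
type_synonym mpoly = "monom \<Rightarrow>\<^sub>0 complex"

definition monoms :: "nat \<Rightarrow> monom set" where
  "monoms n = {m. Poly_Mapping.keys m \<subseteq> {1..n}}"

definition poly_ring :: "nat \<Rightarrow> mpoly ring" where
  "poly_ring n = \<lparr>carrier = {p. Poly_Mapping.keys p \<subseteq> monoms n}, mult = (*), one = 1,
     zero = 0, add = (+)\<rparr>"

text \<open>
  The action with \<open>\<sigma> \<cdot> x\<^sub>i = x\<^bsub>\<sigma> i\<^esub>\<close>: the inner \<open>map_key \<sigma>\<close> sends an exponent vector \<open>m\<close> to
  \<open>m \<circ> \<sigma>\<close>, so the coefficient of \<open>\<sigma> \<cdot> p\<close> at \<open>m\<close> is that of \<open>p\<close> at \<open>m \<circ> \<sigma>\<close>.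
  Both uses of \<open>map_key\<close> are only meaningful for injective keys, hence for bijective \<open>\<sigma>\<close>.
\<close>

definition perm_poly :: "(nat \<Rightarrow> nat) \<Rightarrow> mpoly \<Rightarrow> mpoly" where
  "perm_poly \<sigma> p = Poly_Mapping.map_key (Poly_Mapping.map_key \<sigma>) p"

lemma perm_poly_single:
  assumes "bij \<sigma>"
  shows "perm_poly \<sigma> (Poly_Mapping.single (Poly_Mapping.single i k) c) =
    Poly_Mapping.single (Poly_Mapping.single (\<sigma> i) k) c"
proof -
  have inj: "inj \<sigma>" and surj: "surj \<sigma>" using assms by (auto simp: bij_def)
  have "inj (Poly_Mapping.map_key \<sigma> :: monom \<Rightarrow> monom)"
  proof (rule injI)
    fix m m' :: monom
    assume eq: "Poly_Mapping.map_key \<sigma> m = Poly_Mapping.map_key \<sigma> m'"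
    have "Poly_Mapping.lookup m (\<sigma> j) = Poly_Mapping.lookup m' (\<sigma> j)" for j
      using arg_cong[OF eq, of "\<lambda>x. Poly_Mapping.lookup x j"] inj
      by (simp add: map_key.rep_eq)
    then show "m = m'" using surj by (metis poly_mapping_eqI surjD)
  qed
  moreover have "Poly_Mapping.single i k =
      Poly_Mapping.map_key \<sigma> (Poly_Mapping.single (\<sigma> i) k)"
    by (rule map_key_single[OF inj, symmetric])
  ultimately show ?thesis
    unfolding perm_poly_def by (metis map_key_single)
qed


section \<open>Complex representations of the symmetric group\<close>

record 'v rep =
  space :: "'v set"
  vadd :: "'v \<Rightarrow> 'v \<Rightarrow> 'v"
  vscale :: "complex \<Rightarrow> 'v \<Rightarrow> 'v"
  vact :: "(nat \<Rightarrow> nat) \<Rightarrow> 'v \<Rightarrow> 'v"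

definition rep_iso :: "nat \<Rightarrow> 'v rep \<Rightarrow> 'w rep \<Rightarrow> bool" where
  "rep_iso n V W \<longleftrightarrow> (\<exists>\<phi>. bij_betw \<phi> (space V) (space W) \<and>
     (\<forall>x\<in>space V. \<forall>y\<in>space V. \<phi> (vadd V x y) = vadd W (\<phi> x) (\<phi> y)) \<and>
     (\<forall>c. \<forall>x\<in>space V. \<phi> (vscale V c x) = vscale W c (\<phi> x)) \<and>
     (\<forall>\<sigma>\<in>carrier (sym_group n). \<forall>x\<in>space V. \<phi> (vact V \<sigma> x) = vact W \<sigma> (\<phi> x)))"

text \<open>\<open>\<complex>\<^sup>N\<close> is realised as the functions \<open>nat \<Rightarrow> complex\<close> vanishing from \<open>N\<close> on.\<close>

definition has_dim :: "'v rep \<Rightarrow> nat \<Rightarrow> bool" where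
  "has_dim V N \<longleftrightarrow> (\<exists>\<phi>. bij_betw \<phi> (space V) {f :: nat \<Rightarrow> complex. \<forall>i\<ge>N. f i = 0} \<and>
     (\<forall>x\<in>space V. \<forall>y\<in>space V. \<phi> (vadd V x y) = (\<lambda>i. \<phi> x i + \<phi> y i)) \<and>
     (\<forall>c. \<forall>x\<in>space V. \<phi> (vscale V c x) = (\<lambda>i. c * \<phi> x i)))"

definition rep_dim :: "'v rep \<Rightarrow> nat" where
  "rep_dim V = (THE N. has_dim V N)"

text \<open>
  The quotient \<open>P/I\<close>; a scalar \<open>c\<close> acts as multiplication by the class of the constant \<open>c\<close>.
  The action by images of cosets is well defined when \<open>I\<close> is stable under the symmetric group.
\<close>

definition quot_rep :: "nat \<Rightarrow> mpoly set \<Rightarrow> mpoly set rep" where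
  "quot_rep n I = (let Q = poly_ring n Quot I in
     \<lparr>space = carrier Q, vadd = add Q,
      vscale = (\<lambda>c A. mult Q (I +>\<^bsub>poly_ring n\<^esub> Poly_Mapping.single 0 c) A),
      vact = (\<lambda>\<sigma> A. perm_poly \<sigma> ` A)\<rparr>)"


section \<open>Partitions, Young subgroups and permutation modules\<close>

definition is_partition :: "nat list \<Rightarrow> nat \<Rightarrow> bool" where
  "is_partition lam n \<longleftrightarrow> sorted_wrt (\<ge>) lam \<and> (\<forall>i\<in>set lam. i \<ge> 1) \<and> sum_list lam = n"

definition is_hook :: "nat list \<Rightarrow> bool" where
  "is_hook lam \<longleftrightarrow> (\<exists>k r. lam = k # replicate r 1)"

definition young_block :: "nat list \<Rightarrow> nat \<Rightarrow> nat set" where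
  "young_block lam j = {sum_list (take j lam) <.. sum_list (take (Suc j) lam)}"

definition young_subgroup :: "nat \<Rightarrow> nat list \<Rightarrow> (nat \<Rightarrow> nat) set" where
  "young_subgroup n lam =
     {\<sigma> \<in> carrier (sym_group n). \<forall>j<length lam. \<sigma> ` young_block lam j = young_block lam j}"

text \<open>
  The functions on the left cosets of the Young subgroup with \<open>(\<sigma> f)(C) = f(\<sigma>\<^sup>-\<^sup>1 C)\<close>, so that
  \<open>\<sigma>\<close> sends the indicator function of a coset \<open>C\<close> to that of \<open>\<sigma> C\<close>.
\<close>

definition perm_module :: "nat \<Rightarrow> nat list \<Rightarrow> ((nat \<Rightarrow> nat) set \<Rightarrow> complex) rep" where
  "perm_module n lam = (let G = sym_group n in
     \<lparr>space = {f. \<forall>C. C \<notin> lcosets\<^bsub>G\<^esub> (young_subgroup n lam) \<longrightarrow> f C = 0},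
      vadd = (\<lambda>f g C. f C + g C),
      vscale = (\<lambda>c f C. c * f C),
      vact = (\<lambda>\<sigma> f C. f (inv\<^bsub>G\<^esub> \<sigma> <#\<^bsub>G\<^esub> C))\<rparr>)"


section \<open>The Hilbert scheme of points of affine space\<close>

text \<open>The closed points: the ideals of colength \<open>N\<close>.\<close>

definition hilb_points :: "nat \<Rightarrow> nat \<Rightarrow> mpoly set set" where
  "hilb_points n N = {I. ideal I (poly_ring n) \<and> has_dim (quot_rep n I) N}"

text \<open>
  The standard affine charts. For a set \<open>B\<close> of \<open>N\<close> monomials, the ideals \<open>I\<close> such that \<open>B\<close> is a
  basis of \<open>P/I\<close> form an open affine subscheme. Its coordinate ring is generated by the functions
  \<open>c\<^bsub>m,b\<^esub>\<close>, where \<open>m \<equiv> (\<Sum>b\<in>B. c\<^bsub>m,b\<^esub>(I) b) mod I\<close> for every monomial \<open>m\<close>.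
\<close>

definition hilb_chart :: "nat \<Rightarrow> nat \<Rightarrow> monom set \<Rightarrow> mpoly set set" where
  "hilb_chart n N B = {I \<in> hilb_points n N.
     \<forall>p\<in>carrier (poly_ring n). \<exists>!r. Poly_Mapping.keys r \<subseteq> B \<and> p - r \<in> I}"

definition normal_form :: "mpoly set \<Rightarrow> monom set \<Rightarrow> mpoly \<Rightarrow> mpoly" where
  "normal_form I B p = (THE r. Poly_Mapping.keys r \<subseteq> B \<and> p - r \<in> I)"

definition chart_coord :: "mpoly set \<Rightarrow> monom set \<Rightarrow> monom \<times> monom \<Rightarrow> complex" where
  "chart_coord I B = (\<lambda>(m, b). Poly_Mapping.lookup (normal_form I B (Poly_Mapping.single m 1)) b)"

definition monom_eval :: "('x \<Rightarrow> complex) \<Rightarrow> ('x \<Rightarrow>\<^sub>0 nat) \<Rightarrow> complex" where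
  "monom_eval v t = (\<Prod>x\<in>Poly_Mapping.keys t. v x ^ Poly_Mapping.lookup t x)"

definition poly_eval :: "('x \<Rightarrow> complex) \<Rightarrow> (('x \<Rightarrow>\<^sub>0 nat) \<Rightarrow>\<^sub>0 complex) \<Rightarrow> complex" where
  "poly_eval v F = (\<Sum>t\<in>Poly_Mapping.keys F. Poly_Mapping.lookup F t * monom_eval v t)"

definition chart_polys :: "nat \<Rightarrow> monom set \<Rightarrow> ((monom \<times> monom \<Rightarrow>\<^sub>0 nat) \<Rightarrow>\<^sub>0 complex) set" where
  "chart_polys n B =
     {F. \<forall>t\<in>Poly_Mapping.keys F. Poly_Mapping.keys t \<subseteq> monoms n \<times> B}"

definition hilb_closed :: "nat \<Rightarrow> nat \<Rightarrow> mpoly set set \<Rightarrow> bool" where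
  "hilb_closed n N Z \<longleftrightarrow> Z \<subseteq> hilb_points n N \<and>
     (\<forall>B. B \<subseteq> monoms n \<longrightarrow> finite B \<longrightarrow> card B = N \<longrightarrow>
        (\<exists>S \<subseteq> chart_polys n B.
           Z \<inter> hilb_chart n N B =
             {I \<in> hilb_chart n N B. \<forall>F\<in>S. poly_eval (chart_coord I B) F = 0}))"

definition hilb_topology :: "nat \<Rightarrow> nat \<Rightarrow> mpoly set topology" where
  "hilb_topology n N =
     topology (\<lambda>U. U \<subseteq> hilb_points n N \<and> hilb_closed n N (hilb_points n N - U))"

lemma monom_eval_superset:
  assumes "finite A" "Poly_Mapping.keys t \<subseteq> A"
  shows "monom_eval v t = (\<Prod>x\<in>A. v x ^ Poly_Mapping.lookup t x)"
  unfolding monom_eval_def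
  by (rule prod.mono_neutral_left) (use assms in \<open>auto simp: in_keys_iff\<close>)

lemma monom_eval_add: "monom_eval v (s + t) = monom_eval v s * monom_eval v t"
proof -
  let ?A = "Poly_Mapping.keys s \<union> Poly_Mapping.keys t"
  have "monom_eval v (s + t) = (\<Prod>x\<in>?A. v x ^ Poly_Mapping.lookup (s + t) x)"
    by (rule monom_eval_superset) (use Poly_Mapping.keys_add[of s t] in auto)
  also have "\<dots> = (\<Prod>x\<in>?A. v x ^ Poly_Mapping.lookup s x) * (\<Prod>x\<in>?A. v x ^ Poly_Mapping.lookup t x)"
    by (simp add: lookup_add power_add prod.distrib)
  also have "\<dots> = monom_eval v s * monom_eval v t"
    by (simp add: monom_eval_superset[of ?A s] monom_eval_superset[of ?A t])
  finally show ?thesis .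
qed

lemma poly_eval_superset:
  assumes "finite A" "Poly_Mapping.keys F \<subseteq> A"
  shows "poly_eval v F = (\<Sum>t\<in>A. Poly_Mapping.lookup F t * monom_eval v t)"
  unfolding poly_eval_def
  by (rule sum.mono_neutral_left) (use assms in \<open>auto simp: in_keys_iff\<close>)

lemma poly_eval_add: "poly_eval v (F + G) = poly_eval v F + poly_eval v G"
proof -
  let ?A = "Poly_Mapping.keys F \<union> Poly_Mapping.keys G"
  have "poly_eval v (F + G) = (\<Sum>t\<in>?A. Poly_Mapping.lookup (F + G) t * monom_eval v t)"
    by (rule poly_eval_superset) (use Poly_Mapping.keys_add[of F G] in auto)
  also have "\<dots> = (\<Sum>t\<in>?A. Poly_Mapping.lookup F t * monom_eval v t) +
      (\<Sum>t\<in>?A. Poly_Mapping.lookup G t * monom_eval v t)"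
    by (simp add: lookup_add algebra_simps sum.distrib)
  also have "\<dots> = poly_eval v F + poly_eval v G"
    by (simp add: poly_eval_superset[of ?A F] poly_eval_superset[of ?A G])
  finally show ?thesis .
qed

lemma poly_eval_single: "poly_eval v (Poly_Mapping.single t c) = c * monom_eval v t"
  by (auto simp: poly_eval_def)

lemma poly_eval_zero: "poly_eval v 0 = 0"
  by (simp add: poly_eval_def)

lemma poly_eval_one: "poly_eval v 1 = 1"
  by (simp add: poly_eval_single monom_eval_def flip: single_one)

lemma poly_eval_sum: "poly_eval v (sum f A) = (\<Sum>a\<in>A. poly_eval v (f a))"
  by (induction A rule: infinite_finite_induct) (simp_all add: poly_eval_zero poly_eval_add)

lemma poly_eval_mult: "poly_eval v (F * G) = poly_eval v F * poly_eval v G"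
proof -
  have dec: "H = (\<Sum>t\<in>Poly_Mapping.keys H. Poly_Mapping.single t (Poly_Mapping.lookup H t))"
    for H :: "('a \<Rightarrow>\<^sub>0 nat) \<Rightarrow>\<^sub>0 complex"
    by (rule poly_mapping_eqI)
      (auto simp: lookup_sum lookup_single when_def in_keys_iff if_distrib cong: if_cong)
  have "F * G = (\<Sum>s\<in>Poly_Mapping.keys F. \<Sum>t\<in>Poly_Mapping.keys G.
      Poly_Mapping.single (s + t) (Poly_Mapping.lookup F s * Poly_Mapping.lookup G t))"
    using arg_cong2[OF dec[of F] dec[of G], of "(*)"] by (simp only: sum_product mult_single)
  then have "poly_eval v (F * G) = (\<Sum>s\<in>Poly_Mapping.keys F. \<Sum>t\<in>Poly_Mapping.keys G.
      Poly_Mapping.lookup F s * Poly_Mapping.lookup G t * (monom_eval v s * monom_eval v t))"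
    by (simp add: poly_eval_sum poly_eval_single monom_eval_add)
  also have "\<dots> = poly_eval v F * poly_eval v G"
    unfolding poly_eval_def sum_product by (intro sum.cong refl) (simp add: mult_ac)
  finally show ?thesis .
qed

lemma chart_polys_mult:
  assumes "F \<in> chart_polys n B" "G \<in> chart_polys n B"
  shows "F * G \<in> chart_polys n B"
  unfolding chart_polys_def
proof (intro CollectI ballI)
  fix t assume "t \<in> Poly_Mapping.keys (F * G)"
  then obtain a b where "t = a + b" "a \<in> Poly_Mapping.keys F" "b \<in> Poly_Mapping.keys G"
    using Poly_Mapping.keys_mult[of F G] by blast
  then show "Poly_Mapping.keys t \<subseteq> monoms n \<times> B"
    using assms Poly_Mapping.keys_add[of a b] unfolding chart_polys_def by blast
qed

lemma hilb_closed_empty: "hilb_closed n N {}"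
proof -
  have "1 \<in> chart_polys n B" for B by (simp add: chart_polys_def)
  then have "\<exists>S \<subseteq> chart_polys n B. {} \<inter> hilb_chart n N B =
      {I \<in> hilb_chart n N B. \<forall>F\<in>S. poly_eval (chart_coord I B) F = 0}" for B
    by (intro exI[of _ "{1}"]) (auto simp: poly_eval_one)
  then show ?thesis by (simp add: hilb_closed_def)
qed

lemma hilb_closedD:
  assumes "hilb_closed n N Z" "B \<subseteq> monoms n" "finite B" "card B = N"
  shows "\<exists>S \<subseteq> chart_polys n B. Z \<inter> hilb_chart n N B =
    {I \<in> hilb_chart n N B. \<forall>F\<in>S. poly_eval (chart_coord I B) F = 0}"
  using assms by (simp add: hilb_closed_def)

lemma hilb_closed_Un:
  assumes "hilb_closed n N Y" "hilb_closed n N Z"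
  shows "hilb_closed n N (Y \<union> Z)"
  unfolding hilb_closed_def
proof (intro conjI allI impI)
  show "Y \<union> Z \<subseteq> hilb_points n N" using assms by (simp add: hilb_closed_def)
  fix B assume B: "B \<subseteq> monoms n" "finite B" "card B = N"
  let ?V = "\<lambda>S. {I \<in> hilb_chart n N B. \<forall>F\<in>S. poly_eval (chart_coord I B) F = 0}"
  obtain S where S: "S \<subseteq> chart_polys n B" "Y \<inter> hilb_chart n N B = ?V S"
    using hilb_closedD[OF assms(1) B] by (elim exE conjE)
  obtain T where T: "T \<subseteq> chart_polys n B" "Z \<inter> hilb_chart n N B = ?V T"
    using hilb_closedD[OF assms(2) B] by (elim exE conjE)
  let ?ST = "{F * G | F G. F \<in> S \<and> G \<in> T}"
  have "?ST \<subseteq> chart_polys n B" using S(1) T(1) by (auto intro: chart_polys_mult)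
  moreover have "?V ?ST = ?V S \<union> ?V T"
  proof (intro equalityI subsetI)
    fix I assume I: "I \<in> ?V ?ST"
    show "I \<in> ?V S \<union> ?V T"
    proof (rule ccontr)
      assume "I \<notin> ?V S \<union> ?V T"
      then obtain F G where "F \<in> S" "G \<in> T"
        "poly_eval (chart_coord I B) F \<noteq> 0" "poly_eval (chart_coord I B) G \<noteq> 0"
        using I by blast
      moreover from this have "poly_eval (chart_coord I B) (F * G) = 0" using I by blast
      ultimately show False by (simp add: poly_eval_mult)
    qed
  qed (auto simp: poly_eval_mult)
  ultimately show "\<exists>S \<subseteq> chart_polys n B. (Y \<union> Z) \<inter> hilb_chart n N B = ?V S"
    using S(2) T(2) by (intro exI[of _ ?ST]) (simp add: Int_Un_distrib2)
qed

lemma hilb_closed_Inter: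
  assumes "\<And>Z. Z \<in> K \<Longrightarrow> hilb_closed n N Z"
  shows "hilb_closed n N (hilb_points n N \<inter> \<Inter>K)"
  unfolding hilb_closed_def
proof (intro conjI allI impI)
  fix B assume B: "B \<subseteq> monoms n" "finite B" "card B = N"
  let ?V = "\<lambda>S. {I \<in> hilb_chart n N B. \<forall>F\<in>S. poly_eval (chart_coord I B) F = 0}"
  have "\<forall>Z\<in>K. \<exists>S. S \<subseteq> chart_polys n B \<and> Z \<inter> hilb_chart n N B = ?V S"
    using hilb_closedD[OF assms B] by blast
  then have "\<exists>s. \<forall>Z\<in>K. s Z \<subseteq> chart_polys n B \<and> Z \<inter> hilb_chart n N B = ?V (s Z)"
    by (rule bchoice)
  then obtain s where s':
    "\<forall>Z\<in>K. s Z \<subseteq> chart_polys n B \<and> Z \<inter> hilb_chart n N B = ?V (s Z)" ..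
  note s = bspec[OF s', THEN conjunct1] bspec[OF s', THEN conjunct2]
  have "hilb_chart n N B \<subseteq> hilb_points n N" by (auto simp: hilb_chart_def)
  then have "(hilb_points n N \<inter> \<Inter>K) \<inter> hilb_chart n N B =
      {I \<in> hilb_chart n N B. \<forall>Z\<in>K. I \<in> Z \<inter> hilb_chart n N B}" by blast
  also have "\<dots> = {I \<in> hilb_chart n N B. \<forall>Z\<in>K. I \<in> ?V (s Z)}" using s(2) by auto
  also have "\<dots> = ?V (\<Union>Z\<in>K. s Z)" by blast
  finally show "\<exists>S \<subseteq> chart_polys n B. (hilb_points n N \<inter> \<Inter>K) \<inter> hilb_chart n N B = ?V S"
    using s(1) by (intro exI[of _ "\<Union>Z\<in>K. s Z"]) blast
qed auto

lemma openin_hilb_topology: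
  "openin (hilb_topology n N) U \<longleftrightarrow>
     U \<subseteq> hilb_points n N \<and> hilb_closed n N (hilb_points n N - U)"
proof -
  let ?X = "hilb_points n N"
  have "istopology (\<lambda>U. U \<subseteq> ?X \<and> hilb_closed n N (?X - U))"
    unfolding istopology_def
  proof (intro conjI allI impI)
    fix U V assume "U \<subseteq> ?X \<and> hilb_closed n N (?X - U)" "V \<subseteq> ?X \<and> hilb_closed n N (?X - V)"
    then show "hilb_closed n N (?X - U \<inter> V)" "U \<inter> V \<subseteq> ?X"
      by (auto simp: Diff_Int hilb_closed_Un)
  next
    fix K assume K: "\<forall>U\<in>K. U \<subseteq> ?X \<and> hilb_closed n N (?X - U)"
    then have "hilb_closed n N (?X \<inter> \<Inter>((\<lambda>U. ?X - U) ` K))"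
      by (intro hilb_closed_Inter) auto
    moreover have "?X \<inter> \<Inter>((\<lambda>U. ?X - U) ` K) = ?X - \<Union>K" by auto
    ultimately show "hilb_closed n N (?X - \<Union>K)" by simp
    show "\<Union>K \<subseteq> ?X" using K by blast
  qed
  then show ?thesis unfolding hilb_topology_def by (simp add: topology_inverse')
qed

lemma topspace_hilb_topology: "topspace (hilb_topology n N) = hilb_points n N"
proof -
  have "openin (hilb_topology n N) (hilb_points n N)"
    by (simp add: openin_hilb_topology hilb_closed_empty)
  then show ?thesis
    by (metis openin_hilb_topology openin_subset openin_topspace subset_antisym)
qed

lemma closedin_hilb_topology: "closedin (hilb_topology n N) Z \<longleftrightarrow> hilb_closed n N Z"
proof -
  have "Z \<subseteq> hilb_points n N \<Longrightarrow> hilb_points n N - (hilb_points n N - Z) = Z" by blast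
  then show ?thesis
    by (auto simp: closedin_def topspace_hilb_topology openin_hilb_topology hilb_closed_def)
qed


section \<open>The invariant Hilbert scheme\<close>

text \<open>
  Its closed points are the stable ideals \<open>I\<close> with \<open>P/I \<cong> \<rho>\<close>, with the topology induced from the
  Hilbert scheme of \<open>dim \<rho>\<close> points.
\<close>

definition inv_hilb_ideals :: "nat \<Rightarrow> 'v rep \<Rightarrow> mpoly set set" where
  "inv_hilb_ideals n \<rho> = {I. ideal I (poly_ring n) \<and>
     (\<forall>\<sigma>\<in>carrier (sym_group n). perm_poly \<sigma> ` I = I) \<and> rep_iso n (quot_rep n I) \<rho>}"

definition inv_hilb_closed_points :: "nat \<Rightarrow> 'v rep \<Rightarrow> mpoly set topology" where
  "inv_hilb_closed_points n \<rho> =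
     subtopology (hilb_topology n (rep_dim \<rho>)) (inv_hilb_ideals n \<rho>)"

definition inv_hilb :: "nat \<Rightarrow> 'v rep \<Rightarrow> mpoly set set topology" where
  "inv_hilb n \<rho> = scheme_space (inv_hilb_closed_points n \<rho>)"

end

theory Submission
  imports
    Defs
    "HOL-Computational_Algebra.Computational_Algebra"
    "HOL-Library.Function_Algebras"
begin

text \<open>
  Write \<open>n = k + r\<close> and \<open>\<lambda> = (k, 1, \<dots>, 1)\<close> with \<open>r\<close> ones after \<open>k\<close>. For pairwise distinct \<open>a, c\<^sub>1, \<dots>, c\<^sub>r\<close>
  the vanishing ideal of the orbit of \<open>(a, \<dots>, a, c\<^sub>1, \<dots>, c\<^sub>r)\<close> is a point of the invariant Hilbert
  scheme. The proof shows that every point of the scheme is determined by parameters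
  \<open>(a, c\<^sub>1, \<dots>, c\<^sub>r)\<close>, distinct or not, and that its coordinates are polynomials in the parameters.

  The link is a set of relations with parameters \<open>a\<close> and \<open>b\<^sub>l = c\<^sub>l - a\<close>, written in the shifted variables
  \<open>y\<^sub>i = x\<^sub>i - a\<close>: the coefficients of \<open>(\<Prod>i. s - y\<^sub>i) - s\<^sup>k (\<Prod>l. s - b\<^sub>l)\<close> and all products of \<open>r + 1\<close> distinct
  \<open>y\<^sub>i\<close> (\<open>hook_relations\<close>). Three facts about them carry the proof.

  First, modulo these relations, over any commutative coefficient ring, a set of monomials
  that depends on \<open>k\<close> and \<open>r\<close> only spans the polynomial ring (\<open>hook_monoms_span\<close>). These are the
  Garsia-Procesi monomials of a hook. The proof is by induction on \<open>n\<close>: filter the quotient by the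
  multiples of \<open>1, y\<^sub>n, y\<^sub>n (y\<^sub>n - b\<^sub>1), \<dots>\<close>; the layers satisfy the relations for \<open>(k - 1, r)\<close> and for
  \<open>(k, r - 1)\<close> in one variable less. Second, along the same filtration, the monomials are linearly
  independent in every stable quotient in which the Vandermonde determinant of \<open>r + 1\<close> variables
  survives (\<open>hook_monoms_indep\<close>). Third, every quotient isomorphic to the permutation module satisfies
  the relations for some parameters (\<open>hook_relations_hold\<close>): its invariants are the constants, and
  the vectors on which the symmetric group of \<open>r + 1\<close> variables acts by the sign form a line spanned by the
  Vandermonde determinant. The eigenvalues of the remaining variables and of the symmetric functions
  on this line give \<open>a\<close> and the \<open>b\<^sub>l\<close>; the products of \<open>r + 1\<close> distinct \<open>y\<^sub>i\<close> generate an ideal without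
  alternating elements, so that dividing by it does not affect independence of the monomials, and it
  vanishes for reasons of dimension.

  Hence the invariant Hilbert scheme lies in one standard chart of the Hilbert scheme, that of the
  hook monomials. Any two of its points are joined by a curve of parameters whose general member is an
  orbit, and along the curve the chart coordinates are polynomials in the curve parameter
  (\<open>family_normal_forms\<close>). A closed set containing infinitely many points of the curve
  contains all of them (\<open>closed_along_curve\<close>), so two proper closed subsets cannot cover the space.
\<close>

section \<open>Polynomials in finitely many variables\<close>

text \<open>Polynomials over an arbitrary coefficient ring, so that the coefficients may themselves depend
  polynomially on a parameter; \<open>Const\<close> and \<open>Var\<close> are the constants and the variables, and \<open>polys n\<close> consists of the
  polynomials in the first \<open>n\<close> variables.\<close>

type_synonym 'c mp = "(nat \<Rightarrow>\<^sub>0 nat) \<Rightarrow>\<^sub>0 'c"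

definition Const :: "'c::zero \<Rightarrow> 'c mp" where
  "Const c = Poly_Mapping.single 0 c"

definition Var :: "nat \<Rightarrow> 'c::zero_neq_one mp" where
  "Var i = Poly_Mapping.single (Poly_Mapping.single i 1) 1"

definition polys :: "nat \<Rightarrow> 'c::zero mp set" where
  "polys n = {p. Poly_Mapping.keys p \<subseteq> monoms n}"

lemma Const_0 [simp]: "Const 0 = 0"
  and Const_1 [simp]: "Const 1 = 1"
  and Const_add: "Const (a + b) = Const a + Const b"
  and Const_mult: "Const (a * b) = Const a * Const b"
  and Const_minus: "Const (- c) = - Const c"
  and Const_diff: "Const (c - d) = Const c - Const d"
  for a b :: "'c::semiring_1" and c d :: "'d::ring_1"
  by (simp_all add: Const_def single_add mult_single single_uminus single_diff)

lemma Const_sum: "Const (sum f A) = (\<Sum>x\<in>A. Const (f x :: 'c::semiring_1))"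
  by (induction A rule: infinite_finite_induct) (auto simp: Const_add)

lemma Const_eq_0_iff [simp]: "Const c = 0 \<longleftrightarrow> c = 0"
  by (metis Const_def lookup_single_eq lookup_zero single_zero)

lemma single_sum_keys:
  "p = (\<Sum>m\<in>Poly_Mapping.keys p. Poly_Mapping.single m (Poly_Mapping.lookup p m))"
  by (rule poly_mapping_eqI)
    (auto simp: lookup_sum lookup_single when_def in_keys_iff if_distrib cong: if_cong)

lemma lookup_Const_mult: "Poly_Mapping.lookup (Const c * p) m = c * Poly_Mapping.lookup p m"
  for p :: "'c::comm_ring_1 mp"
proof -
  have "Const c * p = (\<Sum>m\<in>Poly_Mapping.keys p. Poly_Mapping.single m (c * Poly_Mapping.lookup p m))"
    by (subst single_sum_keys[of p]) (simp add: Const_def sum_distrib_left mult_single)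
  then show ?thesis
    by (auto simp: lookup_sum lookup_single when_def in_keys_iff if_distrib cong: if_cong)
qed

lemma monoms_0 [simp]: "0 \<in> monoms n"
  by (simp add: monoms_def)

lemma monoms_add: "a \<in> monoms n \<Longrightarrow> b \<in> monoms n \<Longrightarrow> a + b \<in> monoms n"
  using Poly_Mapping.keys_add[of a b] by (auto simp: monoms_def)

lemma monoms_single: "i \<in> {1..n} \<Longrightarrow> Poly_Mapping.single i e \<in> monoms n"
  by (simp add: monoms_def)

lemma monoms_mono: "m \<le> n \<Longrightarrow> monoms m \<subseteq> monoms n"
  by (force simp: monoms_def)

lemma polys_mono: "m \<le> n \<Longrightarrow> polys m \<subseteq> polys n"
  using monoms_mono[of m n] by (auto simp: polys_def)

lemma polys_0 [simp]: "0 \<in> polys n"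
  by (simp add: polys_def)

lemma polys_Const [simp]: "Const c \<in> polys n"
  by (auto simp: polys_def Const_def)

lemma polys_1 [simp]: "(1 :: 'c::comm_ring_1 mp) \<in> polys n"
  using polys_Const[of "1::'c"] by simp

lemma polys_Var: "i \<in> {1..n} \<Longrightarrow> Var i \<in> polys n"
  by (auto simp: polys_def Var_def monoms_single)

lemma polys_add: "p \<in> polys n \<Longrightarrow> q \<in> polys n \<Longrightarrow> p + q \<in> polys n"
  using Poly_Mapping.keys_add[of p q] by (auto simp: polys_def)

lemma polys_uminus: "p \<in> polys n \<Longrightarrow> - p \<in> polys n" for p :: "'c::comm_ring_1 mp"
  by (auto simp: polys_def in_keys_iff subset_iff)

lemma polys_diff: "p \<in> polys n \<Longrightarrow> q \<in> polys n \<Longrightarrow> p - q \<in> polys n" for p :: "'c::comm_ring_1 mp"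
  using polys_add[of p n "- q"] polys_uminus[of q n] by simp

lemma polys_mult: "p \<in> polys n \<Longrightarrow> q \<in> polys n \<Longrightarrow> p * q \<in> polys n" for p :: "'c::comm_ring_1 mp"
  using Poly_Mapping.keys_mult[of p q] monoms_add by (fastforce simp: polys_def)

lemma polys_sum: "(\<And>x. x \<in> A \<Longrightarrow> f x \<in> polys n) \<Longrightarrow> sum f A \<in> polys n"
  by (induction A rule: infinite_finite_induct) (auto simp: polys_add)

lemma polys_prod: "(\<And>x. x \<in> A \<Longrightarrow> f x \<in> polys n) \<Longrightarrow> prod f A \<in> polys n"
  for f :: "_ \<Rightarrow> 'c::comm_ring_1 mp"
  by (induction A rule: infinite_finite_induct) (auto simp: polys_mult)

lemma polys_prod_list: "(\<And>x. x \<in> set xs \<Longrightarrow> f x \<in> polys n) \<Longrightarrow> prod_list (map f xs) \<in> polys n"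
  for f :: "_ \<Rightarrow> 'c::comm_ring_1 mp"
  by (induction xs) (auto simp: polys_mult)

lemma polys_power: "p \<in> polys n \<Longrightarrow> p ^ e \<in> polys n" for p :: "'c::comm_ring_1 mp"
  by (induction e) (auto simp: polys_mult)

lemma Var_power: "(Var i :: 'c::comm_ring_1 mp) ^ e = Poly_Mapping.single (Poly_Mapping.single i e) 1"
  by (induction e) (simp_all add: Var_def mult_single single_add[symmetric] single_one)

lemma monomial_prod:
  "finite A \<Longrightarrow> Poly_Mapping.keys m \<subseteq> A \<Longrightarrow>
    Poly_Mapping.single m (1 :: 'c::comm_ring_1) = (\<Prod>i\<in>A. Var i ^ Poly_Mapping.lookup m i)"
proof -
  assume A: "finite A" "Poly_Mapping.keys m \<subseteq> A"
  have *: "finite A \<Longrightarrow> (\<Prod>i\<in>A. Poly_Mapping.single (g i) (1::'c)) = Poly_Mapping.single (sum g A) 1"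
    for g :: "nat \<Rightarrow> nat \<Rightarrow>\<^sub>0 nat"
    by (induction A rule: finite_induct) (auto simp: mult_single)
  have "m = (\<Sum>i\<in>A. Poly_Mapping.single i (Poly_Mapping.lookup m i))"
    by (rule poly_mapping_eqI)
      (use A in \<open>auto simp: lookup_sum lookup_single when_def in_keys_iff if_distrib cong: if_cong\<close>)
  then show ?thesis
    using *[OF A(1), of "\<lambda>i. Poly_Mapping.single i (Poly_Mapping.lookup m i)"]
    by (simp add: Var_power)
qed

lemma polys_induct [consumes 1, case_names const add Var]:
  fixes p :: "'c::comm_ring_1 mp"
  assumes "p \<in> polys n"
    and const: "\<And>c. P (Const c)"
    and add: "\<And>p q. p \<in> polys n \<Longrightarrow> q \<in> polys n \<Longrightarrow> P p \<Longrightarrow> P q \<Longrightarrow> P (p + q)"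
    and Var: "\<And>i p. i \<in> {1..n} \<Longrightarrow> p \<in> polys n \<Longrightarrow> P p \<Longrightarrow> P (Var i * p)"
  shows "P p"
proof -
  have pow: "P (Var i ^ e * q) \<and> Var i ^ e * q \<in> polys n"
    if "P q" "q \<in> polys n" "i \<in> {1..n}" for i e q
    using that by (induction e) (auto intro!: Var polys_mult polys_Var simp: mult.assoc)
  have pr: "P ((\<Prod>i\<in>A. Var i ^ f i) * Const c) \<and> (\<Prod>i\<in>A. Var i ^ f i) * Const c \<in> polys n"
    if "finite A" "A \<subseteq> {1..n}" for A f c
    using that
  proof (induction A rule: finite_induct)
    case empty then show ?case by (simp add: const)
  next
    case (insert x A)
    then show ?case using pow[of "(\<Prod>i\<in>A. Var i ^ f i) * Const c" x "f x"] by (simp add: mult.assoc)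
  qed
  have mono: "P (Poly_Mapping.single m c) \<and> Poly_Mapping.single m c \<in> polys n"
    if "m \<in> monoms n" for m c
  proof -
    have "Poly_Mapping.single m c = Poly_Mapping.single m 1 * Const c"
      by (simp add: Const_def mult_single)
    also have "Poly_Mapping.single m (1::'c) = (\<Prod>i\<in>{1..n}. Var i ^ Poly_Mapping.lookup m i)"
      using that by (intro monomial_prod) (auto simp: monoms_def)
    finally show ?thesis using pr[of "{1..n}"] by simp
  qed
  have "P (\<Sum>m\<in>A. Poly_Mapping.single m (f m)) \<and> (\<Sum>m\<in>A. Poly_Mapping.single m (f m)) \<in> polys n"
    if "finite A" "A \<subseteq> monoms n" for A f
    using that
  proof (induction A rule: finite_induct)
    case empty then show ?case using const[of 0] by simp
  next
    case (insert x F) then show ?case using mono[of x] by (auto intro: add polys_add)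
  qed
  from this[of "Poly_Mapping.keys p" "Poly_Mapping.lookup p"] assms(1)
  show ?thesis using single_sum_keys[of p] by (auto simp: polys_def)
qed

text \<open>Division by a monic linear polynomial in the last variable.\<close>

lemma polys_Var_division:
  fixes p :: "'c::comm_ring_1 mp"
  assumes "p \<in> polys (Suc n)"
  obtains p0 p1 where "p0 \<in> polys n" "p1 \<in> polys (Suc n)" "p = p0 + (Var (Suc n) - Const c) * p1"
proof -
  let ?u = "Var (Suc n) - Const c :: 'c mp"
  have "\<exists>p0 p1. p0 \<in> polys n \<and> p1 \<in> polys (Suc n) \<and> p = p0 + ?u * p1" using assms
  proof (induction p rule: polys_induct)
    case (const d)
    then show ?case by (intro exI[of _ "Const d"] exI[of _ 0]) simp
  next
    case (add p q)
    then obtain p0 p1 q0 q1 where *: "p0 \<in> polys n" "p1 \<in> polys (Suc n)" "p = p0 + ?u * p1"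
      "q0 \<in> polys n" "q1 \<in> polys (Suc n)" "q = q0 + ?u * q1" by blast
    have "p + q = (p0 + q0) + ?u * (p1 + q1)" unfolding * by (simp add: algebra_simps)
    with * show ?case using polys_add by blast
  next
    case (Var i p)
    then obtain p0 p1 where p: "p0 \<in> polys n" "p1 \<in> polys (Suc n)" "p = p0 + ?u * p1" by blast
    have V: "Var i \<in> (polys (Suc n) :: 'c mp set)" using Var by (intro polys_Var) auto
    show ?case
    proof (cases "i = Suc n")
      case False
      then have "Var i \<in> (polys n :: 'c mp set)" using Var by (intro polys_Var) auto
      moreover have "Var i * p = Var i * p0 + ?u * (Var i * p1)"
        unfolding p(3) by (simp add: algebra_simps)
      ultimately show ?thesis using p V polys_mult by blast
    next
      case True
      have "p0 \<in> polys (Suc n)" using p polys_mono[of n "Suc n"] by auto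
      moreover have "Var i * p = Const c * p0 + ?u * (p0 + Var i * p1)"
        unfolding p(3) True by (simp add: algebra_simps)
      ultimately show ?thesis using p V polys_mult polys_add polys_Const by metis
    qed
  qed
  then show ?thesis using that by blast
qed

section \<open>Submodules and chains\<close>

text \<open>Subsets of the polynomial ring that are modules over the polynomials in the first \<open>n\<close> variables. They
  need not lie in \<open>polys n\<close>: an ideal in more variables is one of them, which is what an
  induction on the number of variables needs. \<open>adjoin n J w\<close> is the submodule generated by \<open>J\<close> and \<open>w\<close>.\<close>

definition submod :: "nat \<Rightarrow> 'c::comm_ring_1 mp set \<Rightarrow> bool" where
  "submod n J \<longleftrightarrow> 0 \<in> J \<and> (\<forall>p\<in>J. \<forall>q\<in>J. p + q \<in> J) \<and> (\<forall>q\<in>polys n. \<forall>p\<in>J. q * p \<in> J)"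

definition adjoin :: "nat \<Rightarrow> 'c::comm_ring_1 mp set \<Rightarrow> 'c mp \<Rightarrow> 'c mp set" where
  "adjoin n J w = {j + w * q | j q. j \<in> J \<and> q \<in> polys n}"

lemma submod_0: "submod n J \<Longrightarrow> 0 \<in> J"
  and submod_add: "submod n J \<Longrightarrow> p \<in> J \<Longrightarrow> q \<in> J \<Longrightarrow> p + q \<in> J"
  and submod_mult: "submod n J \<Longrightarrow> r \<in> polys n \<Longrightarrow> p \<in> J \<Longrightarrow> r * p \<in> J"
  by (auto simp: submod_def)

lemma submod_mult2: "submod n J \<Longrightarrow> r \<in> polys n \<Longrightarrow> p \<in> J \<Longrightarrow> p * r \<in> J"
  using submod_mult by (metis mult.commute)

lemma submod_uminus: "submod n J \<Longrightarrow> p \<in> J \<Longrightarrow> - p \<in> J"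
  using submod_mult[of n J "- 1" p] polys_uminus[of 1 n] by simp

lemma submod_diff: "submod n J \<Longrightarrow> p \<in> J \<Longrightarrow> q \<in> J \<Longrightarrow> p - q \<in> J"
  using submod_add[of n J p "- q"] submod_uminus by fastforce

lemma submod_sum: "submod n J \<Longrightarrow> (\<And>x. x \<in> A \<Longrightarrow> f x \<in> J) \<Longrightarrow> sum f A \<in> J"
  by (induction A rule: infinite_finite_induct) (auto simp: submod_0 submod_add)

lemma submod_mono: "submod n J \<Longrightarrow> m \<le> n \<Longrightarrow> submod m J"
  using polys_mono[of m n] unfolding submod_def by blast

lemma adjoin_base: "j \<in> J \<Longrightarrow> j \<in> adjoin n J w"
  unfolding adjoin_def by (rule CollectI, rule exI[of _ j], rule exI[of _ 0]) simp

lemma submod_adjoin: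
  fixes J :: "'c::comm_ring_1 mp set"
  assumes "submod n J" shows "submod n (adjoin n J w)"
  unfolding submod_def
proof (intro conjI ballI)
  show "0 \<in> adjoin n J w" using submod_0[OF assms] by (rule adjoin_base)
next
  fix p q assume "p \<in> adjoin n J w" "q \<in> adjoin n J w"
  then obtain j r j' r' where *: "p = j + w * r" "j \<in> J" "r \<in> polys n" "q = j' + w * r'" "j' \<in> J"
      "r' \<in> polys n" unfolding adjoin_def by blast
  have "p + q = (j + j') + w * (r + r')" unfolding * by (simp add: algebra_simps)
  moreover have "j + j' \<in> J" "r + r' \<in> polys n"
    using assms * by (auto simp: polys_add submod_add)
  ultimately show "p + q \<in> adjoin n J w" unfolding adjoin_def by blast
next
  fix q p :: "'c mp" assume "q \<in> polys n" "p \<in> adjoin n J w"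
  then obtain j r where *: "p = j + w * r" "j \<in> J" "r \<in> polys n" unfolding adjoin_def by blast
  have "q * p = q * j + w * (q * r)" unfolding * by (simp add: algebra_simps)
  moreover have "q * j \<in> J" "q * r \<in> polys n"
    using assms * \<open>q \<in> polys n\<close> by (auto simp: polys_mult submod_mult)
  ultimately show "q * p \<in> adjoin n J w" unfolding adjoin_def by blast
qed

lemma adjoin_gen: "submod n J \<Longrightarrow> q \<in> polys n \<Longrightarrow> w * q \<in> adjoin n J w"
  unfolding adjoin_def by (rule CollectI, rule exI[of _ 0], rule exI[of _ q]) (simp add: submod_0)

lemma keys_Const_mult: "Poly_Mapping.keys (Const c * p) \<subseteq> Poly_Mapping.keys p"
  for p :: "'c::comm_ring_1 mp"
  by (auto simp: in_keys_iff lookup_Const_mult)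

lemma keys_Const_comb:
  fixes p q :: "'c::comm_ring_1 mp"
  assumes "Poly_Mapping.keys p \<subseteq> B" "Poly_Mapping.keys q \<subseteq> B"
  shows "Poly_Mapping.keys (p + Const c * q) \<subseteq> B"
  using Poly_Mapping.keys_add[of p "Const c * q"] keys_Const_mult[of c q] assms by blast

text \<open>Let \<open>w\<^sub>j\<close> be \<open>v\<close> times the product of the first \<open>j\<close> factors \<open>x - c\<close> in the last variable \<open>x\<close>. If
  monomials \<open>B\<^sub>j\<close> in the other variables span the layer generated by \<open>w\<^sub>j\<close> modulo \<open>w\<^sub>j\<^sub>+\<^sub>1\<close>, and
  the \<open>B\<^sub>j\<close> decrease, then the products \<open>x\<^sup>j b\<close> with \<open>b \<in> B\<^sub>j\<close> span everything. Their
  combinations are encoded as the values at \<open>x\<close> of polynomials whose \<open>j\<close>-th coefficient is supported on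
  \<open>B\<^sub>j\<close>; that the \<open>B\<^sub>j\<close> decrease makes this class stable under multiplication by \<open>x - c\<close>, up to the shift of \<open>j\<close>.\<close>

lemma chain_span:
  fixes v :: "'c::comm_ring_1 mp"
  assumes "submod (Suc n) J"
    and "v * (\<Prod>c\<leftarrow>cs. Var (Suc n) - Const c) \<in> J"
    and "\<And>j. B (Suc j) \<subseteq> B j"
    and "\<And>pre c suf p. cs = pre @ c # suf \<Longrightarrow> p \<in> polys n \<Longrightarrow>
      \<exists>s. Poly_Mapping.keys s \<subseteq> B (length pre) \<and>
        (v * (\<Prod>c\<leftarrow>pre. Var (Suc n) - Const c)) * (p - s) \<in>
          adjoin (Suc n) J (v * (\<Prod>c\<leftarrow>pre @ [c]. Var (Suc n) - Const c))"
    and "p \<in> polys (Suc n)"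
  shows "\<exists>S. (\<forall>j. Poly_Mapping.keys (coeff S j) \<subseteq> B j) \<and> (\<forall>j\<ge>length cs. coeff S j = 0) \<and>
    v * (p - poly S (Var (Suc n))) \<in> J"
  using assms
proof (induction cs arbitrary: v B p)
  case Nil
  then show ?case using submod_mult2[of "Suc n" J p v] by (intro exI[of _ 0]) auto
next
  case (Cons c cs)
  define u where "u = Var (Suc n) - Const c"
  obtain p0 p1 where p: "p0 \<in> polys n" "p1 \<in> polys (Suc n)" "p = p0 + u * p1"
    using polys_Var_division[OF Cons.prems(5), of c] unfolding u_def by blast
  obtain s where s: "Poly_Mapping.keys s \<subseteq> B 0" "v * (p0 - s) \<in> adjoin (Suc n) J (v * u)"
    using Cons.prems(4)[of "[]" c cs, OF _ p(1)] unfolding u_def by auto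
  then obtain j q where jq: "v * (p0 - s) = j + v * u * q" "j \<in> J" "q \<in> polys (Suc n)"
    unfolding adjoin_def by blast
  have "\<exists>S. (\<forall>j. Poly_Mapping.keys (coeff S j) \<subseteq> B (Suc j)) \<and> (\<forall>j\<ge>length cs. coeff S j = 0) \<and>
    (v * u) * ((q + p1) - poly S (Var (Suc n))) \<in> J"
  proof (rule Cons.IH[OF Cons.prems(1)])
    show "v * u * (\<Prod>c\<leftarrow>cs. Var (Suc n) - Const c) \<in> J"
      using Cons.prems(2) by (simp add: u_def mult_ac)
    show "q + p1 \<in> polys (Suc n)" using jq p polys_add by blast
    fix pre c' suf and p' :: "'c mp" assume "cs = pre @ c' # suf" "p' \<in> polys n"
    then show "\<exists>s. Poly_Mapping.keys s \<subseteq> B (Suc (length pre)) \<and>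
        (v * u * (\<Prod>c\<leftarrow>pre. Var (Suc n) - Const c)) * (p' - s) \<in>
          adjoin (Suc n) J (v * u * (\<Prod>c\<leftarrow>pre @ [c']. Var (Suc n) - Const c))"
      using Cons.prems(4)[of "c # pre" c' suf p'] by (simp add: u_def mult.assoc)
  qed (use Cons.prems(3) in auto)
  then obtain S where S: "\<And>j. Poly_Mapping.keys (coeff S j) \<subseteq> B (Suc j)"
    "\<And>j. j\<ge>length cs \<Longrightarrow> coeff S j = 0" "(v * u) * ((q + p1) - poly S (Var (Suc n))) \<in> J" by blast
  define T where "T = [:s:] + [:- Const c, 1:] * S"
  have T: "coeff T j = (case j of 0 \<Rightarrow> s - Const c * coeff S 0
      | Suc i \<Rightarrow> coeff S i - Const c * coeff S j)" for j
    by (cases j) (simp_all add: T_def coeff_pCons)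
  show ?case
  proof (intro exI[of _ T] conjI allI impI)
    fix j show "Poly_Mapping.keys (coeff T j) \<subseteq> B j"
    proof (cases j)
      case 0
      have "Poly_Mapping.keys (s + Const (- c) * coeff S 0) \<subseteq> B 0"
        using s(1) S(1)[of 0] Cons.prems(3)[of 0] by (intro keys_Const_comb) auto
      then show ?thesis unfolding T 0 by (simp add: Const_minus)
    next
      case (Suc i)
      have "Poly_Mapping.keys (coeff S i + Const (- c) * coeff S j) \<subseteq> B j"
        using S(1)[of i] S(1)[of j] Cons.prems(3)[of j] Suc by (intro keys_Const_comb) auto
      then show ?thesis unfolding T Suc by (simp add: Const_minus)
    qed
  next
    fix j assume "length (c # cs) \<le> j"
    then show "coeff T j = 0" using S(2) unfolding T by (auto split: nat.split)
  next
    have "v * (p - poly T (Var (Suc n))) = v * (p0 - s) + v * u * (p1 - poly S (Var (Suc n)))"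
      by (simp add: p T_def u_def algebra_simps)
    also have "\<dots> = j + (v * u) * ((q + p1) - poly S (Var (Suc n)))"
      unfolding jq(1) by (simp add: algebra_simps)
    also have "\<dots> \<in> J" using jq S(3) Cons.prems(1) submod_add by blast
    finally show "v * (p - poly T (Var (Suc n))) \<in> J" .
  qed
qed

text \<open>The dual of \<open>chain_span\<close>: independence in the layers gives independence of the products \<open>x\<^sup>j b\<close>.
  Synthetic division peels off one layer at a time.\<close>

lemma chain_indep:
  fixes v :: "'c::comm_ring_1 mp"
  assumes J: "submod (Suc n) J"
    and anti: "\<And>j. B (Suc j) \<subseteq> B j"
    and Bn: "B 0 \<subseteq> monoms (Suc n)"
    and step: "\<And>pre c suf s. cs = pre @ c # suf \<Longrightarrow> Poly_Mapping.keys s \<subseteq> B (length pre) \<Longrightarrow>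
        (v * (\<Prod>c\<leftarrow>pre. Var (Suc n) - Const c)) * s \<in>
          adjoin (Suc n) J (v * (\<Prod>c\<leftarrow>pre @ [c]. Var (Suc n) - Const c)) \<Longrightarrow> s = 0"
    and S: "\<And>j. Poly_Mapping.keys (coeff S j) \<subseteq> B j" "\<And>j. j \<ge> length cs \<Longrightarrow> coeff S j = 0"
    and mem: "v * poly S (Var (Suc n)) \<in> J"
  shows "S = 0"
  using anti Bn step S mem
proof (induction cs arbitrary: v B S)
  case Nil
  then show ?case by (auto intro: poly_eqI)
next
  case (Cons c cs)
  define u where "u = Var (Suc n) - Const c"
  define S' where "S' = synthetic_div S (Const c)"
  have Sdec: "S = [:poly S (Const c):] + [:- Const c, 1:] * S'"
    using synthetic_div_correct'[of "Const c" S] unfolding S'_def by (simp add: algebra_simps)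
  have co: "coeff S 0 = poly S (Const c) - Const c * coeff S' 0"
    "coeff S (Suc j) = coeff S' j - Const c * coeff S' (Suc j)" for j
    by (subst Sdec, simp add: coeff_pCons)+
  have d: "degree S' \<le> length cs"
    unfolding S'_def using Cons.prems(5)
    by (metis degree_le degree_synthetic_div diff_Suc_1 diff_le_mono le_less_Suc_eq length_Cons not_less_eq order.order_iff_strict)
  have S'0: "coeff S' j = 0" if "j \<ge> length cs" for j
  proof (cases "j = length cs")
    case False
    then show ?thesis using d that by (intro coeff_eq_0) auto
  next
    case True
    have "coeff S' (Suc j) = 0" using d True by (intro coeff_eq_0) auto
    then show ?thesis using co(2)[of j] Cons.prems(5)[of "Suc j"] True by simp
  qed
  have S'B: "Poly_Mapping.keys (coeff S' j) \<subseteq> B (Suc j)" for j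
  proof (induction "length cs - j" arbitrary: j)
    case 0
    then show ?case using S'0 by simp
  next
    case (Suc i)
    then have "Poly_Mapping.keys (coeff S' (Suc j)) \<subseteq> B (Suc (Suc j))" by auto
    then have "Poly_Mapping.keys (coeff S (Suc j) + Const c * coeff S' (Suc j)) \<subseteq> B (Suc j)"
      using Cons.prems(1,4) by (intro keys_Const_comb) auto
    then show ?case unfolding co(2) by simp
  qed
  have k0: "Poly_Mapping.keys (poly S (Const c)) \<subseteq> B 0"
  proof -
    have "Poly_Mapping.keys (coeff S 0 + Const c * coeff S' 0) \<subseteq> B 0"
      using Cons.prems(4)[of 0] S'B[of 0] Cons.prems(1)[of 0] by (intro keys_Const_comb) auto
    then show ?thesis unfolding co(1) by simp
  qed
  have Bmono: "B j \<subseteq> B 0" for j using Cons.prems(1) by (rule lift_Suc_antimono_le) simp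
  have inP: "poly S' (Var (Suc n)) \<in> polys (Suc n)"
  proof -
    have "coeff S' j \<in> polys (Suc n)" for j
      using S'B[of j] Bmono[of "Suc j"] Cons.prems(2) unfolding polys_def by blast
    then show ?thesis unfolding poly_altdef
      by (intro polys_sum polys_mult polys_power polys_Var) auto
  qed
  have eq: "v * poly S (Var (Suc n)) = v * poly S (Const c) + v * u * poly S' (Var (Suc n))"
    by (subst (1) Sdec) (simp add: u_def algebra_simps)
  have "v * poly S (Const c) = v * poly S (Var (Suc n)) + (v * u) * (- poly S' (Var (Suc n)))"
    using eq by simp
  then have "v * poly S (Const c) \<in> adjoin (Suc n) J (v * u)"
    using Cons.prems(6) inP polys_uminus unfolding adjoin_def by blast
  then have S0: "poly S (Const c) = 0"
    using Cons.prems(3)[of "[]" c cs "poly S (Const c)"] k0 by (simp add: u_def)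
  have "S' = 0"
  proof (rule Cons.IH[of "B \<circ> Suc" "v * u"])
    show "v * u * poly S' (Var (Suc n)) \<in> J" using eq S0 Cons.prems(6) by simp
    fix pre c' suf s
    assume "cs = pre @ c' # suf" "Poly_Mapping.keys s \<subseteq> (B \<circ> Suc) (length pre)"
      "v * u * (\<Prod>c\<leftarrow>pre. Var (Suc n) - Const c) * s
       \<in> adjoin (Suc n) J (v * u * (\<Prod>c\<leftarrow>pre @ [c']. Var (Suc n) - Const c))"
    then show "s = 0"
      using Cons.prems(3)[of "c # pre" c' suf s] by (simp add: u_def mult.assoc)
  qed (use Cons.prems(1,2) S'B S'0 Bmono[of 1] in auto)
  then show ?case using Sdec S0 by simp
qed


section \<open>The relations of the hook family and a spanning set of monomials\<close>

text \<open>Congruence to zero of a polynomial, in an auxiliary variable \<open>s\<close>, with coefficients in a module.\<close>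

definition coeffs_in :: "'a::comm_ring_1 set \<Rightarrow> 'a poly \<Rightarrow> bool" where
  "coeffs_in J F \<longleftrightarrow> (\<forall>i. coeff F i \<in> J)"

lemma coeffs_in_0: "submod n J \<Longrightarrow> coeffs_in J 0"
  and coeffs_in_add: "submod n J \<Longrightarrow> coeffs_in J F \<Longrightarrow> coeffs_in J G \<Longrightarrow> coeffs_in J (F + G)"
  and coeffs_in_diff: "submod n J \<Longrightarrow> coeffs_in J F \<Longrightarrow> coeffs_in J G \<Longrightarrow> coeffs_in J (F - G)"
  by (simp_all add: coeffs_in_def submod_0 submod_add submod_diff)

lemma submod_polys: "submod n (polys n)"
  by (simp add: submod_def polys_add polys_mult)

lemma coeffs_in_mult:
  "submod n J \<Longrightarrow> coeffs_in J F \<Longrightarrow> coeffs_in (polys n) G \<Longrightarrow> coeffs_in J (F * G)"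
  unfolding coeffs_in_def coeff_mult by (auto intro!: submod_sum submod_mult2)

lemma coeffs_in_smult:
  "submod n J \<Longrightarrow> c \<in> polys n \<Longrightarrow> coeffs_in J F \<Longrightarrow> coeffs_in J (smult c F)"
  by (simp add: coeffs_in_def submod_mult)

lemma coeffs_in_linear: "c \<in> polys n \<Longrightarrow> coeffs_in (polys n) [:c, 1:]"
  by (auto simp: coeffs_in_def coeff_pCons split: nat.split)

lemma coeffs_in_prod:
  "(\<And>i. i \<in> A \<Longrightarrow> coeffs_in (polys n) (f i)) \<Longrightarrow> coeffs_in (polys n) (prod f A)"
proof (induction A rule: infinite_finite_induct)
  case (insert x F)
  then have "coeffs_in (polys n) (f x * prod f F)" by (intro coeffs_in_mult[OF submod_polys]) auto
  then show ?case using insert by simp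
qed (auto simp: coeffs_in_def one_pCons coeff_pCons split: nat.split)

lemma coeffs_in_eval:
  assumes "submod n J" "coeffs_in J F" "y \<in> polys n"
  shows "poly F y \<in> J"
  unfolding poly_altdef using assms
  by (auto intro!: submod_sum submod_mult2 polys_power simp: coeffs_in_def)

text \<open>A monic linear factor can be cancelled modulo a submodule.\<close>

lemma coeffs_in_cancel_linear:
  assumes J: "submod n J" and c: "c \<in> polys n" and F: "coeffs_in J ([:- c, 1:] * D)"
  shows "coeffs_in J D"
  unfolding coeffs_in_def
proof
  fix j show "coeff D j \<in> J"
  proof (induction "Suc (degree D) - j" arbitrary: j)
    case 0
    then show ?case by (simp add: coeff_eq_0 submod_0[OF J])
  next
    case (Suc i)
    have "coeff D (Suc j) \<in> J" using Suc by simp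
    then have "coeff ([:- c, 1:] * D) (Suc j) + c * coeff D (Suc j) \<in> J"
      using F submod_add[OF J] submod_mult[OF J c] unfolding coeffs_in_def by blast
    then show ?case by simp
  qed
qed

text \<open>The shifted variables \<open>y\<^sub>i = x\<^sub>i - a\<close>, the polynomial \<open>\<Prod>i\<le>n. s - y\<^sub>i\<close>, and the polynomial with
  given constant roots. The variable \<open>s\<close> is that of the type \<open>poly\<close>.\<close>

definition shift_var :: "'c::comm_ring_1 \<Rightarrow> nat \<Rightarrow> 'c mp" where
  "shift_var a i = Var i - Const a"

lemma polys_shift_var: "i \<in> {1..n} \<Longrightarrow> shift_var a i \<in> polys n"
  by (simp add: shift_var_def polys_diff polys_Var)

definition root_poly :: "'c::comm_ring_1 \<Rightarrow> nat \<Rightarrow> 'c mp poly" where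
  "root_poly a n = (\<Prod>i=1..n. [:- shift_var a i, 1:])"

lemma root_poly_Suc: "root_poly a (Suc n) = root_poly a n * [:- shift_var a (Suc n), 1:]"
  by (simp add: root_poly_def)

lemma coeffs_in_root_poly: "m \<le> n \<Longrightarrow> coeffs_in (polys n) (root_poly a m)"
  unfolding root_poly_def
  by (intro coeffs_in_prod coeffs_in_linear polys_uminus polys_shift_var) auto

definition const_roots :: "'c::comm_ring_1 list \<Rightarrow> 'c mp poly" where
  "const_roots bs = (\<Prod>b\<leftarrow>bs. [:- Const b, 1:])"

text \<open>The relations satisfied by the orbit of \<open>(a, \<dots>, a, a + b\<^sub>1, \<dots>, a + b\<^sub>r)\<close> with \<open>k\<close> equal coordinates at the
  beginning, imposed on the multiples of \<open>v\<close> modulo \<open>J\<close>; the list \<open>bs\<close> holds the differences \<open>b\<^sub>l\<close>.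
  For \<open>k = 0\<close> the second family is empty.\<close>

definition hook_relations ::
  "'c::comm_ring_1 \<Rightarrow> 'c list \<Rightarrow> nat \<Rightarrow> 'c mp set \<Rightarrow> 'c mp \<Rightarrow> bool" where
  "hook_relations a bs k J v \<longleftrightarrow>
     coeffs_in J (smult v (root_poly a (k + length bs) - Polynomial.monom 1 k * const_roots bs)) \<and>
     (\<forall>S. S \<subseteq> {1..k + length bs} \<longrightarrow> card S = Suc (length bs) \<longrightarrow> v * (\<Prod>i\<in>S. shift_var a i) \<in> J)"

text \<open>Modulo \<open>y\<^sub>n - c\<close> the factors \<open>s - y\<^sub>n\<close> and \<open>s - c\<close> agree and can be cancelled.\<close>

lemma root_poly_step:
  assumes J: "submod (Suc n) J"
    and F: "coeffs_in J (smult w (root_poly a (Suc n) - [:- Const c, 1:] * G))"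
  shows "coeffs_in (adjoin (Suc n) J (w * (shift_var a (Suc n) - Const c))) (smult w (root_poly a n - G))"
proof -
  let ?y = "shift_var a (Suc n)"
  let ?J = "adjoin (Suc n) J (w * (?y - Const c))"
  have J': "submod (Suc n) ?J" using submod_adjoin[OF J] .
  have eq: "[:- Const c, 1:] * smult w (root_poly a n - G) =
      smult w (root_poly a (Suc n) - [:- Const c, 1:] * G) +
      smult (w * (?y - Const c)) (root_poly a n)"
    by (intro poly_eqI)
      (simp add: root_poly_Suc coeff_pCons algebra_simps split: nat.split)
  have 1: "coeffs_in ?J (smult w (root_poly a (Suc n) - [:- Const c, 1:] * G))"
    using F adjoin_base unfolding coeffs_in_def by blast
  have 2: "coeffs_in ?J (smult (w * (?y - Const c)) (root_poly a n))"
    using coeffs_in_root_poly[of n "Suc n" a] adjoin_gen[OF J] by (auto simp: coeffs_in_def)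
  have "coeffs_in ?J ([:- Const c, 1:] * smult w (root_poly a n - G))"
    unfolding eq by (rule coeffs_in_add[OF J' 1 2])
  then show ?thesis using coeffs_in_cancel_linear[OF J'] polys_Const by blast
qed

text \<open>The low coefficients of \<open>\<Prod>i\<le>m. s - y\<^sub>i\<close> are elementary symmetric functions of degree at least \<open>d\<close>.\<close>

lemma root_poly_low_coeffs:
  assumes J: "submod n J" and "m \<le> n"
    and "\<And>S. S \<subseteq> {1..m} \<Longrightarrow> card S = d \<Longrightarrow> w * (\<Prod>i\<in>S. shift_var a i) \<in> J"
    and "j + d \<le> m"
  shows "w * coeff (root_poly a m) j \<in> J"
  using assms(2-4)
proof (induction m arbitrary: d w j)
  case 0
  then show ?case by (simp add: root_poly_def)
next
  case (Suc m)
  show ?case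
  proof (cases d)
    case 0
    then have "w \<in> J" using Suc.prems(2)[of "{}"] by simp
    moreover have "coeff (root_poly a (Suc m)) j \<in> polys n"
      using coeffs_in_root_poly[OF Suc.prems(1), of a] by (simp add: coeffs_in_def)
    ultimately show ?thesis using submod_mult2[OF J] by blast
  next
    case (Suc d')
    let ?y = "shift_var a (Suc m)"
    have 1: "(w * ?y) * coeff (root_poly a m) j \<in> J"
    proof (rule Suc.IH[of d'])
      fix S assume S: "S \<subseteq> {1..m}" "card S = d'"
      then have n: "Suc m \<notin> S" "finite S" using finite_subset by auto
      then have "card (insert (Suc m) S) = d" using S Suc by simp
      moreover have "insert (Suc m) S \<subseteq> {1..Suc m}" using S by auto
      ultimately have "w * (\<Prod>i\<in>insert (Suc m) S. shift_var a i) \<in> J" using Suc.prems(2) by blast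
      then show "w * ?y * (\<Prod>i\<in>S. shift_var a i) \<in> J" using n by (simp add: mult.assoc)
    qed (use Suc.prems Suc in auto)
    have 2: "w * (if j = 0 then 0 else coeff (root_poly a m) (j - 1)) \<in> J"
    proof (cases j)
      case 0 then show ?thesis using submod_0[OF J] by simp
    next
      case (Suc j')
      have "w * coeff (root_poly a m) j' \<in> J"
      proof (rule Suc.IH[of d])
        fix S assume "S \<subseteq> {1..m}" "card S = d"
        then show "w * (\<Prod>i\<in>S. shift_var a i) \<in> J" by (intro Suc.prems(2)) auto
      qed (use Suc.prems Suc in auto)
      then show ?thesis using Suc by simp
    qed
    have "coeff (root_poly a (Suc m)) j =
        (if j = 0 then 0 else coeff (root_poly a m) (j - 1)) - ?y * coeff (root_poly a m) j"
      by (cases j) (simp_all add: root_poly_Suc mult.commute[of _ "[:_, 1:]"])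
    then have "w * coeff (root_poly a (Suc m)) j =
        w * (if j = 0 then 0 else coeff (root_poly a m) (j - 1)) - (w * ?y) * coeff (root_poly a m) j"
      by (simp only: right_diff_distrib mult.assoc)
    then show ?thesis using submod_diff[OF J 2 1] by simp
  qed
qed

lemma poly_const_roots: "poly (const_roots bs) x = (\<Prod>b\<leftarrow>bs. x - Const b)"
  by (induction bs) (simp_all add: const_roots_def algebra_simps)

lemma poly_root_poly: "i \<in> {1..n} \<Longrightarrow> poly (root_poly a n) (shift_var a i) = 0"
  by (auto simp: root_poly_def poly_prod intro!: prod_zero bexI[of _ i])

text \<open>The first step of the filtration: the root \<open>0\<close> of \<open>s\<^sup>k \<Prod>(s - b\<^sub>l)\<close> is used once if \<open>k > 0\<close>, and is no root if
  \<open>k = 0\<close>.\<close>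

definition head_factor :: "'c::comm_ring_1 \<Rightarrow> nat \<Rightarrow> nat \<Rightarrow> 'c mp" where
  "head_factor a k n = (if k = 0 then 1 else shift_var a n)"

text \<open>The filtration ends at zero. For \<open>k > 0\<close>, multiply \<open>\<Prod>i. s - y\<^sub>i\<close> by \<open>y\<^sub>n\<close>: the products of \<open>r + 1\<close> distinct
  variables kill the coefficients of \<open>y\<^sub>n \<Prod>i<n. s - y\<^sub>i\<close> below \<open>s\<^sup>k\<close>, so that \<open>s\<^sup>k\<close> can be
  cancelled before putting \<open>s = y\<^sub>n\<close>.\<close>

lemma hook_relations_last:
  assumes J: "submod n J" and n: "n = k + length bs" "n > 0"
    and rel: "hook_relations a bs k J v"
  shows "v * head_factor a k n * (\<Prod>b\<leftarrow>bs. shift_var a n - Const b) \<in> J"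
proof (cases k)
  case 0
  have "coeffs_in J (smult v (root_poly a n - const_roots bs))"
    using rel unfolding hook_relations_def n 0 by (simp add: monom_0)
  from coeffs_in_eval[OF J this polys_shift_var[of n n a]] n(2)
  have "v * (0 - (\<Prod>b\<leftarrow>bs. shift_var a n - Const b)) \<in> J"
    by (simp add: poly_root_poly poly_const_roots)
  from submod_uminus[OF J this] show ?thesis using 0 by (simp add: head_factor_def)
next
  case (Suc k')
  define m where "m = k' + length bs"
  have nm: "n = Suc m" using n Suc by (simp add: m_def)
  let ?y = "shift_var a n"
  have y: "?y \<in> polys n" using nm by (intro polys_shift_var) auto
  define w where "w = v * ?y"
  have low: "w * coeff (root_poly a m) j \<in> J" if "j < k" for j
  proof (rule root_poly_low_coeffs[OF J, of _ "length bs"])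
    fix S assume S: "S \<subseteq> {1..m}" "card S = length bs"
    then have f: "n \<notin> S" "finite S" using nm finite_subset by auto
    then have "card (insert n S) = Suc (length bs)" using S by simp
    moreover have "insert n S \<subseteq> {1..k + length bs}" using S n nm by auto
    ultimately have "v * (\<Prod>i\<in>insert n S. shift_var a i) \<in> J"
      using rel unfolding hook_relations_def by blast
    then show "w * (\<Prod>i\<in>S. shift_var a i) \<in> J" using f by (simp add: w_def mult.assoc)
  qed (use nm that Suc m_def in auto)
  define E where "E = poly_shift k (root_poly a m)"
  define D where "D = E * [:- ?y, 1:] - const_roots bs"
  have dec: "root_poly a m = Polynomial.monom 1 k * E + poly_cutoff k (root_poly a m)"
    unfolding E_def by (intro poly_eqI) (auto simp: coeff_monom_mult coeff_poly_shift coeff_poly_cutoff)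
  have cut: "coeffs_in J (smult w (poly_cutoff k (root_poly a m)))"
    using low submod_0[OF J] by (auto simp: coeffs_in_def coeff_poly_cutoff)
  have "coeffs_in J (smult w (root_poly a n - Polynomial.monom 1 k * const_roots bs))"
    using rel coeffs_in_smult[OF J y] unfolding hook_relations_def n(1) w_def
    by (metis mult.commute smult_smult)
  moreover have "coeffs_in J (smult w (poly_cutoff k (root_poly a m)) * [:- ?y, 1:])"
    by (intro coeffs_in_mult[OF J cut] coeffs_in_linear polys_uminus y)
  ultimately have "coeffs_in J (smult w (root_poly a n - Polynomial.monom 1 k * const_roots bs)
      - smult w (poly_cutoff k (root_poly a m)) * [:- ?y, 1:])"
    by (rule coeffs_in_diff[OF J])
  also have "smult w (root_poly a n - Polynomial.monom 1 k * const_roots bs)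
      - smult w (poly_cutoff k (root_poly a m)) * [:- ?y, 1:] = Polynomial.monom 1 k * smult w D"
    unfolding nm root_poly_Suc D_def
    by (subst (1) dec) (simp add: algebra_simps smult_diff_right smult_add_right)
  finally have *: "coeffs_in J (Polynomial.monom 1 k * smult w D)" .
  have "coeffs_in J (smult w D)"
    unfolding coeffs_in_def
  proof
    fix j show "coeff (smult w D) j \<in> J"
      using *[unfolded coeffs_in_def, rule_format, of "k + j"] by (simp add: coeff_monom_mult)
  qed
  from coeffs_in_eval[OF J this y]
  have "- (w * (\<Prod>b\<leftarrow>bs. ?y - Const b)) \<in> J" by (simp add: D_def poly_const_roots)
  from submod_uminus[OF J this] show ?thesis using Suc by (simp add: w_def head_factor_def)
qed

text \<open>The relations in the layers: \<open>(k, r)\<close> for the first layer of \<open>(k + 1, r)\<close>, and, below, \<open>r - 1\<close> instead of \<open>r\<close> for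
  the layer belonging to the root \<open>b\<close>.\<close>

lemma hook_relations_head:
  assumes J: "submod n J" and n: "n = Suc (k + length bs)"
    and rel: "hook_relations a bs (Suc k) J v"
  shows "hook_relations a bs k (adjoin n J (v * shift_var a n)) v"
  unfolding hook_relations_def
proof (intro conjI allI impI)
  have "Polynomial.monom 1 (Suc k) * const_roots bs =
      [:- Const 0, 1:] * (Polynomial.monom 1 k * const_roots bs)"
    by (simp add: monom_Suc)
  then have "coeffs_in J (smult v (root_poly a (Suc (k + length bs)) -
      [:- Const 0, 1:] * (Polynomial.monom 1 k * const_roots bs)))"
    using rel unfolding hook_relations_def by simp
  from root_poly_step[OF J[unfolded n] this]
  show "coeffs_in (adjoin n J (v * shift_var a n))
     (smult v (root_poly a (k + length bs) - Polynomial.monom 1 k * const_roots bs))"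
    unfolding n by simp
next
  fix S assume S: "S \<subseteq> {1..k + length bs}" "card S = Suc (length bs)"
  have "S \<subseteq> {1..Suc k + length bs}" using S by auto
  then show "v * (\<Prod>i\<in>S. shift_var a i) \<in> adjoin n J (v * shift_var a n)"
    using S rel unfolding hook_relations_def by (intro adjoin_base) blast
qed

lemma hook_relations_root:
  fixes bs :: "'c::comm_ring_1 list"
  assumes J: "submod n J" and n: "n = k + length bs"
    and rel: "hook_relations a bs k J v" and bs: "bs = pre @ b # suf"
    and w: "w = v * head_factor a k n * (\<Prod>b\<leftarrow>pre. shift_var a n - Const b)"
  shows "hook_relations a (pre @ suf) k (adjoin n J (w * (shift_var a n - Const b))) w"
proof -
  define m where "m = k + length (pre @ suf)"
  have nm: "n = Suc m" unfolding n bs m_def by simp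
  have y: "shift_var a n \<in> polys n" using nm by (intro polys_shift_var) auto
  have pre: "(\<Prod>b\<leftarrow>pre. shift_var a n - Const b) \<in> polys n"
    by (intro polys_prod_list polys_diff y polys_Const)
  have hd: "head_factor a k n \<in> polys n" by (simp add: head_factor_def y)
  let ?G = "Polynomial.monom 1 k * const_roots (pre @ suf)"
  have G: "Polynomial.monom 1 k * const_roots bs = [:- Const b, 1:] * ?G"
    unfolding bs by (simp only: const_roots_def map_append prod_list.append list.map prod_list.Cons mult_ac)
  have "coeffs_in J (smult v (root_poly a (Suc m) - [:- Const b, 1:] * ?G))"
    using rel unfolding hook_relations_def G n[symmetric] nm by blast
  from coeffs_in_smult[OF J polys_mult[OF hd pre] this]
  have "coeffs_in J (smult w (root_poly a (Suc m) - [:- Const b, 1:] * ?G))"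
    unfolding smult_smult w by (simp only: mult_ac)
  from root_poly_step[OF J[unfolded nm] this]
  have 1: "coeffs_in (adjoin n J (w * (shift_var a n - Const b))) (smult w (root_poly a m - ?G))"
    unfolding nm .
  have 2: "w * (\<Prod>i\<in>S. shift_var a i) \<in> J" if S: "S \<subseteq> {1..m}" "card S = Suc (length (pre @ suf))" for S
  proof (cases k)
    case 0
    then have "card S \<le> length (pre @ suf)" using card_mono[OF _ S(1)] by (simp add: m_def)
    then show ?thesis using S by simp
  next
    case (Suc k')
    have f: "finite S" "n \<notin> S" using S nm finite_subset by auto
    then have "card (insert n S) = Suc (length bs)" using S bs by simp
    moreover have "insert n S \<subseteq> {1..k + length bs}" using S nm n by auto
    ultimately have "v * (\<Prod>i\<in>insert n S. shift_var a i) \<in> J"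
      using rel unfolding hook_relations_def by blast
    from submod_mult2[OF J pre this] f Suc show ?thesis
      by (simp add: w head_factor_def mult_ac)
  qed
  show ?thesis unfolding hook_relations_def m_def[symmetric] using 1 2 adjoin_base by blast
qed

text \<open>The exponent vectors of the Garsia-Procesi basis for the hook \<open>(k, 1, \<dots>, 1)\<close> with \<open>r\<close> ones, in \<open>k + r\<close>
  variables. For \<open>k = 0\<close> these are the staircase monomials in \<open>r\<close> variables.\<close>

fun hook_monoms :: "nat \<Rightarrow> nat \<Rightarrow> monom set" where
  "hook_monoms 0 0 = {0}"
| "hook_monoms 0 (Suc r) =
     (\<Union>j\<le>r. (\<lambda>m. m + Poly_Mapping.single (Suc r) j) ` hook_monoms 0 r)"
| "hook_monoms (Suc k) 0 = hook_monoms k 0"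
| "hook_monoms (Suc k) (Suc r) = hook_monoms k (Suc r) \<union>
     (\<Union>j\<in>{1..Suc r}. (\<lambda>m. m + Poly_Mapping.single (Suc (Suc (k + r))) j) ` hook_monoms (Suc k) r)"

lemma finite_hook_monoms: "finite (hook_monoms k r)"
  by (induction k r rule: hook_monoms.induct) auto

lemma hook_monoms_monoms: "hook_monoms k r \<subseteq> monoms (k + r)"
proof (induction k r rule: hook_monoms.induct)
  case (2 r)
  then show ?case using monoms_mono[of r "Suc r"]
    by (auto intro!: monoms_add monoms_single)
next
  case (3 k)
  then show ?case using monoms_mono[of k "Suc k"] by auto
next
  case (4 k r)
  then show ?case using monoms_mono[of "Suc (k + r)" "Suc (Suc (k + r))"]
    by (auto intro!: monoms_add monoms_single)
qed auto

lemma hook_monoms_row0: "hook_monoms k 0 = {0}"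
  by (induction k) auto

lemma zero_in_hook_monoms: "0 \<in> hook_monoms k r"
proof (induction k r rule: hook_monoms.induct)
  case (2 r)
  then show ?case by (auto intro!: bexI[of _ 0] image_eqI[of _ _ 0])
qed auto

lemma hook_monoms_antimono: "hook_monoms (Suc k) r \<subseteq> hook_monoms k (Suc r)"
proof (induction k r rule: hook_monoms.induct)
  case 1
  then show ?case by auto
next
  case (2 r)
  have "hook_monoms 0 (Suc r) \<subseteq> hook_monoms 0 (Suc (Suc r))"
  proof
    fix m assume m: "m \<in> hook_monoms 0 (Suc r)"
    have "m = m + Poly_Mapping.single (Suc (Suc r)) 0" by simp
    with m show "m \<in> hook_monoms 0 (Suc (Suc r))"
      unfolding hook_monoms.simps(2)[of "Suc r"] by blast
  qed
  moreover have "(\<Union>j\<in>{1..Suc r}. (\<lambda>m. m + Poly_Mapping.single (Suc (Suc r)) j) ` hook_monoms (Suc 0) r)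
      \<subseteq> hook_monoms 0 (Suc (Suc r))"
    using 2 unfolding hook_monoms.simps(2)[of "Suc r"] by fastforce
  ultimately show ?case by simp
next
  case (3 k)
  then show ?case using zero_in_hook_monoms by (simp add: hook_monoms_row0)
next
  case (4 k r)
  have "(\<Union>j\<in>{1..Suc r}. (\<lambda>m. m + Poly_Mapping.single (Suc (Suc (Suc k + r))) j) ` hook_monoms (Suc (Suc k)) r)
      \<subseteq> (\<Union>j\<in>{1..Suc (Suc r)}. (\<lambda>m. m + Poly_Mapping.single (Suc (Suc (k + Suc r))) j) ` hook_monoms (Suc k) (Suc r))"
    using 4(2) by fastforce
  then show ?case
    unfolding hook_monoms.simps(4)[of "Suc k" r] hook_monoms.simps(4)[of k "Suc r"] using 4(1) by blast
qed

text \<open>The hook monomials grouped by their exponent \<open>j\<close> of the last variable.\<close>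

definition layer :: "nat \<Rightarrow> nat \<Rightarrow> nat \<Rightarrow> monom set" where
  "layer k r j = (if k = 0 then hook_monoms 0 (r - 1)
     else if j = 0 then hook_monoms (k - 1) r else hook_monoms k (r - 1))"

definition num_layers :: "nat \<Rightarrow> nat \<Rightarrow> nat" where
  "num_layers k r = (if k = 0 then r else Suc r)"

lemma hook_monoms_layers:
  assumes "k + r > 0"
  shows "hook_monoms k r =
    (\<Union>j<num_layers k r. (\<lambda>m. m + Poly_Mapping.single (k + r) j) ` layer k r j)"
proof (cases k)
  case 0
  then obtain r' where "r = Suc r'" using assms by (cases r) auto
  then show ?thesis using 0 by (simp add: layer_def num_layers_def lessThan_Suc_atMost)
next
  case (Suc k')
  have *: "{..<Suc r} = insert 0 {1..r}" by auto
  have "(\<Union>j<num_layers k r. (\<lambda>m. m + Poly_Mapping.single (k + r) j) ` layer k r j) =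
      hook_monoms k' r \<union> (\<Union>j\<in>{1..r}. (\<lambda>m. m + Poly_Mapping.single (k + r) j) ` hook_monoms k (r - 1))"
    unfolding num_layers_def using Suc * by (simp add: layer_def)
  then show ?thesis using Suc by (cases r) auto
qed

lemma layer_antimono: "layer k r (Suc j) \<subseteq> layer k r j"
proof (cases "k = 0 \<or> j > 0")
  case False
  then obtain k' where "k = Suc k'" "j = 0" by (cases k) auto
  then show ?thesis using hook_monoms_antimono[of k' "r - 1"] zero_in_hook_monoms
    by (cases r) (auto simp: layer_def hook_monoms_row0)
qed (auto simp: layer_def)

lemma keys_mult_Var_power:
  "Poly_Mapping.keys (p * Var n ^ j) \<subseteq> (\<lambda>m. m + Poly_Mapping.single n j) ` Poly_Mapping.keys p"
  for p :: "'c::comm_ring_1 mp"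
proof
  fix m assume "m \<in> Poly_Mapping.keys (p * Var n ^ j)"
  then obtain a b where ab: "m = a + b" "a \<in> Poly_Mapping.keys p"
      "b \<in> Poly_Mapping.keys (Poly_Mapping.single (Poly_Mapping.single n j) (1::'c))"
    unfolding Var_power using Poly_Mapping.keys_mult by blast
  then have "b = Poly_Mapping.single n j" by (simp split: if_splits)
  with ab show "m \<in> (\<lambda>m. m + Poly_Mapping.single n j) ` Poly_Mapping.keys p" by blast
qed

lemma keys_poly_layers:
  fixes S :: "'c::comm_ring_1 mp poly"
  assumes "\<And>j. Poly_Mapping.keys (coeff S j) \<subseteq> B j" "\<And>j. j \<ge> d \<Longrightarrow> coeff S j = 0"
  shows "Poly_Mapping.keys (poly S (Var n)) \<subseteq> (\<Union>j<d. (\<lambda>m. m + Poly_Mapping.single n j) ` B j)"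
proof
  fix m assume "m \<in> Poly_Mapping.keys (poly S (Var n))"
  then obtain j where j: "m \<in> Poly_Mapping.keys (coeff S j * Var n ^ j)"
    unfolding poly_altdef using Poly_Mapping.keys_sum[of "\<lambda>i. coeff S i * Var n ^ i" "{..degree S}"] by blast
  then have "coeff S j \<noteq> 0" by auto
  then have "j < d" using assms(2) not_le by blast
  moreover have "m \<in> (\<lambda>m. m + Poly_Mapping.single n j) ` B j"
    using j keys_mult_Var_power[of "coeff S j" n j] assms(1)[of j] by blast
  ultimately show "m \<in> (\<Union>j<d. (\<lambda>m. m + Poly_Mapping.single n j) ` B j)" by blast
qed

text \<open>The values at which the last variable is evaluated along the filtration.\<close>

definition root_list :: "'c::comm_ring_1 \<Rightarrow> nat \<Rightarrow> 'c list \<Rightarrow> 'c list" where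
  "root_list a k bs = map ((+) a) (if k = 0 then bs else 0 # bs)"

lemma length_root_list: "length (root_list a k bs) = num_layers k (length bs)"
  by (simp add: root_list_def num_layers_def)

lemma prod_root_list:
  "(\<Prod>c\<leftarrow>root_list a k bs. Var n - Const c) =
    head_factor a k n * (\<Prod>b\<leftarrow>bs. shift_var a n - Const b)"
proof -
  have *: "(\<lambda>b. Var n - Const (a + b)) = (\<lambda>b. shift_var a n - Const b)"
    by (auto simp: shift_var_def Const_add)
  then show ?thesis by (simp add: root_list_def head_factor_def comp_def * shift_var_def)
qed

lemma root_list_cases:
  assumes "root_list a k bs = pre @ c # suf"
  obtains (head) "k > 0" "pre = []" "c = a"
  | (root) pre' b suf' where "bs = pre' @ b # suf'" "c = a + b" "length pre = (if k = 0 then 0 else 1) + length pre'"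
      "\<And>n. (\<Prod>c\<leftarrow>pre. Var n - Const c) = head_factor a k n * (\<Prod>b\<leftarrow>pre'. shift_var a n - Const b)"
proof -
  have split: "\<exists>pre' b suf'. bs = pre' @ b # suf' \<and> ds = map ((+) a) pre' \<and> c = a + b"
    if "map ((+) a) bs = ds @ c # suf" for ds
    using that by (auto simp: map_eq_append_conv map_eq_Cons_conv)
  show ?thesis
  proof (cases "k = 0")
    case True
    then have "map ((+) a) bs = pre @ c # suf" using assms by (simp add: root_list_def)
    from split[OF this] obtain pre' b suf' where *: "bs = pre' @ b # suf'" "pre = map ((+) a) pre'" "c = a + b"
      by blast
    then have "pre = root_list a k pre'" using True by (simp add: root_list_def)
    moreover have "length pre = length pre'" using * by simp
    ultimately show ?thesis using * True by (intro root[of pre' b suf']) (simp_all only: prod_root_list, simp)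
  next
    case False
    show ?thesis
    proof (cases pre)
      case Nil
      then show ?thesis using False assms by (intro head) (auto simp: root_list_def)
    next
      case (Cons d ds)
      have "a # map ((+) a) bs = d # ds @ c # suf" using assms[unfolded root_list_def Cons] False
        by (simp only: if_False list.map add_0_right append_Cons)
      then have d: "map ((+) a) bs = ds @ c # suf" "d = a" by (metis list.inject)+
      from split[OF d(1)] obtain pre' b suf' where *: "bs = pre' @ b # suf'" "ds = map ((+) a) pre'" "c = a + b"
        by blast
      then have "pre = root_list a k pre'" using False Cons d by (simp add: root_list_def)
      moreover have "length pre = 1 + length pre'" using Cons * by simp
      ultimately show ?thesis using * False
        by (intro root[of pre' b suf']) (simp_all only: prod_root_list, simp)
    qed
  qed
qed

text \<open>The coefficient ring is arbitrary; over a polynomial ring this yields normal forms for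
  families.\<close>

theorem hook_monoms_span:
  fixes v :: "'c::comm_ring_1 mp"
  assumes "length bs = r" "submod (k + r) J" "hook_relations a bs k J v" "p \<in> polys (k + r)"
  shows "\<exists>s. Poly_Mapping.keys s \<subseteq> hook_monoms k r \<and> v * (p - s) \<in> J"
  using assms
proof (induction "k + r" arbitrary: k r bs J v p rule: less_induct)
  case less
  show ?case
  proof (cases "k + r")
    case 0
    then have "Poly_Mapping.keys p \<subseteq> {0}" using less.prems(4) by (auto simp: polys_def monoms_def)
    then show ?thesis using 0 submod_0[OF less.prems(2)] by (intro exI[of _ p]) simp
  next
    case (Suc n)
    have J: "submod (Suc n) J" using less.prems Suc by simp
    have n: "Suc n = k + length bs" using less.prems Suc by simp
    have "\<exists>S. (\<forall>j. Poly_Mapping.keys (coeff S j) \<subseteq> layer k r j) \<and>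
      (\<forall>j\<ge>length (root_list a k bs). coeff S j = 0) \<and> v * (p - poly S (Var (Suc n))) \<in> J"
    proof (rule chain_span[OF J])
      show "v * (\<Prod>c\<leftarrow>root_list a k bs. Var (Suc n) - Const c) \<in> J"
        using hook_relations_last[OF J n _ less.prems(3)] by (simp add: prod_root_list mult.assoc)
      show "layer k r (Suc j) \<subseteq> layer k r j" for j by (rule layer_antimono)
      show "p \<in> polys (Suc n)" using less.prems Suc by simp
      fix pre c suf and p :: "'c mp"
      assume split: "root_list a k bs = pre @ c # suf" and p: "p \<in> polys n"
      let ?w = "v * (\<Prod>c\<leftarrow>pre. Var (Suc n) - Const c)"
      let ?w' = "v * (\<Prod>c\<leftarrow>pre @ [c]. Var (Suc n) - Const c)"
      have J': "submod n (adjoin (Suc n) J ?w')"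
        using submod_mono[OF submod_adjoin[OF J], of n] by simp
      from split show "\<exists>s. Poly_Mapping.keys s \<subseteq> layer k r (length pre) \<and>
          ?w * (p - s) \<in> adjoin (Suc n) J ?w'"
      proof (cases rule: root_list_cases)
        case head
        then obtain k' where k: "k = Suc k'" by (cases k) auto
        have "hook_relations a bs k' (adjoin (Suc n) J ?w') v"
          using hook_relations_head[OF J, of k' bs a v] n k less.prems(3) head by (simp add: shift_var_def)
        moreover have "k' + r = n" using k Suc by simp
        ultimately show ?thesis
          using less.hyps[of k' r bs "adjoin (Suc n) J ?w'" v p] less.prems k p J' head
          by (simp add: layer_def)
      next
        case (root pre' b suf')
        have w: "?w = v * head_factor a k (Suc n) * (\<Prod>b\<leftarrow>pre'. shift_var a (Suc n) - Const b)"
          using root(4) by (simp add: mult.assoc)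
        have "?w' = ?w * (shift_var a (Suc n) - Const b)"
          using root(2) by (simp add: shift_var_def Const_add mult.assoc diff_diff_eq)
        with hook_relations_root[OF J n less.prems(3) root(1) w]
        have "hook_relations a (pre' @ suf') k (adjoin (Suc n) J ?w') ?w" by simp
        moreover have "length (pre' @ suf') = r - 1" "k + (r - 1) = n" "r \<ge> 1"
          using root(1) less.prems(1) Suc by auto
        moreover have "layer k r (length pre) = hook_monoms k (r - 1)"
          using root(3) by (auto simp: layer_def)
        ultimately show ?thesis
          using less.hyps[of k "r - 1" "pre' @ suf'" "adjoin (Suc n) J ?w'" ?w p] p J' Suc by auto
      qed
    qed
    then obtain S where S: "\<And>j. Poly_Mapping.keys (coeff S j) \<subseteq> layer k r j"
      "\<And>j. j\<ge>num_layers k r \<Longrightarrow> coeff S j = 0" "v * (p - poly S (Var (Suc n))) \<in> J"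
      using less.prems(1) by (auto simp: length_root_list)
    then have "Poly_Mapping.keys (poly S (Var (Suc n))) \<subseteq> hook_monoms k r"
      using keys_poly_layers[of S "layer k r" "num_layers k r" "Suc n"] hook_monoms_layers[of k r] Suc by auto
    then show ?thesis using S(3) by blast
  qed
qed


section \<open>The action on polynomials and alternating polynomials\<close>

lemma inj_map_key_monom:
  assumes "bij \<sigma>" shows "inj (Poly_Mapping.map_key \<sigma> :: monom \<Rightarrow> monom)"
proof (rule injI)
  fix m m' :: monom
  assume eq: "Poly_Mapping.map_key \<sigma> m = Poly_Mapping.map_key \<sigma> m'"
  have "Poly_Mapping.lookup m (\<sigma> j) = Poly_Mapping.lookup m' (\<sigma> j)" for j
    using arg_cong[OF eq, of "\<lambda>x. Poly_Mapping.lookup x j"] bij_is_inj[OF assms]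
    by (simp add: map_key.rep_eq)
  then show "m = m'" using bij_is_surj[OF assms] by (metis poly_mapping_eqI surjD)
qed

lemma lookup_perm_poly:
  "bij \<sigma> \<Longrightarrow> Poly_Mapping.lookup (perm_poly \<sigma> p) m = Poly_Mapping.lookup p (Poly_Mapping.map_key \<sigma> m)"
  unfolding perm_poly_def using inj_map_key_monom[of \<sigma>] by (simp add: map_key.rep_eq)

lemma perm_poly_add: "bij \<sigma> \<Longrightarrow> perm_poly \<sigma> (p + q) = perm_poly \<sigma> p + perm_poly \<sigma> q"
  and perm_poly_diff: "bij \<sigma> \<Longrightarrow> perm_poly \<sigma> (p - q) = perm_poly \<sigma> p - perm_poly \<sigma> q"
  and perm_poly_uminus: "bij \<sigma> \<Longrightarrow> perm_poly \<sigma> (- p) = - perm_poly \<sigma> p"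
  and perm_poly_0: "bij \<sigma> \<Longrightarrow> perm_poly \<sigma> 0 = 0"
  by (auto intro!: poly_mapping_eqI simp: lookup_perm_poly lookup_add lookup_minus)

lemma perm_poly_sum: "bij \<sigma> \<Longrightarrow> perm_poly \<sigma> (sum f A) = (\<Sum>x\<in>A. perm_poly \<sigma> (f x))"
  by (induction A rule: infinite_finite_induct) (auto simp: perm_poly_0 perm_poly_add)

lemma perm_poly_comp:
  assumes "bij \<sigma>" "bij \<tau>"
  shows "perm_poly \<sigma> (perm_poly \<tau> p) = perm_poly (\<sigma> \<circ> \<tau>) p"
  using assms bij_comp[OF assms(2,1)]
  by (intro poly_mapping_eqI) (simp add: lookup_perm_poly map_key_compose bij_is_inj)

lemma perm_poly_id [simp]: "perm_poly id p = p"
  by (intro poly_mapping_eqI) (simp add: lookup_perm_poly map_key_id[folded id_def])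

lemma perm_poly_monomial:
  assumes "bij \<sigma>"
  shows "perm_poly \<sigma> (Poly_Mapping.single m c) =
    Poly_Mapping.single (Poly_Mapping.map_key (inv' \<sigma>) m) c"
proof (intro poly_mapping_eqI)
  fix m' :: monom
  have inv: "bij (inv' \<sigma>)" using assms by (rule bij_imp_bij_inv)
  have "Poly_Mapping.map_key (inv' \<sigma>) (Poly_Mapping.map_key \<sigma> m') = m'"
    "Poly_Mapping.map_key \<sigma> (Poly_Mapping.map_key (inv' \<sigma>) m) = m"
    using assms inv by (auto simp: map_key_compose bij_is_inj o_def bij_is_surj surj_f_inv_f map_key_id)
  then have "m = Poly_Mapping.map_key \<sigma> m' \<longleftrightarrow> Poly_Mapping.map_key (inv' \<sigma>) m = m'" by auto
  then show "Poly_Mapping.lookup (perm_poly \<sigma> (Poly_Mapping.single m c)) m' =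
      Poly_Mapping.lookup (Poly_Mapping.single (Poly_Mapping.map_key (inv' \<sigma>) m) c) m'"
    using assms by (simp add: lookup_perm_poly lookup_single when_def)
qed

lemma perm_poly_mult:
  assumes "bij \<sigma>" shows "perm_poly \<sigma> (p * q) = perm_poly \<sigma> p * perm_poly \<sigma> q"
proof -
  have inv: "inj (inv' \<sigma>)" using assms by (simp add: bij_imp_bij_inv bij_is_inj)
  have pq: "p * q = (\<Sum>s\<in>Poly_Mapping.keys p. \<Sum>t\<in>Poly_Mapping.keys q.
      Poly_Mapping.single s (Poly_Mapping.lookup p s) * Poly_Mapping.single t (Poly_Mapping.lookup q t))"
    using arg_cong2[OF single_sum_keys[of p] single_sum_keys[of q], of "(*)"] by (simp only: sum_product)
  have "perm_poly \<sigma> (p * q) = (\<Sum>s\<in>Poly_Mapping.keys p. \<Sum>t\<in>Poly_Mapping.keys q.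
      perm_poly \<sigma> (Poly_Mapping.single s (Poly_Mapping.lookup p s)) *
      perm_poly \<sigma> (Poly_Mapping.single t (Poly_Mapping.lookup q t)))"
    unfolding pq using assms inv
    by (simp add: perm_poly_sum perm_poly_monomial mult_single map_key_plus)
  also have "\<dots> = perm_poly \<sigma> (\<Sum>s\<in>Poly_Mapping.keys p. Poly_Mapping.single s (Poly_Mapping.lookup p s)) *
      perm_poly \<sigma> (\<Sum>t\<in>Poly_Mapping.keys q. Poly_Mapping.single t (Poly_Mapping.lookup q t))"
    using assms by (simp add: perm_poly_sum sum_product)
  finally show ?thesis by (simp only: single_sum_keys[symmetric])
qed

lemma perm_poly_Const: "bij \<sigma> \<Longrightarrow> perm_poly \<sigma> (Const c) = Const c"
  by (simp add: Const_def perm_poly_monomial bij_imp_bij_inv bij_is_inj)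

lemma perm_poly_1: "bij \<sigma> \<Longrightarrow> perm_poly \<sigma> 1 = 1"
  using perm_poly_Const[of \<sigma> 1] by simp

lemma of_int_Const: "(of_int i :: complex mp) = Const (of_int i)"
proof -
  have nat: "(of_nat m :: complex mp) = Const (of_nat m)" for m
    by (induction m) (auto simp: Const_add)
  show ?thesis by (cases i rule: int_cases2) (auto simp: nat Const_minus)
qed

lemma perm_poly_of_int: "bij \<sigma> \<Longrightarrow> perm_poly \<sigma> (of_int i) = of_int i"
  by (simp add: of_int_Const perm_poly_Const)

lemma perm_poly_Var: "bij \<sigma> \<Longrightarrow> perm_poly \<sigma> (Var i) = Var (\<sigma> i)"
  by (simp add: Var_def perm_poly_single)

lemma perm_poly_shift_var: "bij \<sigma> \<Longrightarrow> perm_poly \<sigma> (shift_var a i) = shift_var a (\<sigma> i)"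
  by (simp add: shift_var_def perm_poly_diff perm_poly_Var perm_poly_Const)

lemma perm_poly_prod: "bij \<sigma> \<Longrightarrow> perm_poly \<sigma> (prod f A) = (\<Prod>x\<in>A. perm_poly \<sigma> (f x))"
  by (induction A rule: infinite_finite_induct) (auto simp: perm_poly_1 perm_poly_mult)

lemma perm_poly_prod_list: "bij \<sigma> \<Longrightarrow> perm_poly \<sigma> (prod_list (map f xs)) = prod_list (map (\<lambda>x. perm_poly \<sigma> (f x)) xs)"
  by (induction xs) (auto simp: perm_poly_1 perm_poly_mult)

lemma perm_poly_power: "bij \<sigma> \<Longrightarrow> perm_poly \<sigma> (p ^ e) = perm_poly \<sigma> p ^ e"
  by (induction e) (auto simp: perm_poly_1 perm_poly_mult)

lemma perm_poly_polys:
  assumes "\<sigma> permutes {1..n}" "p \<in> polys n"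
  shows "perm_poly \<sigma> p \<in> polys n"
  using assms(2)
proof (induction p rule: polys_induct)
  case (Var i p)
  have "\<sigma> i \<in> {1..n}" using Var(1) permutes_in_image[OF assms(1)] by simp
  then show ?case using Var permutes_bij[OF assms(1)]
    by (simp add: perm_poly_mult perm_poly_Var polys_mult polys_Var)
qed (use permutes_bij[OF assms(1)] in \<open>auto simp: perm_poly_Const perm_poly_add polys_add\<close>)

text \<open>Ring homomorphisms act on univariate polynomials through their coefficients.\<close>

lemma map_poly_mult_hom:
  fixes h :: "'a::comm_ring_1 \<Rightarrow> 'b::comm_ring_1"
  assumes "h 0 = 0" "\<And>x y. h (x + y) = h x + h y" "\<And>x y. h (x * y) = h x * h y"
  shows "map_poly h (p * q) = map_poly h p * map_poly h q"
proof (rule poly_eqI)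
  fix i
  have hs: "h (sum f A) = (\<Sum>x\<in>A. h (f x))" for f :: "nat \<Rightarrow> 'a" and A
    by (induction A rule: infinite_finite_induct) (auto simp: assms)
  show "coeff (map_poly h (p * q)) i = coeff (map_poly h p * map_poly h q) i"
    by (simp add: coeff_map_poly assms coeff_mult hs)
qed

lemma map_poly_prod_hom:
  fixes h :: "'a::comm_ring_1 \<Rightarrow> 'b::comm_ring_1"
  assumes "h 0 = 0" "h 1 = 1" "\<And>x y. h (x + y) = h x + h y" "\<And>x y. h (x * y) = h x * h y"
  shows "map_poly h (prod f A) = (\<Prod>x\<in>A. map_poly h (f x))"
  by (induction A rule: infinite_finite_induct)
    (simp_all add: map_poly_mult_hom[of h] assms map_poly_1)

lemma map_poly_linear:
  fixes h :: "'a::comm_ring_1 \<Rightarrow> 'b::comm_ring_1"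
  assumes "h 0 = 0" "h 1 = 1"
  shows "map_poly h [:c, 1:] = [:h c, 1:]"
  using assms by (simp add: map_poly_pCons)

lemma map_poly_perm_linear_prod:
  assumes "bij \<sigma>"
  shows "map_poly (perm_poly \<sigma>) (\<Prod>i\<in>A. [:- shift_var a i, 1:]) = (\<Prod>i\<in>A. [:- shift_var a (\<sigma> i), 1:])"
  using assms
  by (simp add: map_poly_prod_hom map_poly_linear perm_poly_0 perm_poly_1 perm_poly_add perm_poly_mult
      perm_poly_uminus perm_poly_shift_var)

lemma perm_poly_coeff_linear_prod:
  assumes "bij \<sigma>" "\<sigma> ` A = A"
  shows "perm_poly \<sigma> (coeff (\<Prod>i\<in>A. [:- shift_var a i, 1:]) j) = coeff (\<Prod>i\<in>A. [:- shift_var a i, 1:]) j"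
proof -
  have "bij_betw \<sigma> A A" using assms inj_on_subset[OF bij_is_inj[OF assms(1)], of A] by (simp add: bij_betw_def)
  then have "(\<Prod>i\<in>A. [:- shift_var a (\<sigma> i), 1:]) = (\<Prod>i\<in>A. [:- shift_var a i, 1:])"
    by (rule prod.reindex_bij_betw)
  then have "coeff (map_poly (perm_poly \<sigma>) (\<Prod>i\<in>A. [:- shift_var a i, 1:])) j = coeff (\<Prod>i\<in>A. [:- shift_var a i, 1:]) j"
    unfolding map_poly_perm_linear_prod[OF assms(1)] by simp
  then show ?thesis using assms by (simp add: coeff_map_poly perm_poly_0)
qed

text \<open>The alternating sum over the permutations of the first \<open>d\<close> variables, and the Vandermonde determinant
  of these variables in the expanded form, with rows the powers of \<open>x\<^sub>i - a\<close>.\<close>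

definition alt :: "nat \<Rightarrow> mpoly \<Rightarrow> mpoly" where
  "alt d p = (\<Sum>\<sigma> | \<sigma> permutes {1..d}. of_int (sign \<sigma>) * perm_poly \<sigma> p)"

definition vandermonde :: "complex \<Rightarrow> nat \<Rightarrow> mpoly" where
  "vandermonde a d = alt d (\<Prod>i\<in>{1..d}. shift_var a i ^ (i - 1))"

lemma finite_perms: "finite {\<sigma>. \<sigma> permutes {1..d::nat}}"
  by (simp add: finite_permutations)

lemma alt_add: "alt d (p + q) = alt d p + alt d q"
  unfolding alt_def sum.distrib[symmetric]
  by (intro sum.cong) (auto simp: perm_poly_add permutes_bij algebra_simps)

lemma alt_0 [simp]: "alt d 0 = 0"
  unfolding alt_def by (intro sum.neutral) (auto simp: perm_poly_0 permutes_bij)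

lemma alt_sum: "alt d (sum f A) = (\<Sum>x\<in>A. alt d (f x))"
  by (induction A rule: infinite_finite_induct) (auto simp: alt_add)

lemma alt_sym_mult:
  assumes "\<And>\<sigma>. \<sigma> permutes {1..d} \<Longrightarrow> perm_poly \<sigma> s = s"
  shows "alt d (s * p) = s * alt d p"
  unfolding alt_def sum_distrib_left
  by (intro sum.cong) (auto simp: perm_poly_mult permutes_bij assms mult_ac)

lemma alt_Const_mult: "alt d (Const c * p) = Const c * alt d p"
  by (rule alt_sym_mult) (simp add: perm_poly_Const permutes_bij)

lemma alt_polys: "d \<le> n \<Longrightarrow> p \<in> polys n \<Longrightarrow> alt d p \<in> polys n"
  unfolding alt_def
  by (intro polys_sum polys_mult perm_poly_polys)
    (auto simp: of_int_Const intro: permutes_subset)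

lemma of_int_sign_sq: "(of_int (sign \<tau>) :: mpoly) * (of_int (sign \<tau>) * x) = x"
  by (simp add: mult.assoc[symmetric] flip: of_int_mult)

lemma alt_antisym:
  assumes "\<tau> permutes {1..d}"
  shows "perm_poly \<tau> (alt d p) = of_int (sign \<tau>) * alt d p"
proof -
  have perm: "permutation \<sigma>" if "\<sigma> permutes {1..d}" for \<sigma>
    using that permutation_permutes by blast
  have "perm_poly \<tau> (alt d p) = (\<Sum>\<sigma> | \<sigma> permutes {1..d}. of_int (sign \<sigma>) * perm_poly (\<tau> \<circ> \<sigma>) p)"
    unfolding alt_def using permutes_bij[OF assms]
    by (auto simp: perm_poly_sum perm_poly_mult perm_poly_of_int perm_poly_comp permutes_bij intro!: sum.cong)
  also have "\<dots> = (\<Sum>\<sigma> | \<sigma> permutes {1..d}. of_int (sign \<tau>) * (of_int (sign (\<tau> \<circ> \<sigma>)) * perm_poly (\<tau> \<circ> \<sigma>) p))"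
    using perm assms by (intro sum.cong) (auto simp: sign_compose of_int_sign_sq mult.assoc)
  also have "\<dots> = of_int (sign \<tau>) * (\<Sum>\<sigma> | \<sigma> permutes {1..d}. of_int (sign (\<tau> \<circ> \<sigma>)) * perm_poly (\<tau> \<circ> \<sigma>) p)"
    by (simp add: sum_distrib_left)
  also have "(\<Sum>\<sigma> | \<sigma> permutes {1..d}. of_int (sign (\<tau> \<circ> \<sigma>)) * perm_poly (\<tau> \<circ> \<sigma>) p) = alt d p"
    unfolding alt_def using assms by (intro setum_permutations_compose_left[symmetric])
  finally show ?thesis .
qed

lemma alt_perm:
  assumes "\<tau> permutes {1..d}"
  shows "alt d (perm_poly \<tau> p) = of_int (sign \<tau>) * alt d p"
proof -
  have perm: "permutation \<sigma>" if "\<sigma> permutes {1..d}" for \<sigma>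
    using that permutation_permutes by blast
  have "alt d (perm_poly \<tau> p) = (\<Sum>\<sigma> | \<sigma> permutes {1..d}. of_int (sign \<sigma>) * perm_poly (\<sigma> \<circ> \<tau>) p)"
    unfolding alt_def using permutes_bij[OF assms]
    by (auto simp: perm_poly_comp permutes_bij intro!: sum.cong)
  also have "\<dots> = (\<Sum>\<sigma> | \<sigma> permutes {1..d}. of_int (sign \<tau>) * (of_int (sign (\<sigma> \<circ> \<tau>)) * perm_poly (\<sigma> \<circ> \<tau>) p))"
  proof (intro sum.cong refl)
    fix \<sigma> assume "\<sigma> \<in> {\<sigma>. \<sigma> permutes {1..d}}"
    then have "sign (\<sigma> \<circ> \<tau>) = sign \<tau> * sign \<sigma>" using perm assms by (simp add: sign_compose)
    then show "of_int (sign \<sigma>) * perm_poly (\<sigma> \<circ> \<tau>) p =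
        of_int (sign \<tau>) * (of_int (sign (\<sigma> \<circ> \<tau>)) * perm_poly (\<sigma> \<circ> \<tau>) p)"
      by (simp add: of_int_sign_sq mult.assoc)
  qed
  also have "\<dots> = of_int (sign \<tau>) * (\<Sum>\<sigma> | \<sigma> permutes {1..d}. of_int (sign (\<sigma> \<circ> \<tau>)) * perm_poly (\<sigma> \<circ> \<tau>) p)"
    by (simp add: sum_distrib_left)
  also have "(\<Sum>\<sigma> | \<sigma> permutes {1..d}. of_int (sign (\<sigma> \<circ> \<tau>)) * perm_poly (\<sigma> \<circ> \<tau>) p) = alt d p"
    unfolding alt_def using assms by (intro sum_permutations_compose_right[symmetric])
  finally show ?thesis .
qed

lemma alt_of_antisym:
  assumes "\<And>\<sigma>. \<sigma> permutes {1..d} \<Longrightarrow> perm_poly \<sigma> p = of_int (sign \<sigma>) * p"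
  shows "alt d p = Const (fact d) * p"
proof -
  have "alt d p = (\<Sum>\<sigma> | \<sigma> permutes {1..d}. p)"
    unfolding alt_def by (intro sum.cong) (auto simp: assms of_int_sign_sq)
  also have "\<dots> = of_nat (fact d) * p" using card_permutations[of "{1..d}" d] by (simp del: One_nat_def)
  also have "(of_nat (fact d) :: mpoly) = Const (fact d)"
    using of_int_Const[of "fact d"] by simp
  finally show ?thesis .
qed

lemma alt_eq_0:
  assumes "i \<in> {1..d}" "j \<in> {1..d}" "i \<noteq> j" "perm_poly (transpose i j) p = p"
  shows "alt d p = 0"
proof -
  have "transpose i j permutes {1..d}" using assms by (simp add: permutes_swap_id)
  from alt_perm[OF this, of p] assms have "alt d p = - alt d p" by (simp add: sign_swap_id)
  then have "alt d p + alt d p = 0" by (metis add.right_inverse)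
  then have "Const 2 * alt d p = 0" using Const_add[of "1::complex" 1] by (simp add: algebra_simps)
  then have "Poly_Mapping.lookup (alt d p) m = 0" for m
    using lookup_Const_mult[of 2 "alt d p" m] by simp
  then show ?thesis by (intro poly_mapping_eqI) simp
qed

lemma vandermonde_antisym:
  "\<tau> permutes {1..d} \<Longrightarrow> perm_poly \<tau> (vandermonde a d) = of_int (sign \<tau>) * vandermonde a d"
  unfolding vandermonde_def by (rule alt_antisym)

lemma vandermonde_0 [simp]: "vandermonde a 0 = 1"
  by (simp add: vandermonde_def alt_def)

lemma perm_poly_var_prod:
  assumes "\<sigma> permutes {1..d}"
  shows "perm_poly \<sigma> (\<Prod>i\<in>{1..d}. shift_var a i ^ e i) = (\<Prod>i\<in>{1..d}. shift_var a i ^ e (inv' \<sigma> i))"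
proof -
  have "perm_poly \<sigma> (\<Prod>i\<in>{1..d}. shift_var a i ^ e i) = (\<Prod>i\<in>{1..d}. shift_var a (\<sigma> i) ^ e (inv' \<sigma> (\<sigma> i)))"
    using permutes_bij[OF assms] permutes_inverses(2)[OF assms]
    by (simp add: perm_poly_prod perm_poly_power perm_poly_shift_var)
  also have "\<dots> = (\<Prod>i\<in>{1..d}. shift_var a i ^ e (inv' \<sigma> i))"
    using prod.permute[OF assms, of "\<lambda>i. shift_var a i ^ e (inv' \<sigma> i)"] by (simp add: comp_def)
  finally show ?thesis .
qed

lemma alt_small_monomial:
  assumes e: "\<And>i. i \<in> {1..d} \<Longrightarrow> e i < d"
  shows "\<exists>c. alt d (\<Prod>i\<in>{1..d}. shift_var a i ^ e i) = Const c * vandermonde a d"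
proof (cases "inj_on e {1..d}")
  case False
  then obtain i j where ij: "i \<in> {1..d}" "j \<in> {1..d}" "i \<noteq> j" "e i = e j" by (auto simp: inj_on_def)
  let ?t = "transpose i j"
  have t: "?t permutes {1..d}" using ij by (simp add: permutes_swap_id)
  have "e (?t l) = e l" for l using ij by (auto simp: transpose_def)
  then have "perm_poly ?t (\<Prod>i\<in>{1..d}. shift_var a i ^ e i) = (\<Prod>i\<in>{1..d}. shift_var a i ^ e i)"
    using perm_poly_var_prod[OF t, of a e] by simp
  from alt_eq_0[OF ij(1-3) this] show ?thesis by (intro exI[of _ 0]) simp
next
  case True
  define \<tau> where "\<tau> = (\<lambda>i. if i \<in> {1..d} then Suc (e i) else i)"
  have "inj_on \<tau> {1..d}"
  proof (rule inj_onI)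
    fix i j assume ij: "i \<in> {1..d}" "j \<in> {1..d}" "\<tau> i = \<tau> j"
    then have "e i = e j" unfolding \<tau>_def by (simp only: if_True nat.inject)
    with True ij show "i = j" by (simp only: inj_on_def)
  qed
  moreover have "\<tau> ` {1..d} \<subseteq> {1..d}" using e by (force simp: \<tau>_def)
  ultimately have "bij_betw \<tau> {1..d} {1..d}" by (simp add: bij_betw_def endo_inj_surj)
  then have \<tau>: "\<tau> permutes {1..d}" by (rule bij_imp_permutes) (simp only: \<tau>_def if_False)
  have inv: "inv' \<tau> permutes {1..d}" using \<tau> by (rule permutes_inv)
  have "perm_poly (inv' \<tau>) (\<Prod>i\<in>{1..d}. shift_var a i ^ (i - 1)) = (\<Prod>i\<in>{1..d}. shift_var a i ^ (\<tau> i - 1))"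
    using perm_poly_var_prod[OF inv, of a "\<lambda>i. i - 1"] by (simp add: permutes_inv_inv[OF \<tau>])
  also have "\<dots> = (\<Prod>i\<in>{1..d}. shift_var a i ^ e i)" by (intro prod.cong) (auto simp: \<tau>_def)
  finally have "alt d (\<Prod>i\<in>{1..d}. shift_var a i ^ e i) =
      Const (of_int (sign (inv' \<tau>))) * vandermonde a d"
    using alt_perm[OF inv, of "\<Prod>i\<in>{1..d}. shift_var a i ^ (i - 1)"]
    by (simp only: vandermonde_def of_int_Const)
  then show ?thesis by blast
qed

lemma coeff_root_poly_top: "coeff (root_poly a d) d = 1" and degree_root_poly: "degree (root_poly a d) \<le> d"
proof -
  have "degree (root_poly a d) \<le> d \<and> coeff (root_poly a d) d = (1 :: 'a mp)"
  proof (induction d)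
    case 0 then show ?case by (simp add: root_poly_def)
  next
    case (Suc d)
    then have "degree (root_poly a (Suc d)) \<le> Suc d"
      unfolding root_poly_Suc using degree_mult_le[of "root_poly a d" "[:- shift_var a (Suc d), 1:]"]
        degree_pCons_le[of "- shift_var a (Suc d)" 1] by (simp add: order.trans)
    moreover have "coeff (root_poly a d) (Suc d) = 0" using Suc by (simp add: coeff_eq_0)
    ultimately show ?case using Suc by (simp add: root_poly_Suc mult.commute[of _ "[:_, 1:]"])
  qed
  then show "coeff (root_poly a d) d = 1" "degree (root_poly a d) \<le> d" by auto
qed

lemma poly_eq_sum_le: "degree p \<le> d \<Longrightarrow> poly p x = (\<Sum>i\<le>d. coeff p i * x ^ i)"
  for p :: "'a::comm_ring_1 poly"
  unfolding poly_altdef by (intro sum.mono_neutral_left) (auto simp: coeff_eq_0)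

lemma shift_var_power_reduce:
  assumes "l \<in> {1..d}"
  shows "shift_var a l ^ d = (\<Sum>j<d. - coeff (root_poly a d) j * shift_var a l ^ j)"
proof -
  have "0 = (\<Sum>j\<le>d. coeff (root_poly a d) j * shift_var a l ^ j)"
    using poly_root_poly[OF assms, of a] poly_eq_sum_le[OF degree_root_poly, of a d] by simp
  also have "\<dots> = (\<Sum>j<d. coeff (root_poly a d) j * shift_var a l ^ j) + shift_var a l ^ d"
    by (simp add: lessThan_Suc_atMost[symmetric] coeff_root_poly_top)
  finally show ?thesis by (simp add: sum_negf eq_neg_iff_add_eq_0 add.commute)
qed

text \<open>Every alternating polynomial is a multiple of the Vandermonde determinant. Instead of unique
  factorization the proof uses that \<open>y\<^sub>l\<^sup>d\<close> is a combination of lower powers of \<open>y\<^sub>l\<close> with coefficients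
  symmetric in the first \<open>d\<close> variables. So every set that is closed under addition and under multiplication
  by such symmetric polynomials, and contains the products of powers of the \<open>y\<^sub>i\<close> with exponents below \<open>d\<close>,
  is everything.\<close>

lemma alt_multiple_vandermonde:
  assumes d: "d \<le> n" and p: "p \<in> polys n"
  shows "\<exists>q\<in>polys n. alt d p = q * vandermonde a d"
proof -
  define sym where "sym = {s \<in> polys n. \<forall>\<sigma>. \<sigma> permutes {1..d} \<longrightarrow> perm_poly \<sigma> s = s}"
  define mono where "mono e = (\<Prod>i\<in>{1..d}. shift_var a i ^ e i)" for e :: "nat \<Rightarrow> nat"
  define closed where "closed G \<longleftrightarrow> (\<forall>p\<in>G. \<forall>q\<in>G. p + q \<in> G) \<and> (\<forall>s\<in>sym. \<forall>p\<in>G. s * p \<in> G) \<and>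
    (\<forall>e. (\<forall>i\<in>{1..d}. e i < d) \<longrightarrow> mono e \<in> G)" for G
  have symC: "Const c \<in> sym" for c by (simp add: sym_def perm_poly_Const permutes_bij)
  have one: "1 \<in> G" if "closed G" for G
  proof -
    have "mono (\<lambda>_. 0) \<in> G" using that unfolding closed_def by auto
    then show ?thesis by (simp add: mono_def)
  qed
  have gen: "\<forall>G. closed G \<longrightarrow> p \<in> G" using p
  proof (induction p rule: polys_induct)
    case (const c)
    then show ?case using one symC[of c] unfolding closed_def by (metis mult.right_neutral)
  next
    case (add p q)
    then show ?case unfolding closed_def by blast
  next
    case (Var l p)
    show ?case
    proof (intro allI impI)
      fix G assume G: "closed G"
      have add: "\<And>p q. p \<in> G \<Longrightarrow> q \<in> G \<Longrightarrow> p + q \<in> G" and sm: "\<And>s p. s \<in> sym \<Longrightarrow> p \<in> G \<Longrightarrow> s * p \<in> G"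
        and mo: "\<And>e. (\<And>i. i\<in>{1..d} \<Longrightarrow> e i < d) \<Longrightarrow> mono e \<in> G"
        using G by (auto simp: closed_def)
      have Gsum: "sum f A \<in> G" if "\<And>x. x \<in> A \<Longrightarrow> f x \<in> G" for f :: "nat \<Rightarrow> mpoly" and A
        using that
      proof (induction A rule: infinite_finite_induct)
        case (insert x F) then show ?case using add by simp
      qed (use sm[OF symC[of 0] one[OF G]] in auto)
      have key: "Var l * mono e \<in> G" if e: "\<And>i. i\<in>{1..d} \<Longrightarrow> e i < d" for e
      proof (cases "l \<in> {1..d}")
        case False
        then have "Var l \<in> sym" unfolding sym_def using Var(1)
          by (auto simp: polys_Var perm_poly_Var permutes_bij permutes_not_in)
        then show ?thesis using sm mo[of e] e by blast
      next
        case True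
        have upd: "mono (e(l := j)) = shift_var a l ^ j * (\<Prod>i\<in>{1..d} - {l}. shift_var a i ^ e i)" for j
          unfolding mono_def using True by (subst prod.remove[of _ l]) auto
        have "shift_var a l * mono e = mono (e(l := Suc (e l)))"
          using upd[of "e l"] upd[of "Suc (e l)"] by (simp add: mult.assoc)
        also have "\<dots> \<in> G"
        proof (cases "Suc (e l) < d")
          case True
          then show ?thesis using e by (intro mo) auto
        next
          case False
          then have "Suc (e l) = d" using e[OF True] by auto
          then have "mono (e(l := Suc (e l))) = (\<Sum>j<d. - coeff (root_poly a d) j * mono (e(l := j)))"
            unfolding upd using shift_var_power_reduce[OF True, of a] by (simp add: sum_distrib_right mult.assoc)
          also have "\<dots> \<in> G"
          proof (intro Gsum sm mo)
            fix j assume "j \<in> {..<d}"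
            then show "(e(l := j)) i < d" if "i \<in> {1..d}" for i using e[OF that] by simp
            have "coeff (root_poly a d) j \<in> polys n"
              using coeffs_in_root_poly[OF d, of a] by (simp add: coeffs_in_def)
            moreover have "perm_poly \<sigma> (coeff (root_poly a d) j) = coeff (root_poly a d) j"
              if "\<sigma> permutes {1..d}" for \<sigma>
              unfolding root_poly_def using that
              by (intro perm_poly_coeff_linear_prod permutes_bij permutes_image)
            ultimately show "- coeff (root_poly a d) j \<in> sym"
              unfolding sym_def by (auto simp: polys_uminus perm_poly_uminus permutes_bij)
          qed
          finally show ?thesis .
        qed
        finally have "shift_var a l * mono e \<in> G" .
        moreover have "Const a * mono e \<in> G" using sm symC mo[of e] e by blast
        ultimately have "shift_var a l * mono e + Const a * mono e \<in> G" by (rule add)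
        then show ?thesis by (simp add: shift_var_def algebra_simps)
      qed
      have "closed {p. Var l * p \<in> G}"
        unfolding closed_def using add sm key by (auto simp: distrib_left mult.left_commute)
      then show "Var l * p \<in> G" using Var(3) by blast
    qed
  qed
  have "closed {p. \<exists>q\<in>polys n. alt d p = q * vandermonde a d}" (is "closed ?G")
    unfolding closed_def
  proof (intro conjI ballI allI impI)
    fix p q assume "p \<in> ?G" "q \<in> ?G"
    then obtain p' q' where "p' \<in> polys n" "q' \<in> polys n" "alt d p = p' * vandermonde a d"
      "alt d q = q' * vandermonde a d" by blast
    then show "p + q \<in> ?G" by (auto simp: alt_add distrib_right[symmetric] intro: polys_add)
  next
    fix s p assume s: "s \<in> sym" and "p \<in> ?G"
    then obtain q where "q \<in> polys n" "alt d p = q * vandermonde a d" by blast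
    moreover have "alt d (s * p) = s * alt d p" using s by (intro alt_sym_mult) (auto simp: sym_def)
    moreover have "s \<in> polys n" using s by (simp add: sym_def)
    ultimately show "s * p \<in> ?G" by (auto simp: mult.assoc[symmetric] intro: polys_mult)
  next
    fix e assume "\<forall>i\<in>{1..d}. e i < d"
    then show "mono e \<in> ?G" using alt_small_monomial[of d e a] unfolding mono_def by fastforce
  qed
  then show ?thesis using gen by blast
qed


section \<open>Independence of the hook monomials\<close>

text \<open>Closure under the permutations of the first \<open>n\<close> variables.\<close>

definition stable :: "nat \<Rightarrow> mpoly set \<Rightarrow> bool" where
  "stable n J \<longleftrightarrow> (\<forall>\<sigma> p. \<sigma> permutes {1..n} \<longrightarrow> p \<in> J \<longrightarrow> perm_poly \<sigma> p \<in> J)"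

lemma stable_mono: "stable n J \<Longrightarrow> m \<le> n \<Longrightarrow> stable m J"
  unfolding stable_def
  using permutes_subset[of _ "{1..m}" "{1..n}"] by (meson atLeastatMost_subset_iff order_refl)

lemma stable_adjoin:
  assumes "stable n J" and w: "\<And>\<sigma>. \<sigma> permutes {1..n} \<Longrightarrow> perm_poly \<sigma> w = w" and "n \<le> m"
  shows "stable n (adjoin m J w)"
  unfolding stable_def
proof (intro allI impI)
  fix \<sigma> p assume \<sigma>: "\<sigma> permutes {1..n}" and "p \<in> adjoin m J w"
  then obtain j q where *: "p = j + w * q" "j \<in> J" "q \<in> polys m" unfolding adjoin_def by blast
  have "perm_poly \<sigma> p = perm_poly \<sigma> j + w * perm_poly \<sigma> q"
    using permutes_bij[OF \<sigma>] w[OF \<sigma>] by (simp add: * perm_poly_add perm_poly_mult)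
  moreover have "perm_poly \<sigma> j \<in> J" using assms(1) \<sigma> *(2) by (auto simp: stable_def)
  moreover have "perm_poly \<sigma> q \<in> polys m"
    using \<sigma> *(3) assms(3) by (intro perm_poly_polys permutes_subset[OF \<sigma>]) auto
  ultimately show "perm_poly \<sigma> p \<in> adjoin m J w" unfolding adjoin_def by blast
qed

lemma alt_in_stable:
  assumes "submod n J" "stable n J" "d \<le> n" "p \<in> J"
  shows "alt d p \<in> J"
  unfolding alt_def
proof (intro submod_sum[OF assms(1)] submod_mult[OF assms(1)])
  fix \<sigma> assume "\<sigma> \<in> {\<sigma>. \<sigma> permutes {1..d}}"
  then have "\<sigma> permutes {1..n}" using assms(3) by (auto intro: permutes_subset)
  then show "perm_poly \<sigma> p \<in> J" using assms by (auto simp: stable_def)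
qed (simp add: of_int_Const)

lemma submod_cancel_Const:
  fixes J :: "mpoly set"
  assumes "submod n J" "Const c * p \<in> J" "c \<noteq> 0"
  shows "p \<in> J"
proof -
  have "Const (1 / c) * (Const c * p) \<in> J" by (rule submod_mult[OF assms(1) polys_Const assms(2)])
  moreover have "Const (1 / c) * (Const c * p) = p"
    using Const_mult[of "1 / c" c] assms(3) by (simp add: mult.assoc[symmetric])
  ultimately show ?thesis by (simp only:)
qed

lemma polys_of_int: "of_int i \<in> (polys n :: mpoly set)"
  by (simp add: of_int_Const)

lemma alt_power_vandermonde:
  assumes "j \<le> d"
  shows "alt (Suc d) (shift_var a (Suc d) ^ j * vandermonde a d) =
    (if j = d then Const (fact d) * vandermonde a (Suc d) else 0)"
proof -
  let ?y = "shift_var a (Suc d)"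
  define st where "st = (\<Prod>i\<in>{1..d}. shift_var a i ^ (i - 1))"
  have eq: "alt (Suc d) (?y ^ j * (of_int (sign \<sigma>) * perm_poly \<sigma> st)) = alt (Suc d) (?y ^ j * st)"
    if \<sigma>: "\<sigma> permutes {1..d}" for \<sigma>
  proof -
    have \<sigma>': "\<sigma> permutes {1..Suc d}" using \<sigma> by (rule permutes_subset) auto
    have "\<sigma> (Suc d) = Suc d" using \<sigma> by (auto simp: permutes_not_in)
    then have *: "?y ^ j * (of_int (sign \<sigma>) * perm_poly \<sigma> st) = Const (of_int (sign \<sigma>)) * perm_poly \<sigma> (?y ^ j * st)"
      using permutes_bij[OF \<sigma>]
      by (simp add: perm_poly_mult perm_poly_power perm_poly_shift_var of_int_Const mult_ac)
    show ?thesis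
      unfolding * alt_Const_mult alt_perm[OF \<sigma>'] unfolding of_int_Const[symmetric] by (rule of_int_sign_sq)
  qed
  have "alt (Suc d) (?y ^ j * vandermonde a d) = (\<Sum>\<sigma> | \<sigma> permutes {1..d}. alt (Suc d) (?y ^ j * st))"
    unfolding vandermonde_def st_def[symmetric] alt_def[of d] sum_distrib_left alt_sum
    using eq by (intro sum.cong) auto
  also have "\<dots> = of_nat (fact d) * alt (Suc d) (?y ^ j * st)"
    using card_permutations[of "{1..d}" d] by (simp del: One_nat_def)
  also have "(of_nat (fact d) :: mpoly) = Const (fact d)"
    using of_int_Const[of "fact d"] by simp
  also have "alt (Suc d) (?y ^ j * st) = (if j = d then vandermonde a (Suc d) else 0)"
  proof (cases "j = d")
    case True
    then show ?thesis by (simp add: st_def vandermonde_def mult.commute)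
  next
    case False
    then have j: "j < d" using assms by simp
    let ?t = "transpose (Suc j) (Suc d)"
    have b: "bij ?t" by simp
    have st: "st = shift_var a (Suc j) ^ j * (\<Prod>i\<in>{1..d} - {Suc j}. shift_var a i ^ (i - 1))"
      unfolding st_def using j by (subst prod.remove[of _ "Suc j"]) auto
    have "perm_poly ?t (\<Prod>i\<in>{1..d} - {Suc j}. shift_var a i ^ (i - 1)) =
        (\<Prod>i\<in>{1..d} - {Suc j}. shift_var a i ^ (i - 1))"
      by (auto simp: perm_poly_prod perm_poly_power perm_poly_shift_var transpose_def intro!: prod.cong)
    then have "perm_poly ?t (?y ^ j * st) = ?y ^ j * st"
      unfolding st using b by (simp add: perm_poly_mult perm_poly_power perm_poly_shift_var mult_ac)
    then have "alt (Suc d) (?y ^ j * st) = 0"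
      using j by (intro alt_eq_0[of "Suc j" _ "Suc d"]) auto
    then show ?thesis using False by simp
  qed
  finally show ?thesis by simp
qed

lemma prod_list_monic:
  "\<exists>c. (\<Prod>b\<leftarrow>bs. y - Const b) = y ^ length bs + (\<Sum>j<length bs. Const (c j) * y ^ j)"
  for bs :: "complex list" and y :: mpoly
proof -
  have "\<exists>G::complex poly. degree G = length bs \<and> lead_coeff G = 1 \<and> poly (map_poly Const G) y = (\<Prod>b\<leftarrow>bs. y - Const b)"
  proof (induction bs)
    case Nil
    then show ?case by (intro exI[of _ 1]) (simp add: map_poly_1)
  next
    case (Cons b bs)
    then obtain G :: "complex poly" where G: "degree G = length bs" "lead_coeff G = 1"
      "poly (map_poly Const G) y = (\<Prod>b\<leftarrow>bs. y - Const b)" by blast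
    have "G \<noteq> 0" using G(2) by auto
    then have "degree ([:- b, 1:] * G) = Suc (length bs)"
      using G by (simp add: degree_mult_eq del: mult_pCons_left)
    moreover have "coeff ([:- b, 1:] * G) (Suc (length bs)) = 1"
      using G by (simp add: coeff_eq_0)
    ultimately have deg: "degree ([:- b, 1:] * G) = Suc (length bs)" "lead_coeff ([:- b, 1:] * G) = 1"
      by simp_all
    have "map_poly Const ([:- b, 1:] * G) = [:- Const b, 1:] * map_poly Const G"
      by (subst map_poly_mult_hom) (simp_all add: Const_add Const_mult map_poly_linear Const_minus)
    note * = this
    have "poly (map_poly Const ([:- b, 1:] * G)) y = (\<Prod>b\<leftarrow>b # bs. y - Const b)"
      using G(3) by (simp only: * poly_mult) (simp add: algebra_simps)
    with deg show ?case by (intro exI[of _ "[:- b, 1:] * G"]) simp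
  qed
  then obtain G :: "complex poly" where G: "degree G = length bs" "lead_coeff G = 1"
      "poly (map_poly Const G) y = (\<Prod>b\<leftarrow>bs. y - Const b)" by blast
  have "degree (map_poly Const G :: mpoly poly) \<le> length bs" using G(1) by (intro degree_le) (auto simp: coeff_map_poly coeff_eq_0)
  from poly_eq_sum_le[OF this, of y]
  have "(\<Prod>b\<leftarrow>bs. y - Const b) = (\<Sum>j\<le>length bs. Const (coeff G j) * y ^ j)"
    using G(3) by (simp add: coeff_map_poly)
  also have "\<dots> = y ^ length bs + (\<Sum>j<length bs. Const (coeff G j) * y ^ j)"
    using G(1,2) by (simp add: lessThan_Suc_atMost[symmetric])
  finally show ?thesis by blast
qed

text \<open>A monic polynomial of degree \<open>d\<close> in one more variable completes the Vandermonde determinant of \<open>d\<close>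
  variables to that of \<open>d + 1\<close> variables; its lower terms alternate to zero.\<close>

lemma alt_monic_vandermonde:
  assumes "length bs = d"
  shows "alt (Suc d) ((\<Prod>b\<leftarrow>bs. shift_var a (Suc d) - Const b) * vandermonde a d) =
    Const (fact d) * vandermonde a (Suc d)"
proof -
  let ?y = "shift_var a (Suc d)"
  obtain c where c: "(\<Prod>b\<leftarrow>bs. ?y - Const b) = ?y ^ d + (\<Sum>j<d. Const (c j) * ?y ^ j)"
    using prod_list_monic[where y = ?y and bs = bs] assms by blast
  have "alt (Suc d) (?y ^ d * vandermonde a d + (\<Sum>j<d. Const (c j) * (?y ^ j * vandermonde a d))) =
      Const (fact d) * vandermonde a (Suc d)"
    by (simp add: alt_add alt_sum alt_Const_mult alt_power_vandermonde)
  then show ?thesis unfolding c by (simp add: distrib_right sum_distrib_right mult.assoc)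
qed

lemma vandermonde_fixed:
  assumes \<sigma>: "bij \<sigma>" "\<And>i. i \<in> {1..d} \<Longrightarrow> \<sigma> i = i"
  shows "perm_poly \<sigma> (vandermonde a d) = vandermonde a d"
  unfolding vandermonde_def alt_def perm_poly_sum[OF \<sigma>(1)]
proof (intro sum.cong refl)
  fix \<tau> assume "\<tau> \<in> {\<tau>. \<tau> permutes {1..d}}"
  then have \<tau>: "\<tau> permutes {1..d}" by simp
  have "\<sigma> (\<tau> i) = \<tau> i" if "i \<in> {1..d}" for i using that \<sigma>(2) permutes_in_image[OF \<tau>] by blast
  then show "perm_poly \<sigma> (of_int (sign \<tau>) * perm_poly \<tau> (\<Prod>i\<in>{1..d}. shift_var a i ^ (i - 1))) =
      of_int (sign \<tau>) * perm_poly \<tau> (\<Prod>i\<in>{1..d}. shift_var a i ^ (i - 1))"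
    using \<sigma>(1) permutes_bij[OF \<tau>]
    by (simp add: perm_poly_mult perm_poly_of_int perm_poly_prod perm_poly_power perm_poly_shift_var)
qed

text \<open>The Vandermonde determinant with one variable less survives in the layers that lose a root: multiplied by the
  remaining linear factors and alternated, it becomes the full determinant.\<close>

lemma layer_nondegenerate:
  assumes J: "submod n J" and stab: "stable n J"
    and v: "\<And>\<sigma>. \<sigma> permutes {1..n} \<Longrightarrow> perm_poly \<sigma> v = v"
    and last: "v * (\<Prod>b\<leftarrow>pre @ b # suf. shift_var a n - Const b) \<in> J"
    and d: "d = length (pre @ suf)" "Suc d \<le> n"
    and nd: "v * vandermonde a (Suc d) \<notin> J"
    and w: "w = v * (\<Prod>b\<leftarrow>pre. shift_var a n - Const b)"
  shows "w * vandermonde a d \<notin> adjoin n J (w * (shift_var a n - Const b))"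
proof
  let ?y = "shift_var a n"
  let ?P = "\<lambda>bs y. \<Prod>b\<leftarrow>bs. y - Const b"
  assume "w * vandermonde a d \<in> adjoin n J (w * (?y - Const b))"
  then obtain j q where jq: "w * vandermonde a d = j + w * (?y - Const b) * q" "j \<in> J" "q \<in> polys n"
    unfolding adjoin_def by blast
  have y: "?y \<in> polys n" using d by (intro polys_shift_var) auto
  have suf: "?P suf ?y \<in> polys n" by (intro polys_prod_list polys_diff y polys_Const)
  have "v * (?P (pre @ suf) ?y * vandermonde a d) = ?P suf ?y * (w * vandermonde a d)"
    by (simp add: w mult_ac)
  also have "\<dots> = ?P suf ?y * j + q * (v * ?P (pre @ b # suf) ?y)"
    unfolding jq(1) by (simp add: w algebra_simps)
  also have "\<dots> \<in> J" using jq suf last submod_mult[OF J] submod_add[OF J] by blast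
  finally have 1: "v * (?P (pre @ suf) ?y * vandermonde a d) \<in> J" .
  let ?t = "transpose (Suc d) n"
  have t: "?t permutes {1..n}" using d by (intro permutes_swap_id) auto
  have "perm_poly ?t (vandermonde a d) = vandermonde a d"
    using d(2) by (intro vandermonde_fixed) (auto simp: transpose_def)
  then have "perm_poly ?t (v * (?P (pre @ suf) ?y * vandermonde a d)) =
      v * (?P (pre @ suf) (shift_var a (Suc d)) * vandermonde a d)"
    using v[OF t]
    by (simp add: perm_poly_mult perm_poly_prod_list perm_poly_diff perm_poly_shift_var perm_poly_Const)
  with 1 stab t have "v * (?P (pre @ suf) (shift_var a (Suc d)) * vandermonde a d) \<in> J"
    unfolding stable_def by metis
  from alt_in_stable[OF J stab d(2) this]
  have "v * alt (Suc d) (?P (pre @ suf) (shift_var a (Suc d)) * vandermonde a d) \<in> J"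
    using v permutes_subset[of _ "{1..Suc d}" "{1..n}"] d(2) by (subst (asm) alt_sym_mult) auto
  then have "Const (fact d) * (v * vandermonde a (Suc d)) \<in> J"
    using alt_monic_vandermonde[of "pre @ suf" d a] d(1) by (simp add: mult_ac)
  from submod_cancel_Const[OF J this] nd show False by simp
qed

text \<open>For \<open>k \<ge> 2\<close> the determinant survives in the first layer: it is killed by \<open>y\<^sub>n\<close>, since each of its terms involves
  \<open>r\<close> of the other variables, hence so is every alternating polynomial.\<close>

lemma head_nondegenerate:
  assumes J: "submod n J" and stab: "stable n J"
    and v: "\<And>\<sigma>. \<sigma> permutes {1..n} \<Longrightarrow> perm_poly \<sigma> v = v"
    and rel: "hook_relations a bs k J v" and n: "n = k + length bs" and d: "d = Suc (length bs)" "d < n"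
    and nd: "v * vandermonde a d \<notin> J"
  shows "v * vandermonde a d \<notin> adjoin n J (v * shift_var a n)"
proof
  let ?y = "shift_var a n"
  assume "v * vandermonde a d \<in> adjoin n J (v * ?y)"
  then obtain j q where jq: "v * vandermonde a d = j + v * ?y * q" "j \<in> J" "q \<in> polys n"
    unfolding adjoin_def by blast
  have vinv: "perm_poly \<sigma> v = v" if "\<sigma> permutes {1..d}" for \<sigma>
    using that d by (intro v permutes_subset[OF that]) auto
  have yinv: "perm_poly \<sigma> ?y = ?y" if "\<sigma> permutes {1..d}" for \<sigma>
    using that d by (simp add: perm_poly_shift_var permutes_bij permutes_not_in)
  have kill: "v * (?y * vandermonde a d) \<in> J"
  proof -
    have "v * (?y * perm_poly \<sigma> (\<Prod>i\<in>{1..d}. shift_var a i ^ (i - 1))) \<in> J" if \<sigma>: "\<sigma> permutes {1..d}" for \<sigma>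
    proof -
      have inj: "inj_on \<sigma> A" for A using permutes_inj[OF \<sigma>] inj_on_subset by blast
      let ?S = "insert n (\<sigma> ` {2..d})"
      have im: "\<sigma> ` {2..d} \<subseteq> {1..d}" using permutes_image[OF \<sigma>] by auto
      then have n': "n \<notin> \<sigma> ` {2..d}" using d by auto
      have "card ?S = Suc (length bs)" using d(1) n' card_image[OF inj[of "{2..d}"]] by simp
      moreover have "?S \<subseteq> {1..k + length bs}" using im d n by auto
      ultimately have 1: "v * (\<Prod>i\<in>?S. shift_var a i) \<in> J" using rel unfolding hook_relations_def by blast
      have "{1..d} = insert 1 {2..d}" using d by auto
      then have e: "(\<Prod>i\<in>{1..d}. g i) = g 1 * (\<Prod>i\<in>{2..d}. g i)" for g :: "nat \<Rightarrow> mpoly" by simp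
      have "perm_poly \<sigma> (\<Prod>i\<in>{1..d}. shift_var a i ^ (i - 1)) = (\<Prod>i\<in>{2..d}. shift_var a (\<sigma> i) ^ (i - 1))"
        using permutes_bij[OF \<sigma>] unfolding e by (simp add: perm_poly_mult perm_poly_1 perm_poly_prod perm_poly_power perm_poly_shift_var)
      also have "\<dots> = (\<Prod>i\<in>{2..d}. shift_var a (\<sigma> i) * shift_var a (\<sigma> i) ^ (i - 2))"
        by (intro prod.cong refl) (simp add: power_Suc[symmetric] Suc_diff_Suc numeral_2_eq_2 del: power_Suc)
      also have "\<dots> = (\<Prod>i\<in>\<sigma> ` {2..d}. shift_var a i) * (\<Prod>i\<in>{2..d}. shift_var a (\<sigma> i) ^ (i - 2))"
        using prod.reindex[OF inj[of "{2..d}"], of "shift_var a"] by (simp add: prod.distrib comp_def)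
      finally have 2: "perm_poly \<sigma> (\<Prod>i\<in>{1..d}. shift_var a i ^ (i - 1)) =
          (\<Prod>i\<in>\<sigma> ` {2..d}. shift_var a i) * (\<Prod>i\<in>{2..d}. shift_var a (\<sigma> i) ^ (i - 2))" .
      have rest: "(\<Prod>i\<in>{2..d}. shift_var a (\<sigma> i) ^ (i - 2)) \<in> polys n"
      proof (intro polys_prod polys_power polys_shift_var)
        fix i assume "i \<in> {2..d}"
        then have "\<sigma> i \<in> {1..d}" using im by blast
        then show "\<sigma> i \<in> {1..n}" using d(2) by simp
      qed
      have "(\<Prod>i\<in>?S. shift_var a i) = ?y * (\<Prod>i\<in>\<sigma> ` {2..d}. shift_var a i)"
        using n' by simp
      then show ?thesis
        using submod_mult2[OF J rest 1] unfolding 2 by (simp only: mult.assoc)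
    qed
    then have "(\<Sum>\<sigma> | \<sigma> permutes {1..d}. of_int (sign \<sigma>) *
        (v * (?y * perm_poly \<sigma> (\<Prod>i\<in>{1..d}. shift_var a i ^ (i - 1))))) \<in> J"
      by (intro submod_sum[OF J], intro submod_mult[OF J polys_of_int]) blast
    then show ?thesis unfolding vandermonde_def alt_def by (simp add: sum_distrib_left mult_ac)
  qed
  obtain q' where q': "q' \<in> polys n" "alt d q = q' * vandermonde a d"
    using alt_multiple_vandermonde[of d n q a] jq d by auto
  have "alt d (vandermonde a d) = Const (fact d) * vandermonde a d"
    by (rule alt_of_antisym, rule vandermonde_antisym)
  moreover have "alt d (v * vandermonde a d) = v * alt d (vandermonde a d)"
    by (rule alt_sym_mult, rule vinv)
  ultimately have "alt d (v * vandermonde a d) = v * (Const (fact d) * vandermonde a d)" by simp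
  moreover have "alt d ((v * ?y) * q) = (v * ?y) * alt d q"
    using vinv yinv by (intro alt_sym_mult) (simp add: perm_poly_mult permutes_bij)
  then have "alt d (j + v * ?y * q) = alt d j + q' * (v * (?y * vandermonde a d))"
    by (simp add: alt_add q'(2) mult_ac)
  moreover have "alt d j + q' * (v * (?y * vandermonde a d)) \<in> J"
    using alt_in_stable[OF J stab _ jq(2), of d] d kill q' submod_add[OF J] submod_mult[OF J] by auto
  ultimately have "v * (Const (fact d) * vandermonde a d) \<in> J" using jq(1) by simp
  then have "Const (fact d) * (v * vandermonde a d) \<in> J"
    unfolding mult.left_commute[of v "Const (fact d)"] .
  from submod_cancel_Const[OF J this] nd show False by simp
qed

lemma layers_decompose:
  fixes s :: "'c::comm_ring_1 mp"
  assumes "Poly_Mapping.keys s \<subseteq> (\<Union>j<d. (\<lambda>m. m + Poly_Mapping.single n j) ` B j)"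
  obtains S where "\<And>j. Poly_Mapping.keys (coeff S j) \<subseteq> B j" "\<And>j. j \<ge> d \<Longrightarrow> coeff S j = 0"
    "poly S (Var n) = s"
proof -
  have "\<forall>m\<in>Poly_Mapping.keys s. \<exists>j b. j < d \<and> b \<in> B j \<and> m = b + Poly_Mapping.single n j"
    using assms by blast
  then obtain f g where fg: "\<And>m. m \<in> Poly_Mapping.keys s \<Longrightarrow>
      f m < d \<and> g m \<in> B (f m) \<and> m = g m + Poly_Mapping.single n (f m)" by metis
  define S where "S = (\<Sum>m\<in>Poly_Mapping.keys s.
      Polynomial.monom (Poly_Mapping.single (g m) (Poly_Mapping.lookup s m)) (f m))"
  have co: "coeff S j = (\<Sum>m\<in>Poly_Mapping.keys s.
      if f m = j then Poly_Mapping.single (g m) (Poly_Mapping.lookup s m) else 0)" for j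
    by (simp add: S_def coeff_sum)
  show ?thesis
  proof (rule that)
    fix j show "Poly_Mapping.keys (coeff S j) \<subseteq> B j"
    proof
      fix m assume "m \<in> Poly_Mapping.keys (coeff S j)"
      then obtain m' where "m' \<in> Poly_Mapping.keys s"
        "m \<in> Poly_Mapping.keys (if f m' = j then Poly_Mapping.single (g m') (Poly_Mapping.lookup s m') else 0)"
        unfolding co by (rule UN_E[OF subsetD[OF Poly_Mapping.keys_sum]])
      then show "m \<in> B j" using fg[of m'] by (auto split: if_splits)
    qed
  next
    fix j assume "j \<ge> d"
    then show "coeff S j = 0" unfolding co using fg by (intro sum.neutral) force
  next
    have "poly S (Var n) = (\<Sum>m\<in>Poly_Mapping.keys s.
        Poly_Mapping.single (g m) (Poly_Mapping.lookup s m) * Var n ^ f m)"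
      by (simp add: S_def poly_sum poly_monom)
    also have "\<dots> = (\<Sum>m\<in>Poly_Mapping.keys s. Poly_Mapping.single m (Poly_Mapping.lookup s m))"
            unfolding Var_power mult_single
    proof (intro sum.cong refl)
      fix m assume "m \<in> Poly_Mapping.keys s"
      then have "g m + Poly_Mapping.single n (f m) = m" using fg by metis
      then show "Poly_Mapping.single (g m + Poly_Mapping.single n (f m)) (Poly_Mapping.lookup s m * 1) =
          Poly_Mapping.single m (Poly_Mapping.lookup s m)" by simp
    qed
    finally show "poly S (Var n) = s" using single_sum_keys[of s] by simp
  qed
qed

text \<open>By \<open>num_layers\<close>, the determinant involves \<open>r + 1\<close> variables, or all \<open>r\<close> variables if \<open>k = 0\<close>.\<close>

theorem hook_monoms_indep:
  fixes v :: mpoly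
  assumes "length bs = r" "submod (k + r) J" "stable (k + r) J"
    and "\<And>\<sigma>. \<sigma> permutes {1..k + r} \<Longrightarrow> perm_poly \<sigma> v = v"
    and "hook_relations a bs k J v"
    and "v * vandermonde a (num_layers k r) \<notin> J"
    and "Poly_Mapping.keys s \<subseteq> hook_monoms k r" "v * s \<in> J"
  shows "s = 0"
  using assms
proof (induction "k + r" arbitrary: k r bs J v s rule: less_induct)
  case less
  show ?case
  proof (cases "k + r")
    case 0
    then have kr: "k = 0" "r = 0" by auto
    then have "s = Const (Poly_Mapping.lookup s 0)"
      using less.prems(7) by (intro poly_mapping_eqI) (auto simp: Const_def lookup_single when_def in_keys_iff)
    then have "Const (Poly_Mapping.lookup s 0) * v \<in> J" using less.prems(8) by (simp add: mult.commute)
    then have "Poly_Mapping.lookup s 0 = 0"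
      using submod_cancel_Const[OF less.prems(2)] less.prems(6) kr by (force simp: num_layers_def)
    then show ?thesis using \<open>s = _\<close> by simp
  next
    case (Suc n)
    have J: "submod (Suc n) J" and stab: "stable (Suc n) J"
      and vinv: "\<And>\<sigma>. \<sigma> permutes {1..Suc n} \<Longrightarrow> perm_poly \<sigma> v = v"
      using less.prems Suc by auto
    have n: "Suc n = k + length bs" using less.prems Suc by simp
    have last: "v * head_factor a k (Suc n) * (\<Prod>b\<leftarrow>bs. shift_var a (Suc n) - Const b) \<in> J"
      using hook_relations_last[OF J n _ less.prems(5)] by simp
    obtain S where S: "\<And>j. Poly_Mapping.keys (coeff S j) \<subseteq> layer k r j"
        "\<And>j. j \<ge> num_layers k r \<Longrightarrow> coeff S j = 0" "poly S (Var (Suc n)) = s"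
      using layers_decompose[where s = s and d = "num_layers k r" and n = "Suc n" and B = "layer k r"] less.prems(7)
        hook_monoms_layers[of k r] Suc by auto
    have "S = 0"
    proof (rule chain_indep[OF J, where B = "layer k r" and cs = "root_list a k bs" and v = v])
      show "layer k r (Suc j) \<subseteq> layer k r j" for j by (rule layer_antimono)
      show "layer k r 0 \<subseteq> monoms (Suc n)"
        unfolding layer_def using Suc
        by (auto intro!: subsetD[OF order_trans[OF hook_monoms_monoms monoms_mono]])
      show "v * poly S (Var (Suc n)) \<in> J" using S(3) less.prems(8) by simp
      show "Poly_Mapping.keys (coeff S j) \<subseteq> layer k r j" for j by (rule S(1))
      show "coeff S j = 0" if "length (root_list a k bs) \<le> j" for j
        using that S(2) less.prems(1) by (simp add: length_root_list)
      fix pre c suf and s :: mpoly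
      assume split: "root_list a k bs = pre @ c # suf" and s: "Poly_Mapping.keys s \<subseteq> layer k r (length pre)"
      let ?w = "v * (\<Prod>c\<leftarrow>pre. Var (Suc n) - Const c)"
      let ?w' = "v * (\<Prod>c\<leftarrow>pre @ [c]. Var (Suc n) - Const c)"
      assume mem: "?w * s \<in> adjoin (Suc n) J ?w'"
      have J': "submod n (adjoin (Suc n) J ?w')"
        using submod_mono[OF submod_adjoin[OF J], of n] by simp
      have fix_last: "\<sigma> (Suc n) = Suc n" if "\<sigma> permutes {1..n}" for \<sigma>
        using that by (auto simp: permutes_not_in)
      have inv: "perm_poly \<sigma> (v * (\<Prod>c\<leftarrow>cs. Var (Suc n) - Const c)) = v * (\<Prod>c\<leftarrow>cs. Var (Suc n) - Const c)"
        if "\<sigma> permutes {1..n}" for \<sigma> cs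
        using vinv[of \<sigma>] permutes_subset[OF that, of "{1..Suc n}"] permutes_bij[OF that] fix_last[OF that]
        by (simp add: perm_poly_mult perm_poly_prod_list perm_poly_diff perm_poly_Var perm_poly_Const)
      have stab': "stable n (adjoin (Suc n) J ?w')"
        using stable_mono[OF stab, of n] by (intro stable_adjoin inv) auto
      from split show "s = 0"
      proof (cases rule: root_list_cases)
        case head
        then obtain k' where k: "k = Suc k'" by (cases k) auto
        have w': "?w' = v * shift_var a (Suc n)" using head by (simp add: shift_var_def)
        have "hook_relations a bs k' (adjoin (Suc n) J ?w') v"
          using hook_relations_head[OF J, of k' bs a v] n k less.prems(5) head by (simp add: shift_var_def)
        moreover have kr: "k' + r = n" using k Suc by simp
        moreover have "v * vandermonde a (num_layers k' r) \<notin> adjoin (Suc n) J ?w'"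
        proof (cases "k' = 0")
          case False
          then show ?thesis unfolding w'
            using head_nondegenerate[OF J stab vinv less.prems(5) n, of "Suc r"] less.prems(1,6) k kr
            by (simp add: num_layers_def)
        next
          case True
          have "v * vandermonde a r \<notin> adjoin (Suc n) J (v * (shift_var a (Suc n) - Const 0))"
            using last less.prems(1,6) k True kr
            by (intro layer_nondegenerate[OF J stab vinv, where pre = "[]" and b = 0 and suf = bs])
              (auto simp: num_layers_def head_factor_def mult.assoc)
          then show ?thesis using True unfolding w' by (simp add: num_layers_def)
        qed
        ultimately show ?thesis
          using less.hyps[of k' r bs "adjoin (Suc n) J ?w'" v s] less.prems(1) k s mem J' stab' head
            inv[of _ "[]"] by (simp add: layer_def)
      next
        case (root pre' b suf')
        have w: "?w = v * head_factor a k (Suc n) * (\<Prod>b\<leftarrow>pre'. shift_var a (Suc n) - Const b)"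
          using root(4) by (simp add: mult.assoc)
        have w': "?w' = ?w * (shift_var a (Suc n) - Const b)"
          using root(2) by (simp add: shift_var_def Const_add mult.assoc diff_diff_eq)
        have "hook_relations a (pre' @ suf') k (adjoin (Suc n) J ?w') ?w"
          unfolding w' by (rule hook_relations_root[OF J n less.prems(5) root(1) w])
        moreover have r: "length (pre' @ suf') = r - 1" "k + (r - 1) = n" "r \<ge> 1"
          using root(1) less.prems(1) Suc by auto
        moreover have "layer k r (length pre) = hook_monoms k (r - 1)"
          using root(3) by (auto simp: layer_def)
        moreover have "?w * vandermonde a (num_layers k (r - 1)) \<notin> adjoin (Suc n) J ?w'"
        proof -
          let ?hd = "if k = 0 then [] else [0::complex]"
          have hd: "head_factor a k (Suc n) = (\<Prod>b\<leftarrow>?hd. shift_var a (Suc n) - Const b)"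
            by (simp add: head_factor_def)
          have sN: "Suc (num_layers k (r - 1)) = num_layers k r" using r(3) by (simp add: num_layers_def)
          show ?thesis unfolding w'
          proof (rule layer_nondegenerate[OF J stab vinv, where pre = "?hd @ pre'" and b = b and suf = suf'])
            show "v * (\<Prod>b\<leftarrow>(?hd @ pre') @ b # suf'. shift_var a (Suc n) - Const b) \<in> J"
              using last unfolding hd root(1) by (simp add: mult.assoc)
            show "v * vandermonde a (Suc (num_layers k (r - 1))) \<notin> J" using less.prems(6) sN by simp
            show "?w = v * (\<Prod>b\<leftarrow>?hd @ pre'. shift_var a (Suc n) - Const b)"
              unfolding w hd by (simp add: mult.assoc)
          qed (use r in \<open>auto simp: num_layers_def\<close>)
        qed
        ultimately show ?thesis
          using less.hyps[of k "r - 1" "pre' @ suf'" "adjoin (Suc n) J ?w'" ?w s] Suc J' stab' inv s mem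
          by auto
      qed
    qed
    then show ?thesis using S(3) by simp
  qed
qed


section \<open>Dimension of a quotient\<close>

lemma fun_vector_space: "vector_space (\<lambda>(c::complex) (f::nat \<Rightarrow> complex) i. c * f i)"
  by unfold_locales (auto simp: algebra_simps fun_eq_iff)

text \<open>\<open>\<complex>\<^sup>N\<close> as in the definition of \<open>has_dim\<close>, and its standard basis.\<close>

definition coord_space :: "nat \<Rightarrow> (nat \<Rightarrow> complex) set" where
  "coord_space N = {f. \<forall>i\<ge>N. f i = 0}"

lemma sum_fun_apply: "(\<Sum>x\<in>A. f x) i = (\<Sum>x\<in>A. f x i)" for f :: "'a \<Rightarrow> 'b \<Rightarrow> 'c::comm_monoid_add"
  by (induction A rule: infinite_finite_induct) auto

definition unit_fun :: "nat \<Rightarrow> nat \<Rightarrow> complex" where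
  "unit_fun j = (\<lambda>i. if i = j then 1 else 0)"

lemma coord_space_expand: "f \<in> coord_space N \<Longrightarrow> f = (\<lambda>i. \<Sum>j<N. f j * unit_fun j i)"
  by (auto simp: coord_space_def unit_fun_def fun_eq_iff if_distrib not_less cong: if_cong)

lemma span_card_ge:
  fixes g :: "'b \<Rightarrow> nat \<Rightarrow> complex"
  assumes "finite B" and sp: "\<And>f. f \<in> coord_space N \<Longrightarrow> \<exists>c. f = (\<lambda>i. \<Sum>b\<in>B. c b * g b i)"
  shows "N \<le> card B"
proof -
  interpret vs: vector_space "\<lambda>(c::complex) (f::nat \<Rightarrow> complex) i. c * f i" by (rule fun_vector_space)
  have inj: "inj_on unit_fun {..<N}" by (auto simp: inj_on_def unit_fun_def fun_eq_iff split: if_splits)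
  have "vs.independent (unit_fun ` {..<N})"
  proof (rule vs.independent_if_scalars_zero)
    fix f x assume *: "(\<Sum>x\<in>unit_fun ` {..<N}. (\<lambda>i. f x * x i)) = 0" and "x \<in> unit_fun ` {..<N}"
    then obtain j where j: "j < N" "x = unit_fun j" by auto
    have "0 = (\<Sum>l<N. (\<lambda>i. f (unit_fun l) * unit_fun l i)) j"
      using * by (simp add: sum.reindex[OF inj])
    also have "\<dots> = f x" unfolding sum_fun_apply using j by (simp add: unit_fun_def if_distrib cong: if_cong)
    finally show "f x = 0" by simp
  qed simp
  moreover have "unit_fun ` {..<N} \<subseteq> vs.span (g ` B)"
  proof
    fix x assume "x \<in> unit_fun ` {..<N}"
    then have "x \<in> coord_space N" by (auto simp: coord_space_def unit_fun_def)
    from sp[OF this] obtain c where "x = (\<Sum>b\<in>B. (\<lambda>i. c b * g b i))"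
      by (auto simp: fun_eq_iff sum_fun_apply)
    also have "\<dots> \<in> vs.span (g ` B)" by (intro vs.span_sum vs.span_scale vs.span_base) auto
    finally show "x \<in> vs.span (g ` B)" .
  qed
  ultimately have "card (unit_fun ` {..<N}) \<le> card (g ` B)"
    using vs.independent_span_bound[of "g ` B"] assms(1) by auto
  also have "\<dots> \<le> card B" using assms(1) by (rule card_image_le)
  finally show ?thesis by (simp add: card_image[OF inj])
qed

lemma indep_card_le:
  fixes g :: "'b \<Rightarrow> nat \<Rightarrow> complex"
  assumes fin: "finite B" and g: "\<And>b. b \<in> B \<Longrightarrow> g b \<in> coord_space N"
    and ind: "\<And>c b. (\<lambda>i. \<Sum>b\<in>B. c b * g b i) = (\<lambda>i. 0) \<Longrightarrow> b \<in> B \<Longrightarrow> c b = 0"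
  shows "card B \<le> N"
    and "N \<le> card B \<Longrightarrow> f \<in> coord_space N \<Longrightarrow> \<exists>c. f = (\<lambda>i. \<Sum>b\<in>B. c b * g b i)"
proof -
  interpret vs: vector_space "\<lambda>(c::complex) (f::nat \<Rightarrow> complex) i. c * f i" by (rule fun_vector_space)
  have inj: "inj_on g B"
  proof (rule inj_onI, rule ccontr)
    fix x y assume xy: "x \<in> B" "y \<in> B" "g x = g y" "x \<noteq> y"
    let ?c = "\<lambda>b. if b = x then 1 else if b = y then -1 else (0::complex)"
    have "(\<Sum>b\<in>B. ?c b * g b i) = (\<Sum>b\<in>{x, y}. ?c b * g b i)" for i
      using fin xy by (intro sum.mono_neutral_right) auto
    then have "(\<lambda>i. \<Sum>b\<in>B. ?c b * g b i) = (\<lambda>i. 0)" using xy by auto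
    from ind[OF this xy(1)] show False by simp
  qed
  have indep: "vs.independent (g ` B)"
  proof (rule vs.independent_if_scalars_zero)
    fix f x assume *: "(\<Sum>x\<in>g ` B. (\<lambda>i. f x * x i)) = 0" and "x \<in> g ` B"
    then obtain b where b: "b \<in> B" "x = g b" by auto
    have "(\<lambda>i. \<Sum>b\<in>B. f (g b) * g b i) = (\<lambda>i. 0)"
      using * by (simp add: sum.reindex[OF inj] fun_eq_iff sum_fun_apply)
    from ind[OF this b(1)] b(2) show "f x = 0" by simp
  qed (use fin in simp)
  have E: "coord_space N \<subseteq> vs.span (unit_fun ` {..<N})"
  proof
    fix f assume "f \<in> coord_space N"
    then have "f = (\<lambda>i. \<Sum>j<N. f j * unit_fun j i)" by (rule coord_space_expand)
    also have "\<dots> = (\<Sum>j<N. (\<lambda>i. f j * unit_fun j i))" by (simp add: fun_eq_iff sum_fun_apply)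
    also have "\<dots> \<in> vs.span (unit_fun ` {..<N})" by (intro vs.span_sum vs.span_scale vs.span_base) auto
    finally show "f \<in> vs.span (unit_fun ` {..<N})" .
  qed
  have bound: "card S \<le> N" if "vs.independent S" "S \<subseteq> coord_space N" for S
    using vs.independent_span_bound[of "unit_fun ` {..<N}" S] that E card_image_le[of "{..<N}" unit_fun]
    by (auto intro: order.trans)
  have "g ` B \<subseteq> coord_space N" using g by auto
  from bound[OF indep this] show "card B \<le> N" by (simp add: card_image[OF inj])
  show "\<exists>c. f = (\<lambda>i. \<Sum>b\<in>B. c b * g b i)" if N: "N \<le> card B" and f: "f \<in> coord_space N"
  proof -
    have "f \<in> vs.span (g ` B)"
    proof (rule ccontr)
      assume nin: "f \<notin> vs.span (g ` B)"
      then have "vs.independent (insert f (g ` B))" using indep by (simp add: vs.independent_insertI)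
      from bound[OF this] f g have "card (insert f (g ` B)) \<le> N" by auto
      moreover have "f \<notin> g ` B" using nin vs.span_base by blast
      ultimately have "Suc (card B) \<le> N" using fin by (simp add: card_image[OF inj])
      then show False using N by simp
    qed
    then obtain c where "f = (\<Sum>x\<in>g ` B. (\<lambda>i. c x * x i))"
      using vs.span_finite[of "g ` B"] fin by auto
    then have "f = (\<lambda>i. \<Sum>b\<in>B. c (g b) * g b i)"
      by (simp add: sum.reindex[OF inj] fun_eq_iff sum_fun_apply)
    then show ?thesis by (rule exI[of _ "\<lambda>b. c (g b)"])
  qed
qed

text \<open>Uniqueness of the dimension. The predicate \<open>has_dim\<close> does not entail that the space is closed under its operations, so
  this is assumed.\<close>

lemma has_dim_le:
  assumes "has_dim V N" "has_dim V M"
    and cadd: "\<And>x y. x \<in> space V \<Longrightarrow> y \<in> space V \<Longrightarrow> vadd V x y \<in> space V"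
    and csc: "\<And>c x. x \<in> space V \<Longrightarrow> vscale V c x \<in> space V"
  shows "M \<le> N"
proof -
  obtain \<phi> where \<phi>: "bij_betw \<phi> (space V) (coord_space N)"
     "\<And>x y. x\<in>space V \<Longrightarrow> y\<in>space V \<Longrightarrow> \<phi> (vadd V x y) = (\<lambda>i. \<phi> x i + \<phi> y i)"
     "\<And>c x. x\<in>space V \<Longrightarrow> \<phi> (vscale V c x) = (\<lambda>i. c * \<phi> x i)"
    using assms(1) unfolding has_dim_def coord_space_def by blast
  obtain \<psi> where \<psi>: "bij_betw \<psi> (space V) (coord_space M)"
     "\<And>x y. x\<in>space V \<Longrightarrow> y\<in>space V \<Longrightarrow> \<psi> (vadd V x y) = (\<lambda>i. \<psi> x i + \<psi> y i)"
     "\<And>c x. x\<in>space V \<Longrightarrow> \<psi> (vscale V c x) = (\<lambda>i. c * \<psi> x i)"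
    using assms(2) unfolding has_dim_def coord_space_def by blast
  define g where "g = inv_into (space V) \<psi>"
  have g: "g f \<in> space V" "\<psi> (g f) = f" if "f \<in> coord_space M" for f
    using that bij_betw_imp_surj_on[OF \<psi>(1)] by (auto simp: g_def f_inv_into_f inv_into_into)
  have ginv: "g (\<psi> x) = x" if "x \<in> space V" for x
    using that bij_betw_imp_inj_on[OF \<psi>(1)] by (simp add: g_def)
  define \<theta> where "\<theta> f = \<phi> (g f)" for f
  have \<theta>in: "\<theta> f \<in> coord_space N" if "f \<in> coord_space M" for f
    using g(1)[OF that] bij_betw_imp_surj_on[OF \<phi>(1)] by (auto simp: \<theta>_def)
  have \<theta>inj: "f = f'" if "f \<in> coord_space M" "f' \<in> coord_space M" "\<theta> f = \<theta> f'" for f f'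
    using g[OF that(1)] g[OF that(2)] that(3) bij_betw_imp_inj_on[OF \<phi>(1)] by (metis \<theta>_def inj_onD)
  have lin: "\<theta> (\<lambda>i. f i + c * f' i) = (\<lambda>i. \<theta> f i + c * \<theta> f' i)"
    if f: "f \<in> coord_space M" "f' \<in> coord_space M" for f f' c
  proof -
    let ?h = "vadd V (g f) (vscale V c (g f'))"
    have h: "?h \<in> space V" using g f cadd csc by blast
    have "\<psi> ?h = (\<lambda>i. f i + c * f' i)" using g f csc \<psi>(2,3) by simp
    then have "g (\<lambda>i. f i + c * f' i) = ?h" using ginv[OF h] by simp
    then show ?thesis using g f csc \<phi>(2,3) by (simp add: \<theta>_def)
  qed
  have zero: "(\<lambda>i. 0) \<in> coord_space M" by (simp add: coord_space_def)
  have \<theta>0: "\<theta> (\<lambda>i. 0) = (\<lambda>i. 0)"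
    using lin[OF zero zero, of 1] by (simp add: fun_eq_iff)
  have unit: "unit_fun j \<in> coord_space M" if "j < M" for j using that by (auto simp: coord_space_def unit_fun_def)
  have comb: "(\<lambda>i. \<Sum>j\<in>A. c j * unit_fun j i) \<in> coord_space M \<and>
      \<theta> (\<lambda>i. \<Sum>j\<in>A. c j * unit_fun j i) = (\<lambda>i. \<Sum>j\<in>A. c j * \<theta> (unit_fun j) i)"
    if "finite A" "A \<subseteq> {..<M}" for A c
    using that
  proof (induction A rule: finite_induct)
    case empty
    then show ?case using zero \<theta>0 by simp
  next
    case (insert x A)
    let ?F = "\<lambda>i. \<Sum>j\<in>A. c j * unit_fun j i"
    have eq: "(\<lambda>i. \<Sum>j\<in>insert x A. c j * unit_fun j i) = (\<lambda>i. ?F i + c x * unit_fun x i)"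
      using insert by (simp add: add.commute)
    have "\<theta> (\<lambda>i. ?F i + c x * unit_fun x i) = (\<lambda>i. \<theta> ?F i + c x * \<theta> (unit_fun x) i)"
      using insert by (intro lin unit) auto
    moreover have "(\<lambda>i. ?F i + c x * unit_fun x i) \<in> coord_space M"
      using insert unit[of x] by (auto simp: coord_space_def)
    ultimately show ?case unfolding eq using insert by (simp add: add.commute)
  qed
  have "card {..<M} \<le> N"
  proof (rule indep_card_le(1)[of "{..<M}" "\<lambda>j. \<theta> (unit_fun j)"])
    fix c j assume *: "(\<lambda>i. \<Sum>j<M. c j * \<theta> (unit_fun j) i) = (\<lambda>i. 0)" and j: "j \<in> {..<M}"
    have "(\<lambda>i. \<Sum>j<M. c j * unit_fun j i) = (\<lambda>i. 0)"
    proof (rule \<theta>inj[OF _ zero])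
      show "(\<lambda>i. \<Sum>j<M. c j * unit_fun j i) \<in> coord_space M" using comb[of "{..<M}" c] by blast
      show "\<theta> (\<lambda>i. \<Sum>j<M. c j * unit_fun j i) = \<theta> (\<lambda>i. 0)"
        using comb[of "{..<M}" c] * \<theta>0 by simp
    qed
    from fun_cong[OF this, of j] j show "c j = 0" by (simp add: unit_fun_def if_distrib cong: if_cong)
  qed (use \<theta>in unit in auto)
  then show ?thesis by simp
qed

section \<open>Ideals and quotients of the polynomial ring\<close>

lemma carrier_poly_ring: "carrier (poly_ring n) = polys n"
  by (simp add: poly_ring_def polys_def)

lemma poly_ring_simps:
  "p \<otimes>\<^bsub>poly_ring n\<^esub> q = p * q" "p \<oplus>\<^bsub>poly_ring n\<^esub> q = p + q" "\<zero>\<^bsub>poly_ring n\<^esub> = 0" "\<one>\<^bsub>poly_ring n\<^esub> = 1"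
  by (simp_all add: poly_ring_def)

lemma poly_ring_ring: "ring (poly_ring n)"
proof (rule ringI)
  show "abelian_group (poly_ring n)"
  proof (rule abelian_groupI)
    fix x assume "x \<in> carrier (poly_ring n)"
    then show "\<exists>y\<in>carrier (poly_ring n). y \<oplus>\<^bsub>poly_ring n\<^esub> x = \<zero>\<^bsub>poly_ring n\<^esub>"
      unfolding carrier_poly_ring by (intro bexI[of _ "- x"]) (auto simp: poly_ring_def polys_uminus)
  qed (auto simp: carrier_poly_ring poly_ring_simps polys_add algebra_simps)
  show "monoid (poly_ring n)"
    by (rule monoidI) (auto simp: carrier_poly_ring poly_ring_simps polys_mult mult.assoc)
qed (auto simp: poly_ring_simps algebra_simps)

lemma poly_ring_a_inv: "p \<in> polys n \<Longrightarrow> \<ominus>\<^bsub>poly_ring n\<^esub> p = - p"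
  using abelian_group.minus_equality[OF ring.is_abelian_group[OF poly_ring_ring], where x = p and y = "- p"]
  by (simp add: carrier_poly_ring poly_ring_simps polys_uminus)

lemma ideal_poly_ring_iff: "ideal I (poly_ring n) \<longleftrightarrow> I \<subseteq> polys n \<and> submod n I"
proof
  assume "ideal I (poly_ring n)"
  then interpret ideal I "poly_ring n" .
  show "I \<subseteq> polys n \<and> submod n I"
    using a_subset additive_subgroup.zero_closed[OF additive_subgroup_axioms]
      additive_subgroup.a_closed[OF additive_subgroup_axioms] I_l_closed
    by (auto simp: submod_def carrier_poly_ring poly_ring_simps)
next
  assume I: "I \<subseteq> polys n \<and> submod n I"
  show "ideal I (poly_ring n)"
  proof (rule idealI[OF poly_ring_ring])
    show "subgroup I (add_monoid (poly_ring n))"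
    proof (rule group.subgroupI)
      show "Group.group (add_monoid (poly_ring n))"
        by (rule abelian_group.a_group[OF ring.is_abelian_group[OF poly_ring_ring]])
      fix a assume "a \<in> I"
      then show "inv\<^bsub>add_monoid (poly_ring n)\<^esub> a \<in> I"
        using I poly_ring_a_inv[of a n] submod_uminus[of n I a] by (auto simp: a_inv_def)
    qed (use I submod_0[of n I] submod_add[of n I] in \<open>auto simp: carrier_poly_ring poly_ring_simps\<close>)
  qed (use I submod_mult[of n I] submod_mult2[of n I] in \<open>auto simp: carrier_poly_ring poly_ring_simps\<close>)
qed

text \<open>The residue classes modulo \<open>I\<close>.\<close>

definition cset :: "mpoly set \<Rightarrow> mpoly \<Rightarrow> mpoly set" where
  "cset I p = {j + p | j. j \<in> I}"

lemma cset_rcos: "I +>\<^bsub>poly_ring n\<^esub> p = cset I p"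
  by (auto simp: a_r_coset_def' cset_def poly_ring_simps)

lemma cset_eq_iff:
  assumes "submod n I"
  shows "cset I p = cset I q \<longleftrightarrow> p - q \<in> I"
proof
  assume "cset I p = cset I q"
  moreover have "p \<in> cset I p" using submod_0[OF assms] by (force simp: cset_def)
  ultimately obtain j where "p = j + q" "j \<in> I" by (auto simp: cset_def)
  then show "p - q \<in> I" by simp
next
  assume d: "p - q \<in> I"
  have "\<exists>j'. j + p = j' + q \<and> j' \<in> I" if "j \<in> I" for j
    using submod_add[OF assms that d] by (intro exI[of _ "j + (p - q)"]) simp
  moreover have "\<exists>j'. j + q = j' + p \<and> j' \<in> I" if "j \<in> I" for j
    using submod_diff[OF assms that d] by (intro exI[of _ "j - (p - q)"]) simp
  ultimately show "cset I p = cset I q" unfolding cset_def by blast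
qed

lemma quot_rep_simps:
  assumes I: "I \<subseteq> polys n" "submod n I"
  shows "space (quot_rep n I) = cset I ` polys n"
    and "p \<in> polys n \<Longrightarrow> q \<in> polys n \<Longrightarrow> vadd (quot_rep n I) (cset I p) (cset I q) = cset I (p + q)"
    and "p \<in> polys n \<Longrightarrow> vscale (quot_rep n I) c (cset I p) = cset I (Const c * p)"
    and "vact (quot_rep n I) \<sigma> A = perm_poly \<sigma> ` A"
proof -
  have id: "ideal I (poly_ring n)" using I ideal_poly_ring_iff by blast
  interpret ideal I "poly_ring n" by (rule id)
  show "space (quot_rep n I) = cset I ` polys n"
    by (auto simp: quot_rep_def FactRing_def A_RCOSETS_def' carrier_poly_ring cset_rcos)
  show "vadd (quot_rep n I) (cset I p) (cset I q) = cset I (p + q)" if "p \<in> polys n" "q \<in> polys n"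
    using a_rcos_sum[of p q] that
    by (simp add: quot_rep_def FactRing_def carrier_poly_ring cset_rcos poly_ring_simps)
  show "vscale (quot_rep n I) c (cset I p) = cset I (Const c * p)" if "p \<in> polys n"
    using rcoset_mult_add[of "Const c" p] that
    by (simp add: quot_rep_def FactRing_def carrier_poly_ring cset_rcos poly_ring_simps Const_def[symmetric])
  show "vact (quot_rep n I) \<sigma> A = perm_poly \<sigma> ` A" by (simp add: quot_rep_def Let_def)
qed

lemma perm_poly_cset:
  assumes "\<sigma> permutes {1..n}" "perm_poly \<sigma> ` I = I"
  shows "perm_poly \<sigma> ` cset I p = cset I (perm_poly \<sigma> p)"
proof -
  have "perm_poly \<sigma> ` cset I p = {perm_poly \<sigma> j + perm_poly \<sigma> p | j. j \<in> I}"
    unfolding cset_def setcompr_eq_image image_image using permutes_bij[OF assms(1)] by (simp add: perm_poly_add)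
  also have "\<dots> = {j + perm_poly \<sigma> p | j. j \<in> perm_poly \<sigma> ` I}" by blast
  finally show ?thesis unfolding assms(2) cset_def .
qed

text \<open>An ideal of colength \<open>N\<close> is the kernel of a linear map onto \<open>\<complex>\<^sup>N\<close>.\<close>

lemma has_dim_quotE:
  assumes I: "I \<subseteq> polys n" "submod n I" and dim: "has_dim (quot_rep n I) N"
  obtains \<Psi> where
    "\<And>p q. p \<in> polys n \<Longrightarrow> q \<in> polys n \<Longrightarrow> \<Psi> (p + q) = (\<lambda>i. \<Psi> p i + \<Psi> q i)"
    "\<And>c p. p \<in> polys n \<Longrightarrow> \<Psi> (Const c * p) = (\<lambda>i. c * \<Psi> p i)"
    "\<And>p. p \<in> polys n \<Longrightarrow> \<Psi> p = (\<lambda>i. 0) \<longleftrightarrow> p \<in> I" "\<Psi> ` polys n = coord_space N"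
proof -
  from dim obtain \<phi> where \<phi>: "bij_betw \<phi> (cset I ` polys n) (coord_space N)"
     "\<forall>x\<in>cset I ` polys n. \<forall>y\<in>cset I ` polys n. \<phi> (vadd (quot_rep n I) x y) = (\<lambda>i. \<phi> x i + \<phi> y i)"
     "\<forall>c. \<forall>x\<in>cset I ` polys n. \<phi> (vscale (quot_rep n I) c x) = (\<lambda>i. c * \<phi> x i)"
    unfolding has_dim_def coord_space_def quot_rep_simps(1)[OF I] by (elim exE conjE)
  note bij = \<phi>(1) and add = \<phi>(2)[rule_format] and sc = \<phi>(3)[rule_format]
  define \<Psi> where "\<Psi> p = \<phi> (cset I p)" for p
  have 1: "\<Psi> (p + q) = (\<lambda>i. \<Psi> p i + \<Psi> q i)" if "p \<in> polys n" "q \<in> polys n" for p q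
    using add[of "cset I p" "cset I q"] quot_rep_simps(2)[OF I that] that by (simp add: \<Psi>_def)
  have 2: "\<Psi> (Const c * p) = (\<lambda>i. c * \<Psi> p i)" if "p \<in> polys n" for c p
    using sc[of "cset I p" c] quot_rep_simps(3)[OF I that] that by (simp add: \<Psi>_def)
  have 0: "\<Psi> 0 = (\<lambda>i. 0)" using 2[of 0 0] by simp
  have 3: "\<Psi> p = (\<lambda>i. 0) \<longleftrightarrow> p \<in> I" if "p \<in> polys n" for p
  proof -
    have "\<Psi> p = \<Psi> 0 \<longleftrightarrow> cset I p = cset I 0"
      unfolding \<Psi>_def using bij_betw_imp_inj_on[OF bij] that by (intro inj_on_eq_iff) auto
    then show ?thesis using cset_eq_iff[OF I(2), of p 0] 0 by simp
  qed
  have 4: "\<Psi> ` polys n = coord_space N"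
    using bij_betw_imp_surj_on[OF bij] by (simp add: \<Psi>_def image_image)
  show ?thesis by (rule that[OF 1 2 3 4])
qed

lemma
  fixes N :: nat and I :: "mpoly set"
  assumes I: "I \<subseteq> polys n" "submod n I" and dim: "has_dim (quot_rep n I) N"
    and B: "finite B" "B \<subseteq> monoms n"
  shows quot_span_card: "(\<And>p. p \<in> polys n \<Longrightarrow> \<exists>s. Poly_Mapping.keys s \<subseteq> B \<and> p - s \<in> I) \<Longrightarrow> N \<le> card B"
    and quot_indep_card: "(\<And>s. Poly_Mapping.keys s \<subseteq> B \<Longrightarrow> s \<in> I \<Longrightarrow> s = 0) \<Longrightarrow> card B \<le> N"
    and quot_indep_span: "(\<And>s. Poly_Mapping.keys s \<subseteq> B \<Longrightarrow> s \<in> I \<Longrightarrow> s = 0) \<Longrightarrow> N \<le> card B \<Longrightarrow>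
      p \<in> polys n \<Longrightarrow> \<exists>s. Poly_Mapping.keys s \<subseteq> B \<and> p - s \<in> I"
proof -
  obtain \<Psi> where add: "\<And>p q. p \<in> polys n \<Longrightarrow> q \<in> polys n \<Longrightarrow> \<Psi> (p + q) = (\<lambda>i. \<Psi> p i + \<Psi> q i)"
    and sc: "\<And>c p. p \<in> polys n \<Longrightarrow> \<Psi> (Const c * p) = (\<lambda>i. c * \<Psi> p i)"
    and ker: "\<And>p. p \<in> polys n \<Longrightarrow> \<Psi> p = (\<lambda>i. 0) \<longleftrightarrow> p \<in> I" and surj: "\<Psi> ` polys n = coord_space N"
    using has_dim_quotE[OF I dim] by blast
  define g where "g b = \<Psi> (Poly_Mapping.single b 1)" for b
  have mon: "Poly_Mapping.single b c \<in> polys n" if "b \<in> B" for b and c :: complex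
    using that B by (auto simp: polys_def)
  define comb where "comb c = (\<Sum>b\<in>B. Poly_Mapping.single b (c b))" for c :: "monom \<Rightarrow> complex"
  have keys: "Poly_Mapping.keys (comb c) \<subseteq> B" for c
    unfolding comb_def using keys_sum[of "\<lambda>b. Poly_Mapping.single b (c b)" B] by (fastforce split: if_splits)
  have lookup: "Poly_Mapping.lookup (comb c) b = c b" if "b \<in> B" for c b
    using that B(1) by (simp add: comb_def lookup_sum lookup_single when_def)
  have combP: "comb c \<in> polys n" for c using keys[of c] B(2) by (auto simp: polys_def)
  have of_keys: "s = comb (Poly_Mapping.lookup s)" if "Poly_Mapping.keys s \<subseteq> B" for s
  proof (rule poly_mapping_eqI)
    fix m show "Poly_Mapping.lookup s m = Poly_Mapping.lookup (comb (Poly_Mapping.lookup s)) m"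
    proof (cases "m \<in> B")
      case False
      then have "m \<notin> Poly_Mapping.keys s" "m \<notin> Poly_Mapping.keys (comb (Poly_Mapping.lookup s))"
        using that keys by blast+
      then show ?thesis by (simp add: in_keys_iff)
    qed (simp add: lookup)
  qed
  have zero: "\<Psi> 0 = (\<lambda>i. 0)" using sc[of 0 0] by simp
  have \<Psi>comb: "\<Psi> (comb c) = (\<lambda>i. \<Sum>b\<in>B. c b * g b i)" for c
  proof -
    have "\<Psi> (\<Sum>b\<in>A. Poly_Mapping.single b (c b)) = (\<lambda>i. \<Sum>b\<in>A. c b * g b i)" if "finite A" "A \<subseteq> B" for A
      using that
    proof (induction A rule: finite_induct)
      case (insert x A)
      have "Poly_Mapping.single x (c x) = Const (c x) * Poly_Mapping.single x 1"
        by (simp add: Const_def mult_single)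
      then have "\<Psi> (Poly_Mapping.single x (c x)) = (\<lambda>i. c x * g x i)"
        using sc[OF mon[of x 1]] insert by (simp add: g_def)
      moreover have "(\<Sum>b\<in>A. Poly_Mapping.single b (c b)) \<in> polys n"
        using insert by (intro polys_sum mon) auto
      ultimately show ?case using insert mon[of x "c x"] by (simp add: add)
    qed (simp add: zero)
    from this[of B] show ?thesis using B by (simp add: comb_def)
  qed
  have diff: "\<Psi> (p - q) = (\<lambda>i. 0) \<longleftrightarrow> \<Psi> p = \<Psi> q" if "p \<in> polys n" "q \<in> polys n" for p q
  proof -
    have "\<Psi> (p + Const (-1) * q) = (\<lambda>i. \<Psi> p i + (-1) * \<Psi> q i)"
      using that by (subst add) (simp_all add: polys_mult sc)
    then show ?thesis by (simp add: Const_minus fun_eq_iff)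
  qed
  show "N \<le> card B" if sp: "\<And>p. p \<in> polys n \<Longrightarrow> \<exists>s. Poly_Mapping.keys s \<subseteq> B \<and> p - s \<in> I"
  proof (rule span_card_ge[OF B(1)])
    fix f assume "f \<in> coord_space N"
    then obtain p where p: "p \<in> polys n" "f = \<Psi> p" using surj by blast
    then obtain s where s: "Poly_Mapping.keys s \<subseteq> B" "p - s \<in> I" using sp by blast
    have "s \<in> polys n" using s(1) B(2) by (auto simp: polys_def)
    then have "\<Psi> p = \<Psi> s" using p s ker[of "p - s"] diff[of p s] I by (simp add: polys_diff)
    also have "\<dots> = \<Psi> (comb (Poly_Mapping.lookup s))" using of_keys[OF s(1)] by simp
    finally show "\<exists>c. f = (\<lambda>i. \<Sum>b\<in>B. c b * g b i)" using p \<Psi>comb by metis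
  qed
  have gN: "g b \<in> coord_space N" if "b \<in> B" for b using surj mon[OF that] by (auto simp: g_def)
  have ind: "c b = 0" if h: "\<And>s. Poly_Mapping.keys s \<subseteq> B \<Longrightarrow> s \<in> I \<Longrightarrow> s = 0"
    and "(\<lambda>i. \<Sum>b\<in>B. c b * g b i) = (\<lambda>i. 0)" "b \<in> B" for c b
  proof -
    have "comb c \<in> I" using that ker[OF combP, of c] \<Psi>comb[of c] by simp
    from h[OF keys this] lookup[OF that(3), of c] show "c b = 0" by simp
  qed
  show "card B \<le> N" if h: "\<And>s. Poly_Mapping.keys s \<subseteq> B \<Longrightarrow> s \<in> I \<Longrightarrow> s = 0"
    by (rule indep_card_le(1)[of B g N, OF B(1) gN]) (use ind[OF h] in auto)
  show "\<exists>s. Poly_Mapping.keys s \<subseteq> B \<and> p - s \<in> I"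
    if h: "\<And>s. Poly_Mapping.keys s \<subseteq> B \<Longrightarrow> s \<in> I \<Longrightarrow> s = 0" and N: "N \<le> card B" and p: "p \<in> polys n"
  proof -
    have "\<Psi> p \<in> coord_space N" using surj p by blast
    then have "\<exists>c. \<Psi> p = (\<lambda>i. \<Sum>b\<in>B. c b * g b i)"
      by (rule indep_card_le(2)[of B g N, OF B(1) gN _ N, rotated 2]) (use ind[OF h] in auto)
    then obtain c where "\<Psi> p = \<Psi> (comb c)" using \<Psi>comb by metis
    then have "p - comb c \<in> I" using diff[OF p combP] ker[of "p - comb c"] p combP by (simp add: polys_diff)
    then show ?thesis using keys by blast
  qed
qed


section \<open>The permutation module of a hook\<close>

declare One_nat_def [simp del] \<comment> \<open>intervals \<open>{1..n}\<close> keep their form\<close>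

text \<open>The left cosets of the Young subgroup of a hook, which fixes the points above \<open>k\<close>: a coset
  is determined by the values above \<open>k\<close>.\<close>

definition hook_coset :: "nat \<Rightarrow> nat \<Rightarrow> (nat \<Rightarrow> nat) \<Rightarrow> (nat \<Rightarrow> nat) set" where
  "hook_coset k n \<tau> = {\<sigma>. \<sigma> permutes {1..n} \<and> (\<forall>i\<in>{k<..n}. \<sigma> i = \<tau> i)}"

lemma young_subgroup_hook:
  assumes n: "n = k + r"
  shows "young_subgroup n (k # replicate r 1) = hook_coset k n id"
proof -
  have st: "sum_list (take (Suc j) (k # replicate r 1)) = k + j" if "j \<le> r" for j
    using that by (simp add: take_replicate min_def sum_list_replicate)
  have b0: "young_block (k # replicate r 1) 0 = {1..k}" by (auto simp: young_block_def)
  have b: "young_block (k # replicate r 1) (Suc j) = {Suc (k + j)}" if "j < r" for j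
    unfolding young_block_def using st[of j] st[of "Suc j"] that by (auto simp del: take_Suc_Cons)
  show ?thesis
  proof (intro equalityI subsetI)
    fix \<sigma> assume \<sigma>: "\<sigma> \<in> young_subgroup n (k # replicate r 1)"
    have "\<sigma> i = i" if "i \<in> {k<..n}" for i
    proof -
      define j where "j = i - Suc k"
      have j: "j < r" "i = Suc (k + j)" using that n by (auto simp: j_def)
      have "\<sigma> ` young_block (k # replicate r 1) (Suc j) = young_block (k # replicate r 1) (Suc j)"
        using \<sigma> j(1) by (auto simp: young_subgroup_def)
      then show ?thesis using b[OF j(1)] j(2) by simp
    qed
    then show "\<sigma> \<in> hook_coset k n id"
      using \<sigma> by (auto simp: young_subgroup_def hook_coset_def sym_group_carrier)
  next
    fix \<sigma> assume \<sigma>: "\<sigma> \<in> hook_coset k n id"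
    then have p: "\<sigma> permutes {1..n}" and fx: "\<And>i. i \<in> {k<..n} \<Longrightarrow> \<sigma> i = i" by (auto simp: hook_coset_def)
    have "\<sigma> ` {1..k} = \<sigma> ` ({1..n} - {k<..n})" using n by (intro arg_cong[of _ _ "image \<sigma>"]) auto
    also have "\<dots> = \<sigma> ` {1..n} - \<sigma> ` {k<..n}" using permutes_inj[OF p] by (rule image_set_diff)
    also have "\<sigma> ` {k<..n} = {k<..n}" using fx by force
    also have "\<sigma> ` {1..n} - {k<..n} = {1..k}" using permutes_image[OF p] n by auto
    finally have "\<sigma> ` {1..k} = {1..k}" .
    then have "\<sigma> ` young_block (k # replicate r 1) j = young_block (k # replicate r 1) j"
      if "j < length (k # replicate r 1)" for j
      using that b b0 fx n by (cases j) auto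
    then show "\<sigma> \<in> young_subgroup n (k # replicate r 1)"
      using p by (simp add: young_subgroup_def sym_group_carrier)
  qed
qed

lemma hook_coset_translate:
  assumes "\<sigma> permutes {1..n}"
  shows "\<sigma> <#\<^bsub>sym_group n\<^esub> hook_coset k n \<tau> = hook_coset k n (\<sigma> \<circ> \<tau>)"
proof (intro equalityI subsetI)
  fix \<rho> assume "\<rho> \<in> \<sigma> <#\<^bsub>sym_group n\<^esub> hook_coset k n \<tau>"
  then show "\<rho> \<in> hook_coset k n (\<sigma> \<circ> \<tau>)"
    using assms by (auto simp: l_coset_def sym_group_mult hook_coset_def permutes_compose)
next
  fix \<rho> assume "\<rho> \<in> hook_coset k n (\<sigma> \<circ> \<tau>)"
  then have \<rho>: "\<rho> permutes {1..n}" "\<And>i. i \<in> {k<..n} \<Longrightarrow> \<rho> i = \<sigma> (\<tau> i)" by (auto simp: hook_coset_def)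
  have "inv' \<sigma> \<circ> \<rho> permutes {1..n}" using \<rho>(1) permutes_inv[OF assms] by (rule permutes_compose)
  then have "inv' \<sigma> \<circ> \<rho> \<in> hook_coset k n \<tau>"
    using \<rho>(2) permutes_inverses(2)[OF assms] by (auto simp: hook_coset_def)
  moreover have "\<rho> = \<sigma> \<circ> (inv' \<sigma> \<circ> \<rho>)" using permutes_inverses(1)[OF assms] by auto
  ultimately show "\<rho> \<in> \<sigma> <#\<^bsub>sym_group n\<^esub> hook_coset k n \<tau>"
    by (auto simp: l_coset_def sym_group_mult)
qed

lemma hook_coset_eq_iff:
  assumes "\<tau> permutes {1..n}" "\<tau>' permutes {1..n}"
  shows "hook_coset k n \<tau> = hook_coset k n \<tau>' \<longleftrightarrow> (\<forall>i\<in>{k<..n}. \<tau> i = \<tau>' i)"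
  using assms by (auto simp: hook_coset_def)

lemma lcosets_hook:
  assumes n: "n = k + r"
  shows "lcosets\<^bsub>sym_group n\<^esub> (young_subgroup n (k # replicate r 1)) = hook_coset k n ` {\<tau>. \<tau> permutes {1..n}}"
proof -
  have "lcosets\<^bsub>sym_group n\<^esub> (young_subgroup n (k # replicate r 1)) =
      (\<lambda>\<tau>. \<tau> <#\<^bsub>sym_group n\<^esub> hook_coset k n id) ` {\<tau>. \<tau> permutes {1..n}}"
    unfolding young_subgroup_hook[OF n] by (auto simp: LCOSETS_def sym_group_carrier)
  also have "\<dots> = hook_coset k n ` {\<tau>. \<tau> permutes {1..n}}"
    by (intro image_cong) (auto simp: hook_coset_translate)
  finally show ?thesis .
qed

text \<open>\<open>coset_model k n I \<Phi>\<close> presents \<open>I\<close> as the kernel of an equivariant linear map \<open>\<Phi>\<close> onto the permutation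
  module, whose elements are functions of a permutation \<open>\<tau>\<close> that depend only on its coset.\<close>

definition coset_model ::
    "nat \<Rightarrow> nat \<Rightarrow> mpoly set \<Rightarrow> (mpoly \<Rightarrow> (nat \<Rightarrow> nat) \<Rightarrow> complex) \<Rightarrow> bool" where
  "coset_model k n I \<Phi> \<longleftrightarrow>
     (\<forall>p\<in>polys n. \<forall>q\<in>polys n. \<forall>\<tau>. \<tau> permutes {1..n} \<longrightarrow> \<Phi> (p + q) \<tau> = \<Phi> p \<tau> + \<Phi> q \<tau>) \<and>
     (\<forall>c. \<forall>p\<in>polys n. \<forall>\<tau>. \<tau> permutes {1..n} \<longrightarrow> \<Phi> (Const c * p) \<tau> = c * \<Phi> p \<tau>) \<and>
     (\<forall>p\<in>polys n. p \<in> I \<longleftrightarrow> (\<forall>\<tau>. \<tau> permutes {1..n} \<longrightarrow> \<Phi> p \<tau> = 0)) \<and>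
     (\<forall>p\<in>polys n. \<forall>\<sigma> \<tau>. \<sigma> permutes {1..n} \<longrightarrow> \<tau> permutes {1..n} \<longrightarrow>
        \<Phi> (perm_poly \<sigma> p) \<tau> = \<Phi> p (inv' \<sigma> \<circ> \<tau>)) \<and>
     (\<forall>p\<in>polys n. \<forall>\<tau> \<tau>'. \<tau> permutes {1..n} \<longrightarrow> \<tau>' permutes {1..n} \<longrightarrow>
        (\<forall>i\<in>{k<..n}. \<tau> i = \<tau>' i) \<longrightarrow> \<Phi> p \<tau> = \<Phi> p \<tau>') \<and>
     (\<forall>f. (\<forall>\<tau> \<tau>'. \<tau> permutes {1..n} \<longrightarrow> \<tau>' permutes {1..n} \<longrightarrow> (\<forall>i\<in>{k<..n}. \<tau> i = \<tau>' i) \<longrightarrow> f \<tau> = f \<tau>') \<longrightarrow>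
        (\<exists>p\<in>polys n. \<forall>\<tau>. \<tau> permutes {1..n} \<longrightarrow> \<Phi> p \<tau> = f \<tau>))"

lemma
  assumes "coset_model k n I \<Phi>"
  shows model_add: "p \<in> polys n \<Longrightarrow> q \<in> polys n \<Longrightarrow> \<tau> permutes {1..n} \<Longrightarrow> \<Phi> (p + q) \<tau> = \<Phi> p \<tau> + \<Phi> q \<tau>"
    and model_scale: "p \<in> polys n \<Longrightarrow> \<tau> permutes {1..n} \<Longrightarrow> \<Phi> (Const c * p) \<tau> = c * \<Phi> p \<tau>"
    and model_kernel: "p \<in> polys n \<Longrightarrow> p \<in> I \<longleftrightarrow> (\<forall>\<tau>. \<tau> permutes {1..n} \<longrightarrow> \<Phi> p \<tau> = 0)"
    and model_act: "p \<in> polys n \<Longrightarrow> \<sigma> permutes {1..n} \<Longrightarrow> \<tau> permutes {1..n} \<Longrightarrow>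
        \<Phi> (perm_poly \<sigma> p) \<tau> = \<Phi> p (inv' \<sigma> \<circ> \<tau>)"
    and model_coset: "p \<in> polys n \<Longrightarrow> \<tau> permutes {1..n} \<Longrightarrow> \<tau>' permutes {1..n} \<Longrightarrow>
        (\<And>i. i \<in> {k<..n} \<Longrightarrow> \<tau> i = \<tau>' i) \<Longrightarrow> \<Phi> p \<tau> = \<Phi> p \<tau>'"
    and model_surj: "(\<And>\<tau> \<tau>'. \<tau> permutes {1..n} \<Longrightarrow> \<tau>' permutes {1..n} \<Longrightarrow> (\<And>i. i \<in> {k<..n} \<Longrightarrow> \<tau> i = \<tau>' i) \<Longrightarrow> f \<tau> = f \<tau>') \<Longrightarrow>
        \<exists>p\<in>polys n. \<forall>\<tau>. \<tau> permutes {1..n} \<longrightarrow> \<Phi> p \<tau> = f \<tau>"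
proof -
  note * = assms[unfolded coset_model_def]
  show "p \<in> polys n \<Longrightarrow> q \<in> polys n \<Longrightarrow> \<tau> permutes {1..n} \<Longrightarrow> \<Phi> (p + q) \<tau> = \<Phi> p \<tau> + \<Phi> q \<tau>"
    using *[THEN conjunct1] by blast
  show "p \<in> polys n \<Longrightarrow> \<tau> permutes {1..n} \<Longrightarrow> \<Phi> (Const c * p) \<tau> = c * \<Phi> p \<tau>"
    using *[THEN conjunct2, THEN conjunct1] by blast
  show "p \<in> polys n \<Longrightarrow> p \<in> I \<longleftrightarrow> (\<forall>\<tau>. \<tau> permutes {1..n} \<longrightarrow> \<Phi> p \<tau> = 0)"
    using *[THEN conjunct2, THEN conjunct2, THEN conjunct1] by blast
  show "p \<in> polys n \<Longrightarrow> \<sigma> permutes {1..n} \<Longrightarrow> \<tau> permutes {1..n} \<Longrightarrow>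
        \<Phi> (perm_poly \<sigma> p) \<tau> = \<Phi> p (inv' \<sigma> \<circ> \<tau>)"
    using *[THEN conjunct2, THEN conjunct2, THEN conjunct2, THEN conjunct1] by blast
  show "p \<in> polys n \<Longrightarrow> \<tau> permutes {1..n} \<Longrightarrow> \<tau>' permutes {1..n} \<Longrightarrow>
        (\<And>i. i \<in> {k<..n} \<Longrightarrow> \<tau> i = \<tau>' i) \<Longrightarrow> \<Phi> p \<tau> = \<Phi> p \<tau>'"
    using *[THEN conjunct2, THEN conjunct2, THEN conjunct2, THEN conjunct2, THEN conjunct1] by blast
  assume "\<And>\<tau> \<tau>'. \<tau> permutes {1..n} \<Longrightarrow> \<tau>' permutes {1..n} \<Longrightarrow> (\<And>i. i \<in> {k<..n} \<Longrightarrow> \<tau> i = \<tau>' i) \<Longrightarrow> f \<tau> = f \<tau>'"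
  then show "\<exists>p\<in>polys n. \<forall>\<tau>. \<tau> permutes {1..n} \<longrightarrow> \<Phi> p \<tau> = f \<tau>"
    using *[THEN conjunct2, THEN conjunct2, THEN conjunct2, THEN conjunct2, THEN conjunct2, rule_format, of f] by blast
qed

text \<open>The function on cosets induced by a function of permutations, extended by zero to all sets.\<close>

definition coset_fun :: "nat \<Rightarrow> nat \<Rightarrow> ((nat \<Rightarrow> nat) \<Rightarrow> complex) \<Rightarrow> (nat \<Rightarrow> nat) set \<Rightarrow> complex" where
  "coset_fun k n f C =
     (if C \<in> hook_coset k n ` {\<tau>. \<tau> permutes {1..n}} then f (SOME \<tau>. \<tau> \<in> C) else 0)"

lemma coset_fun_apply:
  assumes f: "\<And>\<tau> \<tau>'. \<tau> permutes {1..n} \<Longrightarrow> \<tau>' permutes {1..n} \<Longrightarrow> (\<And>i. i \<in> {k<..n} \<Longrightarrow> \<tau> i = \<tau>' i) \<Longrightarrow> f \<tau> = f \<tau>'"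
    and \<tau>: "\<tau> permutes {1..n}"
  shows "coset_fun k n f (hook_coset k n \<tau>) = f \<tau>"
proof -
  have "\<tau> \<in> hook_coset k n \<tau>" using \<tau> by (simp add: hook_coset_def)
  then have "(SOME \<sigma>. \<sigma> \<in> hook_coset k n \<tau>) \<in> hook_coset k n \<tau>"
    by (rule someI[where P = "\<lambda>\<sigma>. \<sigma> \<in> hook_coset k n \<tau>"])
  then have "f (SOME \<sigma>. \<sigma> \<in> hook_coset k n \<tau>) = f \<tau>"
    using \<tau> by (intro f) (auto simp: hook_coset_def)
  then show ?thesis using \<tau> by (simp add: coset_fun_def)
qed

lemma perm_module_simps:
  assumes n: "n = k + r"
  defines "M \<equiv> perm_module n (k # replicate r 1)"
  shows "space M = {f. \<forall>C. C \<notin> hook_coset k n ` {\<tau>. \<tau> permutes {1..n}} \<longrightarrow> f C = 0}"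
    and "vadd M f g C = f C + g C" and "vscale M c f C = c * f C"
    and "\<sigma> permutes {1..n} \<Longrightarrow> vact M \<sigma> f (hook_coset k n \<tau>) = f (hook_coset k n (inv' \<sigma> \<circ> \<tau>))"
    and "\<sigma> permutes {1..n} \<Longrightarrow> f \<in> space M \<Longrightarrow> vact M \<sigma> f \<in> space M"
proof -
  show sp: "space M = {f. \<forall>C. C \<notin> hook_coset k n ` {\<tau>. \<tau> permutes {1..n}} \<longrightarrow> f C = 0}"
    by (simp add: M_def perm_module_def Let_def lcosets_hook[OF n])
  show "vadd M f g C = f C + g C" "vscale M c f C = c * f C"
    by (simp_all add: M_def perm_module_def Let_def)
  assume \<sigma>: "\<sigma> permutes {1..n}"
  then have inv: "inv\<^bsub>sym_group n\<^esub> \<sigma> = inv' \<sigma>" by (simp add: sym_group_carrier)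
  have act: "vact M \<sigma> f C = f (inv' \<sigma> <#\<^bsub>sym_group n\<^esub> C)" for f C
    by (simp add: M_def perm_module_def Let_def inv)
  show "vact M \<sigma> f (hook_coset k n \<tau>) = f (hook_coset k n (inv' \<sigma> \<circ> \<tau>))"
    by (simp add: act hook_coset_translate[OF permutes_inv[OF \<sigma>]])
  assume f: "f \<in> space M"
  show "vact M \<sigma> f \<in> space M"
    unfolding sp
  proof (intro CollectI allI impI)
    fix C assume C: "C \<notin> hook_coset k n ` {\<tau>. \<tau> permutes {1..n}}"
    have "inv' \<sigma> <#\<^bsub>sym_group n\<^esub> C \<notin> hook_coset k n ` {\<tau>. \<tau> permutes {1..n}}"
    proof
      assume "inv' \<sigma> <#\<^bsub>sym_group n\<^esub> C \<in> hook_coset k n ` {\<tau>. \<tau> permutes {1..n}}"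
      then obtain \<tau> where \<tau>: "\<tau> permutes {1..n}" "inv' \<sigma> <#\<^bsub>sym_group n\<^esub> C = hook_coset k n \<tau>" by blast
      have "(\<lambda>\<rho>. \<sigma> \<circ> \<rho>) ` (\<lambda>\<rho>. inv' \<sigma> \<circ> \<rho>) ` C = C"
        unfolding image_image using permutes_inverses(1)[OF \<sigma>] by (simp add: comp_assoc[symmetric] o_def)
      moreover have "(\<lambda>\<rho>. inv' \<sigma> \<circ> \<rho>) ` C = hook_coset k n \<tau>"
        using \<tau>(2) by (auto simp: l_coset_def sym_group_mult)
      ultimately have "C = \<sigma> <#\<^bsub>sym_group n\<^esub> hook_coset k n \<tau>" by (auto simp: l_coset_def sym_group_mult)
      then show False using C \<tau>(1) \<sigma> by (auto simp: hook_coset_translate permutes_compose)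
    qed
    then show "vact M \<sigma> f C = 0" using f unfolding act sp by blast
  qed
qed

lemma rep_iso_imp_model:
  assumes n: "n = k + r" and I: "I \<subseteq> polys n" "submod n I"
    and stab: "\<And>\<sigma>. \<sigma> permutes {1..n} \<Longrightarrow> perm_poly \<sigma> ` I = I"
    and iso: "rep_iso n (quot_rep n I) (perm_module n (k # replicate r 1))"
  shows "\<exists>\<Phi>. coset_model k n I \<Phi>"
proof -
  let ?M = "perm_module n (k # replicate r 1)"
  note M = perm_module_simps[OF n]
  from iso obtain \<phi> where \<phi>: "bij_betw \<phi> (cset I ` polys n) (space ?M)"
     "\<forall>x\<in>cset I ` polys n. \<forall>y\<in>cset I ` polys n. \<phi> (vadd (quot_rep n I) x y) = vadd ?M (\<phi> x) (\<phi> y)"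
     "\<forall>c. \<forall>x\<in>cset I ` polys n. \<phi> (vscale (quot_rep n I) c x) = vscale ?M c (\<phi> x)"
     "\<forall>\<sigma>\<in>carrier (sym_group n). \<forall>x\<in>cset I ` polys n. \<phi> (vact (quot_rep n I) \<sigma> x) = vact ?M \<sigma> (\<phi> x)"
    unfolding rep_iso_def quot_rep_simps(1)[OF I] by (elim exE conjE)
  note bij = \<phi>(1) and add = \<phi>(2)[rule_format] and sc = \<phi>(3)[rule_format] and act = \<phi>(4)[rule_format]
  define \<Phi> where "\<Phi> p \<tau> = \<phi> (cset I p) (hook_coset k n \<tau>)" for p \<tau>
  have add': "\<phi> (cset I (p + q)) = vadd ?M (\<phi> (cset I p)) (\<phi> (cset I q))" if "p \<in> polys n" "q \<in> polys n" for p q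
    using add[of "cset I p" "cset I q"] quot_rep_simps(2)[OF I that] that by simp
  have sc': "\<phi> (cset I (Const c * p)) = vscale ?M c (\<phi> (cset I p))" if "p \<in> polys n" for p c
    using sc[of "cset I p" c] quot_rep_simps(3)[OF I that] that by simp
  have mem: "\<phi> (cset I p) \<in> space ?M" if "p \<in> polys n" for p
    using bij_betw_imp_surj_on[OF bij] that by blast
  have zero: "\<phi> (cset I 0) C = 0" for C using fun_cong[OF sc'[of 0 0], of C] M(3) by simp
  have ker: "p \<in> I \<longleftrightarrow> (\<forall>\<tau>. \<tau> permutes {1..n} \<longrightarrow> \<Phi> p \<tau> = 0)" if p: "p \<in> polys n" for p
  proof
    assume "p \<in> I"
    then have "cset I p = cset I 0" using cset_eq_iff[OF I(2), of p 0] by simp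
    then show "\<forall>\<tau>. \<tau> permutes {1..n} \<longrightarrow> \<Phi> p \<tau> = 0" using zero by (simp add: \<Phi>_def)
  next
    assume *: "\<forall>\<tau>. \<tau> permutes {1..n} \<longrightarrow> \<Phi> p \<tau> = 0"
    have "\<phi> (cset I p) C = \<phi> (cset I 0) C" for C
    proof (cases "C \<in> hook_coset k n ` {\<tau>. \<tau> permutes {1..n}}")
      case True then show ?thesis using * zero by (auto simp: \<Phi>_def)
    next
      case False then show ?thesis using mem[OF p] zero by (simp add: M(1))
    qed
    then have "\<phi> (cset I p) = \<phi> (cset I 0)" by (rule ext)
    then have "cset I p = cset I 0"
      by (rule inj_onD[OF bij_betw_imp_inj_on[OF bij]]) (use p in auto)
    then show "p \<in> I" using cset_eq_iff[OF I(2), of p 0] by simp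
  qed
  have eqv: "\<Phi> (perm_poly \<sigma> p) \<tau> = \<Phi> p (inv' \<sigma> \<circ> \<tau>)"
    if "p \<in> polys n" "\<sigma> permutes {1..n}" "\<tau> permutes {1..n}" for p \<sigma> \<tau>
  proof -
    have "\<phi> (cset I (perm_poly \<sigma> p)) = vact ?M \<sigma> (\<phi> (cset I p))"
      using act[of \<sigma> "cset I p"] that quot_rep_simps(4)[OF I] perm_poly_cset[OF that(2) stab[OF that(2)]]
      by (simp add: sym_group_carrier)
    then show ?thesis using M(4)[OF that(2)] by (simp add: \<Phi>_def)
  qed
  have surj: "\<exists>p\<in>polys n. \<forall>\<tau>. \<tau> permutes {1..n} \<longrightarrow> \<Phi> p \<tau> = f \<tau>"
    if f: "\<forall>\<tau> \<tau>'. \<tau> permutes {1..n} \<longrightarrow> \<tau>' permutes {1..n} \<longrightarrow> (\<forall>i\<in>{k<..n}. \<tau> i = \<tau>' i) \<longrightarrow> f \<tau> = f \<tau>'" for f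
  proof -
    have "coset_fun k n f \<in> space ?M" by (simp add: M(1) coset_fun_def)
    then have "coset_fun k n f \<in> \<phi> ` cset I ` polys n"
      using bij_betw_imp_surj_on[OF bij] by simp
    then obtain p where p: "p \<in> polys n" "\<phi> (cset I p) = coset_fun k n f" by (elim imageE) simp
    have "\<Phi> p \<tau> = f \<tau>" if "\<tau> permutes {1..n}" for \<tau>
      unfolding \<Phi>_def p(2) by (rule coset_fun_apply[OF f[rule_format] that])
    then show ?thesis using p(1) by blast
  qed
  have "coset_model k n I \<Phi>"
    unfolding coset_model_def
  proof (intro conjI ballI allI impI)
    show "\<Phi> (p + q) \<tau> = \<Phi> p \<tau> + \<Phi> q \<tau>" if "p \<in> polys n" "q \<in> polys n" for p q \<tau>
      using add'[OF that] by (simp add: \<Phi>_def M(2))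
    show "\<Phi> (Const c * p) \<tau> = c * \<Phi> p \<tau>" if "p \<in> polys n" for c p \<tau>
      using sc'[OF that] by (simp add: \<Phi>_def M(3))
    show "\<Phi> p \<tau> = \<Phi> p \<tau>'" if "\<tau> permutes {1..n}" "\<tau>' permutes {1..n}" "\<forall>i\<in>{k<..n}. \<tau> i = \<tau>' i" for p \<tau> \<tau>'
      using hook_coset_eq_iff[OF that(1,2), of k] that(3) by (simp add: \<Phi>_def)
    show "\<exists>p\<in>polys n. \<forall>\<tau>. \<tau> permutes {1..n} \<longrightarrow> \<Phi> p \<tau> = f \<tau>"
      if "\<forall>\<tau> \<tau>'. \<tau> permutes {1..n} \<longrightarrow> \<tau>' permutes {1..n} \<longrightarrow> (\<forall>i\<in>{k<..n}. \<tau> i = \<tau>' i) \<longrightarrow> f \<tau> = f \<tau>'" for f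
      using that by (rule surj)
  qed (simp_all only: ker eqv)
  then show ?thesis by blast
qed

lemma model_imp_rep_iso:
  assumes n: "n = k + r" and I: "I \<subseteq> polys n" "submod n I"
    and stab: "\<And>\<sigma>. \<sigma> permutes {1..n} \<Longrightarrow> perm_poly \<sigma> ` I = I"
    and model: "coset_model k n I \<Phi>"
  shows "rep_iso n (quot_rep n I) (perm_module n (k # replicate r 1))"
proof -
  let ?M = "perm_module n (k # replicate r 1)"
  note M = perm_module_simps[OF n]
  have inv: "\<Phi> p \<tau> = \<Phi> p \<tau>'" if "p \<in> polys n" "\<tau> permutes {1..n}" "\<tau>' permutes {1..n}" "\<And>i. i \<in> {k<..n} \<Longrightarrow> \<tau> i = \<tau>' i"
    for p \<tau> \<tau>' using model_coset[OF model that] .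
  define F where "F p = coset_fun k n (\<Phi> p)" for p
  have F: "F p (hook_coset k n \<tau>) = \<Phi> p \<tau>" if "p \<in> polys n" "\<tau> permutes {1..n}" for p \<tau>
    unfolding F_def using that by (intro coset_fun_apply inv) auto
  have F0: "F p C = 0" if "C \<notin> hook_coset k n ` {\<tau>. \<tau> permutes {1..n}}" for p C
    using that by (auto simp: F_def coset_fun_def)
  have Feq: "F p = g" if "p \<in> polys n" "\<And>C. C \<notin> hook_coset k n ` {\<tau>. \<tau> permutes {1..n}} \<Longrightarrow> g C = 0"
    "\<And>\<tau>. \<tau> permutes {1..n} \<Longrightarrow> g (hook_coset k n \<tau>) = \<Phi> p \<tau>" for p g
  proof
    fix C show "F p C = g C"
      by (cases "C \<in> hook_coset k n ` {\<tau>. \<tau> permutes {1..n}}") (auto simp: F F0 that)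
  qed
  have Fdiff: "\<Phi> (p - q) \<tau> = \<Phi> p \<tau> - \<Phi> q \<tau>" if "p \<in> polys n" "q \<in> polys n" "\<tau> permutes {1..n}" for p q \<tau>
    using model_add[OF model that(1) polys_mult[OF polys_Const that(2)] that(3), of "-1"]
      model_scale[OF model that(2,3), of "-1"] by (simp add: Const_minus)
  have eq: "F p = F q \<longleftrightarrow> p - q \<in> I" if "p \<in> polys n" "q \<in> polys n" for p q
  proof -
    have "F p = F q \<longleftrightarrow> (\<forall>\<tau>. \<tau> permutes {1..n} \<longrightarrow> \<Phi> p \<tau> = \<Phi> q \<tau>)"
    proof
      assume "F p = F q"
      then show "\<forall>\<tau>. \<tau> permutes {1..n} \<longrightarrow> \<Phi> p \<tau> = \<Phi> q \<tau>" using F that by metis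
    next
      assume "\<forall>\<tau>. \<tau> permutes {1..n} \<longrightarrow> \<Phi> p \<tau> = \<Phi> q \<tau>"
      then show "F p = F q" using that F F0 by (intro Feq) auto
    qed
    also have "\<dots> \<longleftrightarrow> p - q \<in> I"
      unfolding model_kernel[OF model polys_diff[OF that]] using Fdiff that by auto
    finally show ?thesis .
  qed
  define \<phi> where "\<phi> A = F (SOME p. p \<in> polys n \<and> A = cset I p)" for A
  have \<phi>: "\<phi> (cset I p) = F p" if "p \<in> polys n" for p
  proof -
    let ?q = "SOME q. q \<in> polys n \<and> cset I p = cset I q"
    have "?q \<in> polys n \<and> cset I p = cset I ?q" using that by (rule someI[of _ p, OF conjI]) simp
    then show ?thesis unfolding \<phi>_def using eq[of p ?q] that cset_eq_iff[OF I(2), of p ?q] by simp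
  qed
  show ?thesis
    unfolding rep_iso_def quot_rep_simps(1)[OF I]
  proof (intro exI[of _ \<phi>] conjI ballI allI)
    show "bij_betw \<phi> (cset I ` polys n) (space ?M)"
      unfolding bij_betw_def
    proof
      show "inj_on \<phi> (cset I ` polys n)"
        using eq cset_eq_iff[OF I(2)] by (auto simp: inj_on_def \<phi>)
      show "\<phi> ` cset I ` polys n = space ?M"
      proof (intro equalityI subsetI)
        fix f assume "f \<in> \<phi> ` cset I ` polys n"
        then show "f \<in> space ?M" using \<phi> F0 by (auto simp: M(1))
      next
        fix f assume f: "f \<in> space ?M"
        have "\<exists>p\<in>polys n. \<forall>\<tau>. \<tau> permutes {1..n} \<longrightarrow> \<Phi> p \<tau> = f (hook_coset k n \<tau>)"
          using hook_coset_eq_iff by (intro model_surj[OF model] arg_cong[of _ _ f]) auto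
        then obtain p where p: "p \<in> polys n" "\<And>\<tau>. \<tau> permutes {1..n} \<Longrightarrow> \<Phi> p \<tau> = f (hook_coset k n \<tau>)"
          by blast
        have "F p = f" using f p by (intro Feq) (auto simp: M(1))
        then have "f = \<phi> (cset I p)" using \<phi>[OF p(1)] by simp
        then show "f \<in> \<phi> ` cset I ` polys n" using p(1) by (intro image_eqI) auto
      qed
    qed
  next
    fix x y assume "x \<in> cset I ` polys n" "y \<in> cset I ` polys n"
    then obtain p q where pq: "p \<in> polys n" "q \<in> polys n" "x = cset I p" "y = cset I q" by blast
    have "F (p + q) = vadd ?M (F p) (F q)"
      using pq F F0 by (intro Feq) (auto simp: M(2) polys_add model_add[OF model])
    then show "\<phi> (vadd (quot_rep n I) x y) = vadd ?M (\<phi> x) (\<phi> y)"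
      using pq quot_rep_simps(2)[OF I] by (simp add: \<phi> polys_add)
  next
    fix c x assume "x \<in> cset I ` polys n"
    then obtain p where p: "p \<in> polys n" "x = cset I p" by blast
    have "F (Const c * p) = vscale ?M c (F p)"
      using p F F0 by (intro Feq) (auto simp: M(3) polys_mult model_scale[OF model])
    then show "\<phi> (vscale (quot_rep n I) c x) = vscale ?M c (\<phi> x)"
      using p quot_rep_simps(3)[OF I] by (simp add: \<phi> polys_mult)
  next
    fix \<sigma> x assume "\<sigma> \<in> carrier (sym_group n)" "x \<in> cset I ` polys n"
    then obtain p where p: "p \<in> polys n" "x = cset I p" and \<sigma>: "\<sigma> permutes {1..n}"
      by (auto simp: sym_group_carrier)
    have sp: "perm_poly \<sigma> p \<in> polys n" using \<sigma> p(1) by (rule perm_poly_polys)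
    have "F p \<in> space ?M" using F0 by (simp add: M(1))
    from M(5)[OF \<sigma> this] have v0: "vact ?M \<sigma> (F p) C = 0" if "C \<notin> hook_coset k n ` {\<tau>. \<tau> permutes {1..n}}" for C
      using that by (simp add: M(1))
    have "F (perm_poly \<sigma> p) = vact ?M \<sigma> (F p)"
    proof (rule Feq[OF sp v0])
      fix \<tau> assume \<tau>: "\<tau> permutes {1..n}"
      have "inv' \<sigma> \<circ> \<tau> permutes {1..n}" using \<tau> permutes_inv[OF \<sigma>] by (rule permutes_compose)
      then show "vact ?M \<sigma> (F p) (hook_coset k n \<tau>) = \<Phi> (perm_poly \<sigma> p) \<tau>"
        using M(4)[OF \<sigma>, of "F p" \<tau>] F[OF p(1)] model_act[OF model p(1) \<sigma> \<tau>] by simp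
    qed
    then show "\<phi> (vact (quot_rep n I) \<sigma> x) = vact ?M \<sigma> (\<phi> x)"
      using p sp perm_poly_cset[OF \<sigma> stab[OF \<sigma>]] quot_rep_simps(4)[OF I] by (simp add: \<phi>)
  qed
qed

lemma has_dim_perm_module:
  assumes n: "n = k + r"
  obtains N where "has_dim (perm_module n (k # replicate r 1)) N"
    "rep_dim (perm_module n (k # replicate r 1)) = N"
proof -
  let ?M = "perm_module n (k # replicate r 1)"
  let ?C = "hook_coset k n ` {\<tau>. \<tau> permutes {1..n}}"
  note M = perm_module_simps[OF n]
  have "finite ?C" by (simp add: finite_permutations)
  then obtain h where h: "bij_betw h {0..<card ?C} ?C" using ex_bij_betw_nat_finite by blast
  define N where "N = card ?C"
  define \<phi> where "\<phi> f = (\<lambda>i. if i < N then f (h i) else (0::complex))" for f :: "(nat \<Rightarrow> nat) set \<Rightarrow> complex"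
  have hC: "C \<in> ?C \<longleftrightarrow> (\<exists>i<N. C = h i)" for C
  proof -
    have "?C = h ` {0..<N}" using bij_betw_imp_surj_on[OF h] by (simp add: N_def)
    then have "C \<in> ?C \<longleftrightarrow> C \<in> h ` {0..<N}" by simp
    then show ?thesis by auto
  qed
  have hinj: "i = j" if "h i = h j" "i < N" "j < N" for i j
    using bij_betw_imp_inj_on[OF h] that by (auto simp: N_def dest: inj_onD)
  have "bij_betw \<phi> (space ?M) {f :: nat \<Rightarrow> complex. \<forall>i\<ge>N. f i = 0}"
    unfolding bij_betw_def
  proof
    show "inj_on \<phi> (space ?M)"
    proof (rule inj_onI, rule ext)
      fix f g C assume fg: "f \<in> space ?M" "g \<in> space ?M" "\<phi> f = \<phi> g"
      show "f C = g C"
      proof (cases "C \<in> ?C")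
        case True
        then obtain i where "i < N" "C = h i" using hC by blast
        then show ?thesis using fun_cong[OF fg(3), of i] by (simp add: \<phi>_def)
      next
        case False then show ?thesis using fg(1,2) by (simp add: M(1))
      qed
    qed
    show "\<phi> ` space ?M = {f. \<forall>i\<ge>N. f i = 0}"
    proof (intro equalityI subsetI)
      fix g :: "nat \<Rightarrow> complex" assume g: "g \<in> {f. \<forall>i\<ge>N. f i = 0}"
      define f where "f C = (if C \<in> ?C then g (SOME i. i < N \<and> C = h i) else 0)" for C
      have "f (h i) = g i" if "i < N" for i
      proof -
        have "(SOME j. j < N \<and> h i = h j) = i" using that hinj by (intro some_equality) auto
        then show ?thesis using that hC[of "h i"] by (auto simp: f_def)
      qed
      then have "\<phi> f = g" using g by (auto simp: \<phi>_def fun_eq_iff)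
      moreover have "f \<in> space ?M" by (simp add: M(1) f_def)
      ultimately show "g \<in> \<phi> ` space ?M" by blast
    qed (auto simp: \<phi>_def)
  qed
  then have dim: "has_dim ?M N"
    unfolding has_dim_def by (intro exI[of _ \<phi>] conjI ballI allI) (auto simp: \<phi>_def M(2,3))
  have "K = N" if "has_dim ?M K" for K
    using has_dim_le[OF dim that] has_dim_le[OF that dim] by (force simp: M(1-3) intro!: antisym)
  then have "rep_dim ?M = N" unfolding rep_dim_def using dim by blast
  with dim show ?thesis by (rule that)
qed

lemma has_dim_rep_iso:
  assumes "rep_iso n V W" "has_dim W N"
  shows "has_dim V N"
proof -
  from assms(1) obtain \<phi> where \<phi>: "bij_betw \<phi> (space V) (space W)"
     "\<forall>x\<in>space V. \<forall>y\<in>space V. \<phi> (vadd V x y) = vadd W (\<phi> x) (\<phi> y)"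
     "\<forall>c. \<forall>x\<in>space V. \<phi> (vscale V c x) = vscale W c (\<phi> x)"
    unfolding rep_iso_def by (elim exE conjE)
  from assms(2) obtain \<psi> where \<psi>: "bij_betw \<psi> (space W) {f :: nat \<Rightarrow> complex. \<forall>i\<ge>N. f i = 0}"
     "\<forall>x\<in>space W. \<forall>y\<in>space W. \<psi> (vadd W x y) = (\<lambda>i. \<psi> x i + \<psi> y i)"
     "\<forall>c. \<forall>x\<in>space W. \<psi> (vscale W c x) = (\<lambda>i. c * \<psi> x i)"
    unfolding has_dim_def by (elim exE conjE)
  have "\<phi> x \<in> space W" if "x \<in> space V" for x using bij_betw_apply[OF \<phi>(1) that] .
  then show ?thesis
    unfolding has_dim_def using bij_betw_trans[OF \<phi>(1) \<psi>(1)] \<phi>(2,3) \<psi>(2,3)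
    by (intro exI[of _ "\<psi> \<circ> \<phi>"]) auto
qed


section \<open>Quotients isomorphic to the permutation module satisfy the hook relations\<close>

text \<open>A stable ideal \<open>I\<close> whose quotient is the permutation module of the hook \<open>(k, 1, \<dots>, 1) \<turnstile> n\<close>.\<close>

locale hook_quotient =
  fixes k r n :: nat and I :: "mpoly set" and \<Phi> :: "mpoly \<Rightarrow> (nat \<Rightarrow> nat) \<Rightarrow> complex"
  assumes n: "n = k + r" and k: "k \<ge> 1"
    and sub: "I \<subseteq> polys n" and J: "submod n I" and stab: "stable n I"
    and model: "coset_model k n I \<Phi>"
begin

text \<open>Alternation takes place in the first \<open>d = r + 1\<close> variables: no more than \<open>r + 1\<close> variables can
  alternate in the permutation module, and the vectors for \<open>r + 1\<close> of them form a line.\<close>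

definition d :: nat where "d = Suc r"

lemma d_le: "d \<le> n"
  using n k by (simp add: d_def)

lemma perm_le: "\<sigma> permutes {1..d} \<Longrightarrow> \<sigma> permutes {1..n}"
  using d_le by (auto intro: permutes_subset)

lemma stableD: "\<sigma> permutes {1..n} \<Longrightarrow> p \<in> I \<Longrightarrow> perm_poly \<sigma> p \<in> I"
  using stab by (auto simp: stable_def)

lemma model_diff:
  assumes "p \<in> polys n" "q \<in> polys n" "\<tau> permutes {1..n}"
  shows "\<Phi> (p - q) \<tau> = \<Phi> p \<tau> - \<Phi> q \<tau>"
  using model_add[OF model assms(1) polys_mult[OF polys_Const assms(2)] assms(3), of "-1"]
    model_scale[OF model assms(2,3), of "-1"] by (simp add: Const_minus)

text \<open>The invariants of the quotient are the constants.\<close>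

lemma invariant_const:
  assumes p: "p \<in> polys n" and inv: "\<And>\<sigma>. \<sigma> permutes {1..n} \<Longrightarrow> perm_poly \<sigma> p = p"
  obtains c where "p - Const c \<in> I"
proof -
  have const: "\<Phi> q \<tau> = \<Phi> q id" if "q \<in> polys n" "\<And>\<sigma>. \<sigma> permutes {1..n} \<Longrightarrow> perm_poly \<sigma> q = q" "\<tau> permutes {1..n}" for q \<tau>
    using model_act[OF model that(1,3,3)] that(2,3) permutes_inv_o(2)[OF that(3)] by simp
  have one: "\<Phi> 1 \<tau> = \<Phi> 1 id" if "\<tau> permutes {1..n}" for \<tau>
    using that by (intro const) (auto simp: perm_poly_1 permutes_bij)
  have "\<Phi> 1 id \<noteq> 0"
  proof
    assume "\<Phi> 1 id = 0"
    then have "\<Phi> 1 \<tau> = 0" if "\<tau> permutes {1..n}" for \<tau> using one[OF that] by simp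
    then have "1 \<in> I" using model_kernel[OF model polys_1] by blast
    then have all: "q \<in> I" if "q \<in> polys n" for q using submod_mult[OF J that, of 1] by simp
    obtain q where "q \<in> polys n" "\<And>\<tau>. \<tau> permutes {1..n} \<Longrightarrow> \<Phi> q \<tau> = 1"
      using model_surj[OF model, of "\<lambda>_. 1"] by blast
    then show False using model_kernel[OF model, of q] all permutes_id by (metis zero_neq_one)
  qed
  define c where "c = \<Phi> p id / \<Phi> 1 id"
  have "\<Phi> (p - Const c * 1) \<tau> = 0" if "\<tau> permutes {1..n}" for \<tau>
    using model_diff[OF p polys_mult[OF polys_Const polys_1] that, of c] model_scale[OF model polys_1 that, of c]
      const[OF p inv that] one[OF that] \<open>\<Phi> 1 id \<noteq> 0\<close> by (simp add: c_def)
  then have "p - Const c \<in> I" using model_kernel[OF model, of "p - Const c"] p by (simp add: polys_diff)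
  then show ?thesis by (rule that)
qed

text \<open>Polynomials on which the permutations of the first \<open>d\<close> variables act by the sign.\<close>

definition antisym :: "mpoly \<Rightarrow> bool" where
  "antisym q \<longleftrightarrow> q \<in> polys n \<and> (\<forall>\<sigma>. \<sigma> permutes {1..d} \<longrightarrow> perm_poly \<sigma> q = of_int (sign \<sigma>) * q)"

lemma antisym_polys: "antisym q \<Longrightarrow> q \<in> polys n"
  and antisym_perm: "antisym q \<Longrightarrow> \<sigma> permutes {1..d} \<Longrightarrow> perm_poly \<sigma> q = of_int (sign \<sigma>) * q"
  by (auto simp: antisym_def)

lemma antisym_alt: "p \<in> polys n \<Longrightarrow> antisym (alt d p)"
  using alt_polys[OF d_le] alt_antisym by (auto simp: antisym_def)

lemma antisym_diff: "antisym p \<Longrightarrow> antisym q \<Longrightarrow> antisym (p - q)"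
  by (auto simp: antisym_def polys_diff perm_poly_diff permutes_bij right_diff_distrib)

lemma antisym_sym_mult:
  "s \<in> polys n \<Longrightarrow> (\<And>\<sigma>. \<sigma> permutes {1..d} \<Longrightarrow> perm_poly \<sigma> s = s) \<Longrightarrow> antisym q \<Longrightarrow> antisym (s * q)"
  by (auto simp: antisym_def polys_mult perm_poly_mult permutes_bij mult_ac)

lemma antisym_Const_mult: "antisym q \<Longrightarrow> antisym (Const c * q)"
  by (rule antisym_sym_mult) (auto simp: perm_poly_Const permutes_bij)

lemma Const_diff_mult: "Const c * p - Const e * p = Const (c - e) * p" for c e :: complex
  by (simp add: Const_diff algebra_simps)

text \<open>The coset whose last \<open>r\<close> values are \<open>1, \<dots>, r\<close>.\<close>

lemma base_perm: "\<exists>\<tau>. \<tau> permutes {1..n} \<and> (\<forall>l\<in>{1..r}. \<tau> (k + l) = l)"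
proof -
  define \<tau> where "\<tau> = (\<lambda>i. if i \<in> {1..k} then r + i else if i \<in> {k<..n} then i - k else i)"
  have "inj_on \<tau> {1..n}" using n by (auto simp: inj_on_def \<tau>_def split: if_splits)
  moreover have "\<tau> ` {1..n} \<subseteq> {1..n}" using n by (auto simp: \<tau>_def)
  ultimately have "bij_betw \<tau> {1..n} {1..n}" by (simp add: bij_betw_def endo_inj_surj)
  then have "\<tau> permutes {1..n}" by (rule bij_imp_permutes) (use n in \<open>auto simp: \<tau>_def\<close>)
  moreover have "\<forall>l\<in>{1..r}. \<tau> (k + l) = l" using n by (auto simp: \<tau>_def)
  ultimately show ?thesis by blast
qed

definition \<tau>0 :: "nat \<Rightarrow> nat" where
  "\<tau>0 = (SOME \<tau>. \<tau> permutes {1..n} \<and> (\<forall>l\<in>{1..r}. \<tau> (k + l) = l))"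

lemma \<tau>0: "\<tau>0 permutes {1..n}" "l \<in> {1..r} \<Longrightarrow> \<tau>0 (k + l) = l"
  using someI_ex[OF base_perm] unfolding \<tau>0_def by blast+

lemma \<tau>0': "i \<in> {k<..n} \<Longrightarrow> \<tau>0 i = i - k"
proof -
  assume i: "i \<in> {k<..n}"
  then have "1 \<le> i - k" "i - k \<le> r" "k + (i - k) = i" using n
    by (simp_all only: greaterThanAtMost_iff) linarith+
  then show ?thesis using \<tau>0(2)[of "i - k"] by simp
qed

text \<open>An alternating vector of the permutation module is determined by its value at the coset of \<open>\<tau>0\<close>. If two of
  the indices \<open>1, \<dots>, d\<close> are not values of \<open>\<tau>\<close> above \<open>k\<close>, their transposition fixes the coset of \<open>\<tau>\<close>, and the
  value is zero. Otherwise a permutation of \<open>1, \<dots>, d\<close> carries \<open>\<tau>0\<close> to \<open>\<tau>\<close>.\<close>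

lemma antisym_determined:
  assumes q: "antisym q" and 0: "\<Phi> q \<tau>0 = 0"
  shows "q \<in> I"
proof -
  have qP: "q \<in> polys n" using q by (rule antisym_polys)
  have sgn: "\<Phi> (perm_poly \<sigma> q) \<tau> = of_int (sign \<sigma>) * \<Phi> q \<tau>" if "\<sigma> permutes {1..d}" "\<tau> permutes {1..n}" for \<sigma> \<tau>
    using model_scale[OF model qP that(2), of "of_int (sign \<sigma>)"] antisym_perm[OF q that(1)]
    by (simp add: of_int_Const)
  have "\<Phi> q \<tau> = 0" if \<tau>: "\<tau> permutes {1..n}" for \<tau>
  proof (cases "\<exists>i\<in>{1..d} - \<tau> ` {k<..n}. \<exists>j\<in>{1..d} - \<tau> ` {k<..n}. i \<noteq> j")
    case True
    then obtain i j where ij: "i \<in> {1..d}" "j \<in> {1..d}" "i \<noteq> j" "i \<notin> \<tau> ` {k<..n}" "j \<notin> \<tau> ` {k<..n}" by blast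
    let ?t = "transpose i j"
    have t: "?t permutes {1..d}" using ij by (simp add: permutes_swap_id)
    have "?t \<circ> \<tau> permutes {1..n}" using \<tau> perm_le[OF t] by (rule permutes_compose)
    moreover have "(?t \<circ> \<tau>) l = \<tau> l" if "l \<in> {k<..n}" for l
      using ij that by (auto simp: transpose_def)
    ultimately have "\<Phi> q (?t \<circ> \<tau>) = \<Phi> q \<tau>" using \<tau> by (intro model_coset[OF model qP]) auto
    moreover have "\<Phi> (perm_poly ?t q) \<tau> = \<Phi> q (?t \<circ> \<tau>)"
      using model_act[OF model qP perm_le[OF t] \<tau>] by simp
    ultimately have "\<Phi> q \<tau> = - \<Phi> q \<tau>" using sgn[OF t \<tau>] ij by (simp add: sign_swap_id)
    then show ?thesis by simp
  next
    case False
    let ?T = "\<tau> ` {k<..n}"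
    have cT: "card ?T = r"
      using n by (simp add: card_image[OF inj_on_subset[OF permutes_inj[OF \<tau>] subset_UNIV]])
    have fin: "finite ?T" by simp
    have small: "card ({1..d} - ?T) \<le> 1"
    proof -
      have "\<forall>i\<in>{1..d} - ?T. \<forall>j\<in>{1..d} - ?T. i = j" using False by blast
      moreover have "finite ({1..d} - ?T)" by simp
      ultimately have "card ({1..d} - ?T) \<le> Suc 0" by (intro iffD2[OF card_le_Suc0_iff_eq])
      then show ?thesis unfolding One_nat_def .
    qed
    have "card ({1..d} - ?T) = d - card ({1..d} \<inter> ?T)" by (simp add: card_Diff_subset_Int)
    then have "card ({1..d} \<inter> ?T) \<ge> card ?T" using small cT by (simp add: d_def)
    then have Td: "?T \<subseteq> {1..d}" using card_seteq[OF fin, of "{1..d} \<inter> ?T"] by auto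
    have "card ({1..d} - ?T) = 1" using Td cT by (simp add: card_Diff_subset d_def)
    then obtain x where x: "{1..d} - ?T = {x}" by (rule card_1_singletonE)
    define \<sigma> where "\<sigma> = (\<lambda>i. if i \<in> {1..r} then \<tau> (k + i) else if i = d then x else i)"
    have in1: "\<tau> (k + i) \<in> ?T" if "i \<in> {1..r}" for i using that n by auto
    have "x \<in> {1..d} - ?T" unfolding x by (rule singletonI)
    then have xx: "x \<notin> ?T" "x \<in> {1..d}" unfolding Diff_iff by blast+
    have \<sigma>1: "\<sigma> i = \<tau> (k + i)" if "i \<in> {1..r}" for i using that by (simp add: \<sigma>_def)
    have \<sigma>d: "\<sigma> d = x" by (simp add: \<sigma>_def d_def)
    have split: "i \<in> {1..r} \<or> i = d" if "i \<in> {1..d}" for i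
      using that unfolding d_def atLeastAtMost_iff le_Suc_eq by blast
    have "inj_on \<sigma> {1..d}"
    proof (rule inj_onI)
      fix i j assume ij: "i \<in> {1..d}" "j \<in> {1..d}" "\<sigma> i = \<sigma> j"
      have inj: "i = j" if "\<tau> (k + i) = \<tau> (k + j)" using injD[OF permutes_inj[OF \<tau>] that] by simp
      show "i = j" using split[OF ij(1)] split[OF ij(2)]
      proof (elim disjE)
        assume *: "i \<in> {1..r}" "j \<in> {1..r}"
        show ?thesis using ij(3) unfolding \<sigma>1[OF *(1)] \<sigma>1[OF *(2)] by (rule inj)
      next
        assume *: "i \<in> {1..r}" "j = d"
        show ?thesis using ij(3) in1[OF *(1)] xx(1) unfolding \<sigma>1[OF *(1)] *(2) \<sigma>d by simp
      next
        assume *: "i = d" "j \<in> {1..r}"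
        show ?thesis using ij(3) in1[OF *(2)] xx(1) unfolding \<sigma>1[OF *(2)] *(1) \<sigma>d by simp
      qed simp
    qed
    moreover have "\<sigma> ` {1..d} \<subseteq> {1..d}"
    proof
      fix y assume "y \<in> \<sigma> ` {1..d}"
      then obtain i where i: "i \<in> {1..d}" "y = \<sigma> i" by blast
      show "y \<in> {1..d}" using split[OF i(1)]
      proof
        assume "i \<in> {1..r}"
        then have "y \<in> ?T" using i(2) \<sigma>1 in1 by simp
        then show ?thesis using Td by blast
      qed (use i(2) \<sigma>d xx in simp)
    qed
    ultimately have "bij_betw \<sigma> {1..d} {1..d}" by (simp add: bij_betw_def endo_inj_surj)
    then have \<sigma>: "\<sigma> permutes {1..d}" by (rule bij_imp_permutes) (auto simp: \<sigma>_def d_def)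
    have "\<sigma> \<circ> \<tau>0 permutes {1..n}" using \<tau>0(1) perm_le[OF \<sigma>] by (rule permutes_compose)
    moreover have "\<tau> l = (\<sigma> \<circ> \<tau>0) l" if "l \<in> {k<..n}" for l
    proof -
      have l: "l - k \<in> {1..r}" "k + (l - k) = l" using that n
        by (simp_all only: greaterThanAtMost_iff atLeastAtMost_iff) linarith+
      then show ?thesis using \<sigma>1[OF l(1)] \<tau>0'[OF that] by simp
    qed
    ultimately have "\<Phi> q \<tau> = \<Phi> q (\<sigma> \<circ> \<tau>0)" using \<tau> by (intro model_coset[OF model qP]) auto
    also have "\<dots> = \<Phi> (perm_poly (inv' \<sigma>) q) \<tau>0"
      using model_act[OF model qP permutes_inv[OF perm_le[OF \<sigma>]] \<tau>0(1)]
      unfolding permutes_inv_inv[OF \<sigma>] by (rule sym)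
    also have "\<dots> = 0" using sgn[OF permutes_inv[OF \<sigma>] \<tau>0(1)] 0 by simp
    finally show ?thesis .
  qed
  then show ?thesis using model_kernel[OF model qP] by simp
qed

text \<open>Alternating the indicator function of the coset of \<open>\<tau>0\<close> gives a nonzero vector, since no nontrivial permutation
  of \<open>1, \<dots>, d\<close> fixes this coset.\<close>

lemma alternating_generator: "\<exists>p\<in>polys n. \<Phi> (alt d p) \<tau>0 = 1"
proof -
  define f where "f = (\<lambda>\<tau>. if \<forall>i\<in>{k<..n}. \<tau> i = \<tau>0 i then 1 else (0::complex))"
  have "\<exists>p\<in>polys n. \<forall>\<tau>. \<tau> permutes {1..n} \<longrightarrow> \<Phi> p \<tau> = f \<tau>"
    by (rule model_surj[OF model]) (auto simp: f_def)
  then obtain p where p: "p \<in> polys n" "\<And>\<tau>. \<tau> permutes {1..n} \<Longrightarrow> \<Phi> p \<tau> = f \<tau>" by blast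
  have \<Phi>sum: "\<Phi> (\<Sum>x\<in>A. g x) \<tau>0 = (\<Sum>x\<in>A. \<Phi> (g x) \<tau>0) \<and> (\<Sum>x\<in>A. g x) \<in> polys n"
    if "finite A" "\<And>x. x \<in> A \<Longrightarrow> g x \<in> polys n" for A and g :: "(nat \<Rightarrow> nat) \<Rightarrow> mpoly"
    using that
  proof (induction A rule: finite_induct)
    case empty
    have "\<Phi> 0 \<tau>0 = 0" using model_scale[OF model polys_0 \<tau>0(1), of 0] by simp
    then show ?case by simp
  next
    case (insert x A)
    then show ?case using model_add[OF model, of "g x" "\<Sum>x\<in>A. g x" \<tau>0] \<tau>0(1) by (simp add: polys_add)
  qed
  have id: "\<sigma> = id" if \<sigma>: "\<sigma> permutes {1..d}" and fx: "\<forall>i\<in>{k<..n}. (inv' \<sigma> \<circ> \<tau>0) i = \<tau>0 i" for \<sigma>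
  proof -
    have fix1: "inv' \<sigma> l = l" if "l \<in> {1..r}" for l
      using fx[rule_format, of "k + l"] \<tau>0(2)[OF that] that n by auto
    have inv: "inv' \<sigma> permutes {1..d}" using \<sigma> by (rule permutes_inv)
    have "inv' \<sigma> d \<in> {1..d}" using permutes_in_image[OF inv, of d] by (simp add: d_def)
    moreover have "inv' \<sigma> d \<notin> {1..r}"
    proof
      assume "inv' \<sigma> d \<in> {1..r}"
      then have "inv' \<sigma> (inv' \<sigma> d) = inv' \<sigma> d" by (rule fix1)
      then have "inv' \<sigma> d = d" using permutes_inj[OF inv] by (auto dest: injD)
      then show False using \<open>inv' \<sigma> d \<in> {1..r}\<close> by (simp add: d_def)
    qed
    ultimately have "inv' \<sigma> d = d" by (auto simp: d_def)
    then have "inv' \<sigma> i = i" for i using fix1 permutes_not_in[OF inv, of i] by (cases "i \<in> {1..r} \<or> i = d") (auto simp: d_def)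
    then have "inv' \<sigma> = id" by auto
    then show ?thesis using permutes_inv_inv[OF \<sigma>] by simp
  qed
  have summand: "\<Phi> (of_int (sign \<sigma>) * perm_poly \<sigma> p) \<tau>0 = (if \<sigma> = id then 1 else 0)" if \<sigma>: "\<sigma> permutes {1..d}" for \<sigma>
  proof -
    have "inv' \<sigma> \<circ> \<tau>0 permutes {1..n}" using \<tau>0(1) permutes_inv[OF perm_le[OF \<sigma>]] by (rule permutes_compose)
    then have "\<Phi> (perm_poly \<sigma> p) \<tau>0 = f (inv' \<sigma> \<circ> \<tau>0)"
      using model_act[OF model p(1) perm_le[OF \<sigma>] \<tau>0(1)] p(2) by simp
    moreover have "\<Phi> (of_int (sign \<sigma>) * perm_poly \<sigma> p) \<tau>0 = of_int (sign \<sigma>) * \<Phi> (perm_poly \<sigma> p) \<tau>0"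
      unfolding of_int_Const using perm_poly_polys[OF perm_le[OF \<sigma>] p(1)] \<tau>0(1) by (rule model_scale[OF model])
    ultimately show ?thesis using id[OF \<sigma>] by (auto simp: f_def)
  qed
  have "\<Phi> (alt d p) \<tau>0 = (\<Sum>\<sigma> | \<sigma> permutes {1..d}. \<Phi> (of_int (sign \<sigma>) * perm_poly \<sigma> p) \<tau>0)"
    unfolding alt_def using \<Phi>sum[OF finite_perms] perm_poly_polys[OF perm_le p(1)]
    by (auto simp: polys_mult polys_of_int)
  also have "\<dots> = (\<Sum>\<sigma> | \<sigma> permutes {1..d}. if \<sigma> = id then 1 else 0)"
    by (intro sum.cong) (auto simp: summand)
  also have "\<dots> = 1" using finite_perms[of d] permutes_id[of "{1..d}"] by (simp add: sum.delta)
  finally show ?thesis using p(1) by blast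
qed

text \<open>\<open>E\<close> represents a generator of the line of alternating classes.\<close>

definition P :: mpoly where "P = (SOME p. p \<in> polys n \<and> \<Phi> (alt d p) \<tau>0 = 1)"
definition E :: mpoly where "E = alt d P"

lemma P: "P \<in> polys n" "\<Phi> E \<tau>0 = 1"
proof -
  have "P \<in> polys n \<and> \<Phi> (alt d P) \<tau>0 = 1"
    unfolding P_def by (rule someI_ex) (use alternating_generator in blast)
  then show "P \<in> polys n" "\<Phi> E \<tau>0 = 1" by (simp_all add: E_def)
qed

lemma E_antisym: "antisym E"
  unfolding E_def using P(1) by (rule antisym_alt)

lemma E_polys: "E \<in> polys n"
  using E_antisym by (rule antisym_polys)

lemma E_notin: "E \<notin> I"
  using model_kernel[OF model E_polys] P(2) \<tau>0(1) by auto

lemma Const_E: "Const c * E \<in> I \<Longrightarrow> c = 0"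
  using submod_cancel_Const[OF J] E_notin by blast

lemma antisym_multiple:
  assumes "antisym q"
  obtains c where "q - Const c * E \<in> I"
proof -
  have "\<Phi> (q - Const (\<Phi> q \<tau>0) * E) \<tau>0 = 0"
    using model_diff[OF antisym_polys[OF assms] polys_mult[OF polys_Const E_polys] \<tau>0(1)]
      model_scale[OF model E_polys \<tau>0(1)] P(2) by simp
  then have "q - Const (\<Phi> q \<tau>0) * E \<in> I"
    using assms by (intro antisym_determined antisym_diff antisym_Const_mult E_antisym)
  then show ?thesis by (rule that)
qed

lemma submod_trans: "p - q \<in> I \<Longrightarrow> q - s \<in> I \<Longrightarrow> p - s \<in> I"
  using submod_add[OF J, of "p - q" "q - s"] by simp

lemma submod_sym: "p - q \<in> I \<Longrightarrow> q - p \<in> I"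
  using submod_uminus[OF J, of "p - q"] by simp

lemma submod_cong_mult: "s \<in> polys n \<Longrightarrow> p - q \<in> I \<Longrightarrow> s * p - s * q \<in> I"
  using submod_mult[OF J, of s "p - q"] by (simp add: right_diff_distrib)

lemma submod_cong_mem: "p - q \<in> I \<Longrightarrow> q \<in> I \<Longrightarrow> p \<in> I"
  using submod_add[OF J, of "p - q" q] by simp

text \<open>Polynomials symmetric in the first \<open>d\<close> variables act on the line of alternating classes by scalars.\<close>

lemma symmetric_eigenvalue:
  assumes "s \<in> polys n" "\<And>\<sigma>. \<sigma> permutes {1..d} \<Longrightarrow> perm_poly \<sigma> s = s"
  obtains c where "s * E - Const c * E \<in> I"
  using antisym_multiple[OF antisym_sym_mult[OF assms E_antisym]] by blast

text \<open>The remaining variables act on the line by one and the same scalar, which is the parameter \<open>a\<close>.\<close>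

lemma outer_eigenvalue:
  "\<exists>a. \<forall>j\<in>{d<..n}. shift_var a j * E \<in> I"
proof (cases "d < n")
  case True
  have "\<exists>a. Var j * E - Const a * E \<in> I" if "j \<in> {d<..n}" for j
  proof -
    have "perm_poly \<sigma> (Var j) = Var j" if "\<sigma> permutes {1..d}" for \<sigma>
      using \<open>j \<in> {d<..n}\<close> that by (simp add: perm_poly_Var permutes_bij permutes_not_in)
    then show ?thesis using symmetric_eigenvalue[of "Var j"] that polys_Var[of j n] by auto
  qed
  then obtain f where f: "\<And>j. j \<in> {d<..n} \<Longrightarrow> Var j * E - Const (f j) * E \<in> I" by metis
  have feq: "f j = f j'" if j: "j \<in> {d<..n}" "j' \<in> {d<..n}" for j j'
  proof -
    let ?t = "transpose j j'"
    have t: "?t permutes {1..n}" using j by (intro permutes_swap_id) auto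
    have comm: "\<sigma> \<circ> ?t = ?t \<circ> \<sigma>" if \<sigma>: "\<sigma> permutes {1..d}" for \<sigma>
    proof
      fix x
      have "\<sigma> j = j" "\<sigma> j' = j'" using \<sigma> j by (auto simp: permutes_not_in)
      moreover have "\<sigma> x = j \<longleftrightarrow> x = j" "\<sigma> x = j' \<longleftrightarrow> x = j'"
        using calculation inj_eq[OF permutes_inj[OF \<sigma>], of x] by metis+
      ultimately show "(\<sigma> \<circ> ?t) x = (?t \<circ> \<sigma>) x"
        by (simp add: transpose_def)
    qed
    have "antisym (perm_poly ?t E)"
      unfolding antisym_def
    proof (intro conjI allI impI)
      show "perm_poly ?t E \<in> polys n" using t E_polys by (rule perm_poly_polys)
      fix \<sigma> assume \<sigma>: "\<sigma> permutes {1..d}"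
      have "perm_poly \<sigma> (perm_poly ?t E) = perm_poly ?t (perm_poly \<sigma> E)"
        using permutes_bij[OF \<sigma>] by (simp add: perm_poly_comp comm[OF \<sigma>])
      then show "perm_poly \<sigma> (perm_poly ?t E) = of_int (sign \<sigma>) * perm_poly ?t E"
        using antisym_perm[OF E_antisym \<sigma>] by (simp add: perm_poly_mult perm_poly_of_int)
    qed
    then obtain \<eta> where \<eta>: "perm_poly ?t E - Const \<eta> * E \<in> I" by (rule antisym_multiple)
    have "\<eta> \<noteq> 0"
    proof
      assume "\<eta> = 0"
      then have "perm_poly ?t (perm_poly ?t E) \<in> I" using \<eta> stableD[OF t] by simp
      then show False using E_notin by (simp add: perm_poly_comp)
    qed
    have "perm_poly ?t (Var j * E - Const (f j) * E) \<in> I" using stableD[OF t f[OF j(1)]] .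
    then have 1: "Var j' * perm_poly ?t E - Const (f j) * perm_poly ?t E \<in> I"
      by (simp add: perm_poly_diff perm_poly_mult perm_poly_Var perm_poly_Const)
    have V: "Var j' - Const (f j) \<in> polys n" using j by (intro polys_diff polys_Var polys_Const) auto
    have "(Var j' - Const (f j)) * perm_poly ?t E \<in> I" using 1 by (simp only: left_diff_distrib)
    with submod_cong_mult[OF V submod_sym[OF \<eta>]] have "(Var j' - Const (f j)) * (Const \<eta> * E) \<in> I"
      by (rule submod_cong_mem)
    then have "Const \<eta> * ((Var j' - Const (f j)) * E) \<in> I" by (simp only: mult.left_commute)
    from submod_cancel_Const[OF J this \<open>\<eta> \<noteq> 0\<close>]
    have "Var j' * E - Const (f j) * E \<in> I" by (simp only: left_diff_distrib)
    from submod_trans[OF submod_sym[OF this] f[OF j(2)]]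
    have "Const (f j - f j') * E \<in> I" by (simp only: Const_diff_mult)
    from Const_E[OF this] show ?thesis by simp
  qed
  show ?thesis
  proof (intro exI ballI)
    fix j assume j: "j \<in> {d<..n}"
    have "f j = f n" using True by (intro feq j) simp
    then show "shift_var (f n) j * E \<in> I" using f[OF j] by (simp add: shift_var_def left_diff_distrib)
  qed
qed auto

text \<open>The product of the first \<open>d\<close> shifted variables.\<close>

definition front_prod :: "complex \<Rightarrow> mpoly" where
  "front_prod a = (\<Prod>i\<in>{1..d}. shift_var a i)"

lemma front_prod_polys: "front_prod a \<in> polys n"
  unfolding front_prod_def using d_le by (intro polys_prod polys_shift_var) auto

lemma front_prod_sym:
  assumes "\<sigma> permutes {1..d}" shows "perm_poly \<sigma> (front_prod a) = front_prod a"
proof -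
  have "perm_poly \<sigma> (front_prod a) = (\<Prod>i\<in>{1..d}. (shift_var a \<circ> \<sigma>) i)"
    unfolding front_prod_def using permutes_bij[OF assms] by (simp add: perm_poly_prod perm_poly_shift_var)
  also have "\<dots> = front_prod a"
    unfolding front_prod_def by (rule prod.permute[OF assms, symmetric])
  finally show ?thesis .
qed

lemma front_prod_remove:
  "i \<in> {1..d} \<Longrightarrow> front_prod a = shift_var a i * (\<Prod>l\<in>{1..d} - {i}. shift_var a l)"
  unfolding front_prod_def by (rule prod.remove) auto

lemma front_prod_mem:
  assumes "i \<in> {1..d}" "shift_var a i * q \<in> I"
  shows "front_prod a * q \<in> I"
proof -
  have "(\<Prod>l\<in>{1..d} - {i}. shift_var a l) \<in> polys n"
    using d_le by (intro polys_prod polys_shift_var) auto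
  from submod_mult[OF J this assms(2)] show ?thesis
    unfolding front_prod_remove[OF assms(1)] by (simp only: mult_ac)
qed

text \<open>The scalar \<open>a\<close> is also a root of the polynomial by which the first \<open>d\<close> variables act. The argument uses a Garnir
  element: with \<open>j = d + 1\<close>, subtracting from \<open>E\<close> its images under the transpositions \<open>(i j)\<close>, \<open>i \<le> d\<close>, gives an
  alternating \<open>Z\<close>, hence a multiple of \<open>E\<close> modulo \<open>I\<close>. If the product of the \<open>y\<^sub>i\<close> does not kill \<open>E\<close>, the factor
  is \<open>1\<close>, because it kills the images.\<close>

lemma front_prod_kills:
  assumes "d < n" and a: "\<And>j. j \<in> {d<..n} \<Longrightarrow> shift_var a j * E \<in> I"
  shows "front_prod a * E \<in> I"
proof (rule ccontr)
  assume nin: "front_prod a * E \<notin> I"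
  define j where "j = Suc d"
  have j: "j \<in> {d<..n}" using assms(1) by (simp add: j_def)
  let ?t = "\<lambda>i. transpose i j"
  have t: "?t i permutes {1..n}" if "i \<in> {1..d}" for i using that j by (intro permutes_swap_id) auto
  have \<sigma>j: "\<sigma> j = j" if "\<sigma> permutes {1..d}" for \<sigma>
    by (rule permutes_not_in[OF that]) (simp add: j_def)
  define Z where "Z = E - (\<Sum>i\<in>{1..d}. perm_poly (?t i) E)"
  have tE: "perm_poly (?t i) E \<in> polys n" if "i \<in> {1..d}" for i using t[OF that] E_polys by (rule perm_poly_polys)
  have ZP: "Z \<in> polys n" unfolding Z_def by (intro polys_diff polys_sum E_polys tE)
  have "antisym Z"
    unfolding antisym_def
  proof (intro conjI allI impI)
    show "Z \<in> polys n" by (rule ZP)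
    fix \<sigma> assume \<sigma>: "\<sigma> permutes {1..d}"
    have comm: "\<sigma> \<circ> ?t i = ?t (\<sigma> i) \<circ> \<sigma>" for i
    proof
      fix x
      have "\<sigma> x = \<sigma> i \<longleftrightarrow> x = i" "\<sigma> x = j \<longleftrightarrow> x = j"
        using inj_eq[OF permutes_inj[OF \<sigma>], of x] \<sigma>j[OF \<sigma>] by metis+
      then show "(\<sigma> \<circ> ?t i) x = (?t (\<sigma> i) \<circ> \<sigma>) x" using \<sigma>j[OF \<sigma>] by (simp add: transpose_def)
    qed
    have "perm_poly \<sigma> (perm_poly (?t i) E) = of_int (sign \<sigma>) * perm_poly (?t (\<sigma> i)) E" for i
    proof -
      have "perm_poly \<sigma> (perm_poly (?t i) E) = perm_poly (?t (\<sigma> i)) (perm_poly \<sigma> E)"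
        using permutes_bij[OF \<sigma>] by (simp add: perm_poly_comp comm)
      then show ?thesis using antisym_perm[OF E_antisym \<sigma>] by (simp add: perm_poly_mult perm_poly_of_int)
    qed
    then have "perm_poly \<sigma> (\<Sum>i\<in>{1..d}. perm_poly (?t i) E) =
        of_int (sign \<sigma>) * (\<Sum>i\<in>{1..d}. perm_poly (?t (\<sigma> i)) E)"
      using permutes_bij[OF \<sigma>] by (simp add: perm_poly_sum sum_distrib_left)
    also have "(\<Sum>i\<in>{1..d}. perm_poly (?t (\<sigma> i)) E) = (\<Sum>i\<in>{1..d}. perm_poly (?t i) E)"
      using sum.permute[OF \<sigma>, of "\<lambda>i. perm_poly (?t i) E"] by (simp add: comp_def)
    finally show "perm_poly \<sigma> Z = of_int (sign \<sigma>) * Z"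
      using permutes_bij[OF \<sigma>] antisym_perm[OF E_antisym \<sigma>]
      by (simp add: Z_def perm_poly_diff right_diff_distrib)
  qed
  then obtain e where e: "Z - Const e * E \<in> I" by (rule antisym_multiple)
  obtain c where c: "front_prod a * E - Const c * E \<in> I"
    using symmetric_eigenvalue[OF front_prod_polys front_prod_sym] by blast
  have yt: "shift_var a i * perm_poly (?t i) E \<in> I" if "i \<in> {1..d}" for i
  proof -
    have "perm_poly (?t i) (shift_var a j * E) \<in> I" using stableD[OF t[OF that] a[OF j]] .
    then show ?thesis by (simp add: perm_poly_mult perm_poly_shift_var)
  qed
  have "(\<Sum>i\<in>{1..d}. front_prod a * perm_poly (?t i) E) \<in> I"
    by (intro submod_sum[OF J] front_prod_mem[OF _ yt])
  then have "front_prod a * E - front_prod a * Z \<in> I"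
    by (simp add: Z_def right_diff_distrib sum_distrib_left)
  from submod_trans[OF this submod_cong_mult[OF front_prod_polys e]]
  have "front_prod a * E - Const e * (front_prod a * E) \<in> I" by (simp only: mult.left_commute)
  moreover have "front_prod a * E - Const e * (front_prod a * E) = Const (1 - e) * (front_prod a * E)"
    by (simp add: Const_diff left_diff_distrib)
  ultimately have "Const (1 - e) * (front_prod a * E) \<in> I" by simp
  then have e1: "e = 1" using submod_cancel_Const[OF J] nin by force
  \<comment> \<open>Hence the class of \<open>E\<close> is alternating in \<open>d + 1\<close> variables, and is killed by \<open>y\<^sub>1\<close> as it is by \<open>y\<^sub>j\<close>.\<close>
  define l :: nat where "l = 1"
  have l: "l \<in> {1..d}" by (simp add: l_def d_def)
  have tt: "perm_poly (?t l) (perm_poly (?t i) E) = - perm_poly (?t i) E" if i: "i \<in> {1..d} - {l}" for i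
  proof -
    have li: "transpose l i permutes {1..d}" using l i by (intro permutes_swap_id) auto
    have "i \<noteq> j" "l \<noteq> j" "l \<noteq> i" using i l j by auto
    then have "?t l \<circ> ?t i = ?t i \<circ> transpose l i" by (auto simp: transpose_def fun_eq_iff)
    then have "perm_poly (?t l) (perm_poly (?t i) E) = perm_poly (?t i) (perm_poly (transpose l i) E)"
      by (simp add: perm_poly_comp)
    also have "perm_poly (transpose l i) E = - E"
      using antisym_perm[OF E_antisym li] \<open>l \<noteq> i\<close> by (simp add: sign_swap_id)
    finally show ?thesis by (simp add: perm_poly_uminus)
  qed
  have Zl: "Z = E - (perm_poly (?t l) E + (\<Sum>i\<in>{1..d} - {l}. perm_poly (?t i) E))"
    unfolding Z_def using l by (subst sum.remove[of _ l]) auto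
  have "perm_poly (?t l) Z = perm_poly (?t l) E - (E + (\<Sum>i\<in>{1..d} - {l}. - perm_poly (?t i) E))"
    unfolding Zl using tt by (simp add: perm_poly_diff perm_poly_add perm_poly_sum perm_poly_comp)
  then have tZ: "perm_poly (?t l) Z = - Z" unfolding Zl by (simp add: sum_negf)
  have ZE: "Z - E \<in> I" using e e1 by simp
  have "perm_poly (?t l) (Z - E) \<in> I" using stableD[OF t[OF l] ZE] .
  then have "- Z - perm_poly (?t l) E \<in> I" by (simp add: perm_poly_diff tZ)
  from submod_uminus[OF J submod_add[OF J ZE this]] have "E + perm_poly (?t l) E \<in> I"
    by (simp add: add.commute)
  moreover have yl: "shift_var a l \<in> polys n" using l d_le by (intro polys_shift_var) auto
  ultimately have "shift_var a l * (E + perm_poly (?t l) E) \<in> I" using submod_mult[OF J] by blast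
  from submod_diff[OF J this yt[OF l]] have "shift_var a l * E \<in> I" by (simp add: distrib_left)
  from front_prod_mem[OF l this] nin show False by simp
qed

text \<open>The elementary symmetric functions of the first \<open>d\<close> variables act on \<open>E\<close> as the coefficients of a monic
  complex polynomial.\<close>

lemma root_poly_eigen:
  obtains g :: "complex poly" where "degree g = d" "lead_coeff g = 1"
    "\<And>j. coeff (root_poly a d) j * E - Const (coeff g j) * E \<in> I"
    "front_prod a * E \<in> I \<Longrightarrow> coeff g 0 = 0"
proof -
  have "\<exists>c. coeff (root_poly a d) j * E - Const c * E \<in> I" for j
  proof -
    have "coeff (root_poly a d) j \<in> polys n" using coeffs_in_root_poly[OF d_le, of a] by (simp add: coeffs_in_def)
    moreover have "perm_poly \<sigma> (coeff (root_poly a d) j) = coeff (root_poly a d) j" if "\<sigma> permutes {1..d}" for \<sigma>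
      unfolding root_poly_def using that by (intro perm_poly_coeff_linear_prod permutes_bij permutes_image)
    ultimately show ?thesis using symmetric_eigenvalue by blast
  qed
  then obtain c where c: "\<And>j. coeff (root_poly a d) j * E - Const (c j) * E \<in> I" by metis
  define g where "g = Polynomial.monom 1 d + (\<Sum>j<d. Polynomial.monom (c j) j)"
  have co: "coeff g j = (if j = d then 1 else if j < d then c j else 0)" for j
  proof -
    have "(\<Sum>i<d. coeff (Polynomial.monom (c i) i) j) = (if j < d then c j else 0)"
      by (simp add: sum.delta)
    then show ?thesis by (simp add: g_def coeff_sum)
  qed
  have deg: "degree g = d"
  proof (rule le_antisym)
    show "degree g \<le> d" by (rule degree_le) (simp add: co)
    show "d \<le> degree g" by (rule le_degree) (simp add: co)
  qed
  show ?thesis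
  proof (rule that[of g])
    show "degree g = d" by (rule deg)
    show "lead_coeff g = 1" by (simp add: deg co)
    show "coeff (root_poly a d) j * E - Const (coeff g j) * E \<in> I" for j
    proof -
      consider "j < d" | "j = d" | "j > d" by linarith
      then show ?thesis
      proof cases
        case 3
        then have "coeff (root_poly a d) j = 0"
          using degree_root_poly[of a d] by (intro coeff_eq_0) simp
        then show ?thesis using 3 submod_0[OF J] by (simp add: co)
      qed (use c submod_0[OF J] coeff_root_poly_top[of a d] in \<open>auto simp: co\<close>)
    qed
    assume w: "front_prod a * E \<in> I"
    have "coeff (root_poly a d) 0 = (\<Prod>i\<in>{1..d}. - shift_var a i)"
      by (simp add: poly_0_coeff_0[symmetric] root_poly_def poly_prod)
    also have "\<dots> = (-1) ^ d * front_prod a"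
      by (simp add: front_prod_def prod_uminus)
    finally have "coeff (root_poly a d) 0 * E \<in> I"
      using submod_mult[OF J _ w, of "(-1) ^ d"] by (simp add: mult.assoc polys_power polys_uminus)
    from submod_diff[OF J this c[of 0]] have "Const (c 0) * E \<in> I" by simp
    from Const_E[OF this] show "coeff g 0 = 0" by (simp add: co d_def)
  qed
qed

text \<open>If \<open>d = n\<close>, that is \<open>k = 1\<close>, there are no remaining variables, and any root may serve as \<open>a\<close>.\<close>

lemma head_value:
  obtains a where "\<And>j. j \<in> {d<..n} \<Longrightarrow> shift_var a j * E \<in> I" "front_prod a * E \<in> I"
proof (cases "d < n")
  case True
  obtain a where "\<forall>j\<in>{d<..n}. shift_var a j * E \<in> I" using outer_eigenvalue by blast
  then show ?thesis using front_prod_kills[OF True] by (intro that[of a]) auto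
next
  case False
  obtain g :: "complex poly" where g: "degree g = d" "lead_coeff g = 1"
    "\<And>j. coeff (root_poly 0 d) j * E - Const (coeff g j) * E \<in> I" using root_poly_eigen[of 0] by metis
  have "\<not> constant (poly g)" using g(1) by (simp add: constant_degree d_def)
  then obtain a where a: "poly g a = 0" using fundamental_theorem_of_algebra by blast
  have "(\<Sum>j\<le>d. Const (a ^ j) * (coeff (root_poly 0 d) j * E - Const (coeff g j) * E)) \<in> I"
    by (intro submod_sum[OF J] submod_mult[OF J] g(3)) auto
  also have "(\<Sum>j\<le>d. Const (a ^ j) * (coeff (root_poly 0 d) j * E - Const (coeff g j) * E)) =
      (\<Sum>j\<le>d. coeff (root_poly 0 d) j * Const a ^ j) * E - Const (\<Sum>j\<le>d. coeff g j * a ^ j) * E"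
  proof -
    have pw: "Const (a ^ j) = Const a ^ j" for j by (induction j) (simp_all add: Const_mult)
    have "(\<Sum>j\<le>d. Const (a ^ j) * (coeff (root_poly 0 d) j * E - Const (coeff g j) * E)) =
        (\<Sum>j\<le>d. coeff (root_poly 0 d) j * Const a ^ j * E - Const (coeff g j * a ^ j) * E)"
      by (intro sum.cong refl) (simp add: pw Const_mult algebra_simps)
    then show ?thesis by (simp only: sum_subtractf sum_distrib_right Const_sum)
  qed
  also have "(\<Sum>j\<le>d. coeff g j * a ^ j) = 0"
    using a poly_eq_sum_le[of g d a] g(1) by simp
  also have "(\<Sum>j\<le>d. coeff (root_poly 0 d) j * Const a ^ j) = poly (root_poly 0 d) (Const a)"
    by (rule poly_eq_sum_le[OF degree_root_poly, symmetric])
  also have "\<dots> = (\<Prod>i\<in>{1..d}. - shift_var a i)"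
    by (simp add: root_poly_def poly_prod shift_var_def)
  also have "\<dots> = (-1) ^ d * front_prod a" by (simp add: front_prod_def prod_uminus)
  finally have "(-1) ^ d * (front_prod a * E) \<in> I" by (simp add: mult.assoc)
  then have "(-1) ^ d * ((-1) ^ d * (front_prod a * E)) \<in> I"
    by (rule submod_mult[OF J polys_power[OF polys_uminus[OF polys_1]]])
  then have "front_prod a * E \<in> I" by (simp add: mult.assoc[symmetric] power_mult_distrib[symmetric])
  then show ?thesis using False by (intro that[of a]) auto
qed

lemma coeffs_in_IE: "coeffs_in I (smult E (F - G)) \<longleftrightarrow> (\<forall>j. coeff F j * E - coeff G j * E \<in> I)"
  by (simp add: coeffs_in_def algebra_simps)

lemma alternating_relation:
  assumes a: "\<And>j. j \<in> {d<..n} \<Longrightarrow> shift_var a j * E \<in> I" and w: "front_prod a * E \<in> I"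
  obtains bs where "length bs = r"
    "coeffs_in I (smult E (root_poly a n - Polynomial.monom 1 k * const_roots bs))"
proof -
  obtain g :: "complex poly" where g: "degree g = d" "lead_coeff g = 1"
    "\<And>j. coeff (root_poly a d) j * E - Const (coeff g j) * E \<in> I" "coeff g 0 = 0"
    using root_poly_eigen[of a] w by metis
  have outer: "coeffs_in I (smult E (root_poly a (d + m) - Polynomial.monom 1 m * root_poly a d))" if "d + m \<le> n" for m
    using that
  proof (induction m)
    case 0
    then show ?case using coeffs_in_0[OF J] by simp
  next
    case (Suc m)
    let ?y = "shift_var a (Suc (d + m))"
    have "smult E (root_poly a (d + Suc m) - Polynomial.monom 1 (Suc m) * root_poly a d) =
        smult E (root_poly a (d + m) - Polynomial.monom 1 m * root_poly a d) * [:0, 1:] -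
        smult (?y * E) (root_poly a (d + m))"
      by (simp add: root_poly_Suc monom_Suc algebra_simps smult_diff_right smult_add_right)
    moreover have "coeffs_in I (smult E (root_poly a (d + m) - Polynomial.monom 1 m * root_poly a d) * [:0, 1:])"
      using Suc by (intro coeffs_in_mult[OF J] coeffs_in_linear) auto
    moreover have "coeffs_in I (smult (?y * E) (root_poly a (d + m)))"
    proof -
      have "?y * E \<in> I" using Suc.prems by (intro a) auto
      moreover have "coeff (root_poly a (d + m)) i \<in> polys n" for i
        using coeffs_in_root_poly[of "d + m" n a] Suc.prems by (simp add: coeffs_in_def)
      ultimately show ?thesis unfolding coeffs_in_def by (simp add: submod_mult2[OF J])
    qed
    ultimately show ?case using coeffs_in_diff[OF J] by metis
  qed
  have nd: "n = d + (k - 1)" using n k by (simp add: d_def)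
  obtain h where h: "g = [:0, 1:] * h" using g(4) by (metis mult.commute mult_pCons_left add_0_left mult_1 smult_0_left smult_1_left poly_0_coeff_0 dvdE poly_eq_0_iff_dvd minus_zero)
  have "h \<noteq> 0" using h g(1) by (auto simp: d_def)
  then have hd: "degree h = r" "lead_coeff h = 1"
    using g(1,2) unfolding h by (simp_all add: degree_mult_eq lead_coeff_mult d_def)
  obtain bs where bs: "h = (\<Prod>b\<leftarrow>bs. [:- b, 1:])" "length bs = r"
  proof -
    obtain A where A: "size A = degree h" "h = smult (lead_coeff h) (\<Prod>x\<in>#A. [:- x, 1:])"
      using alg_closed_imp_factorization[OF \<open>h \<noteq> 0\<close>] by blast
    obtain bs where "mset bs = A" using ex_mset by blast
    then show ?thesis using A hd by (intro that[of bs]) (auto simp flip: prod_mset_prod_list)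
  qed
  have cr: "coeff (const_roots bs) j = Const (coeff h j)" for j
  proof -
    have "const_roots xs = map_poly Const (\<Prod>b\<leftarrow>xs. [:- b, 1:])" for xs :: "complex list"
    proof (induction xs)
      case Nil then show ?case by (simp add: const_roots_def map_poly_1)
    next
      case (Cons b xs)
      have "map_poly Const ([:- b, 1:] * (\<Prod>b\<leftarrow>xs. [:- b, 1:])) =
          [:- Const b, 1:] * map_poly Const (\<Prod>b\<leftarrow>xs. [:- b, 1:])"
        by (subst map_poly_mult_hom) (simp_all add: Const_add Const_mult map_poly_linear Const_minus)
      then show ?case using Cons by (simp add: const_roots_def del: mult_pCons_left)
    qed
    then show ?thesis using bs(1) by (simp add: coeff_map_poly)
  qed
  have "coeffs_in I (smult E (root_poly a d - [:0, 1:] * const_roots bs))"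
    unfolding coeffs_in_IE
  proof
    fix j
    have "coeff ([:0, 1:] * const_roots bs) j = Const (coeff g j)"
      unfolding h by (cases j) (simp_all add: cr)
    then show "coeff (root_poly a d) j * E - coeff ([:0, 1:] * const_roots bs) j * E \<in> I" using g(3) by simp
  qed
  from coeffs_in_mult[OF J this, of "Polynomial.monom 1 (k - 1)"]
  have "coeffs_in I (smult E (root_poly a d - [:0, 1:] * const_roots bs) * Polynomial.monom 1 (k - 1))"
    by (simp add: coeffs_in_def)
  from coeffs_in_add[OF J outer[of "k - 1"] this] nd
  have "coeffs_in I (smult E (root_poly a n - Polynomial.monom 1 (k - 1) * root_poly a d) +
      smult E (root_poly a d - [:0, 1:] * const_roots bs) * Polynomial.monom 1 (k - 1))" by simp
  also have "smult E (root_poly a n - Polynomial.monom 1 (k - 1) * root_poly a d) +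
      smult E (root_poly a d - [:0, 1:] * const_roots bs) * Polynomial.monom 1 (k - 1) =
      smult E (root_poly a n - Polynomial.monom 1 k * const_roots bs)"
  proof -
    have "Polynomial.monom 1 k = [:0, 1:] * Polynomial.monom (1::mpoly) (k - 1)"
      using k by (cases k) (auto simp: monom_Suc)
    then show ?thesis by (simp only: mult_smult_left smult_add_right[symmetric]) (simp add: algebra_simps)
  qed
  finally show ?thesis using that bs(2) by blast
qed

text \<open>The coefficients of \<open>\<Prod>i\<le>n. s - y\<^sub>i\<close> are invariant, hence constants in the quotient, and the constants can be
  read off from their action on \<open>E\<close>.\<close>

lemma symmetric_relation:
  assumes "coeffs_in I (smult E (root_poly a n - Polynomial.monom 1 k * const_roots bs))"
  shows "coeffs_in I (root_poly a n - Polynomial.monom 1 k * const_roots bs)"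
  unfolding coeffs_in_def
proof
  fix j
  let ?c = "coeff (Polynomial.monom 1 k * const_roots bs :: mpoly poly) j"
  have "coeff (root_poly a n) j \<in> polys n"
    using coeffs_in_root_poly[of n n a] by (simp add: coeffs_in_def)
  moreover have "perm_poly \<sigma> (coeff (root_poly a n) j) = coeff (root_poly a n) j" if "\<sigma> permutes {1..n}" for \<sigma>
    unfolding root_poly_def using that by (intro perm_poly_coeff_linear_prod permutes_bij permutes_image)
  ultimately obtain f where f: "coeff (root_poly a n) j - Const f \<in> I" using invariant_const by blast
  have "\<exists>c. coeff (const_roots xs) i = Const c" for xs :: "complex list" and i
  proof (induction xs arbitrary: i)
    case Nil then show ?case by (cases "i = 0") (auto simp: const_roots_def intro: exI[of _ 1] exI[of _ 0])
  next
    case (Cons b xs)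
    obtain c c' where "coeff (const_roots xs) i = Const c" "coeff (const_roots xs) (i - 1) = Const c'"
      using Cons by blast
    then have "coeff (const_roots (b # xs)) i = Const ((if i = 0 then 0 else c') - b * c)"
      by (cases i) (simp_all add: const_roots_def Const_diff Const_mult Const_minus)
    then show ?case by blast
  qed
  then obtain c where c: "?c = Const c" by (metis Const_0 coeff_monom_mult mult_1)
  have "coeff (root_poly a n) j * E - Const c * E \<in> I"
    using assms unfolding coeffs_in_IE c[symmetric] by blast
  moreover have "E * coeff (root_poly a n) j - E * Const f \<in> I" using submod_cong_mult[OF E_polys f] .
  ultimately have "Const f * E - Const c * E \<in> I"
    using submod_trans submod_sym by (metis mult.commute)
  then have "Const (f - c) * E \<in> I" by (simp only: Const_diff_mult)
  from Const_E[OF this] have "c = f" by simp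
  then show "coeff (root_poly a n - Polynomial.monom 1 k * const_roots bs) j \<in> I" using f c by simp
qed

lemma vandermonde_notin: "vandermonde a d \<notin> I"
proof
  assume v: "vandermonde a d \<in> I"
  obtain q where q: "q \<in> polys n" "E = q * vandermonde a d"
    using alt_multiple_vandermonde[OF d_le P(1), of a] unfolding E_def by blast
  from submod_mult[OF J q(1) v] E_notin show False unfolding q(2) by simp
qed

text \<open>The products of \<open>d\<close> distinct \<open>y\<^sub>i\<close> generate an ideal without alternating classes.\<close>

lemma alt_product_mem:
  assumes a: "\<And>j. j \<in> {d<..n} \<Longrightarrow> shift_var a j * E \<in> I" and w: "front_prod a * E \<in> I"
    and S: "S \<subseteq> {1..n}" "card S = d" and q: "q \<in> polys n"
  shows "alt d (q * (\<Prod>i\<in>S. shift_var a i)) \<in> I"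
proof -
  have fin: "finite S" using S(1) finite_subset by blast
  have key: "s * alt d q' \<in> I" if s: "s \<in> polys n" "s * E \<in> I" and q': "q' \<in> polys n" for s q'
  proof -
    obtain c where "alt d q' - Const c * E \<in> I" using antisym_multiple[OF antisym_alt[OF q']] .
    from submod_cong_mult[OF s(1) this] show ?thesis
      using submod_mult[OF J polys_Const s(2), of c] submod_cong_mem by (metis mult.left_commute)
  qed
  show ?thesis
  proof (cases "S = {1..d}")
    case True
    have "alt d (front_prod a * q) = front_prod a * alt d q" by (rule alt_sym_mult) (rule front_prod_sym)
    then show ?thesis using key[OF front_prod_polys w q] True by (simp add: front_prod_def mult.commute)
  next
    case False
    have "\<not> S \<subseteq> {1..d}" using False S(2) card_seteq[of "{1..d}" S] by auto
    then obtain j where j: "j \<in> S" "j \<in> {d<..n}" using S(1) by force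
    let ?q = "q * (\<Prod>i\<in>S - {j}. shift_var a i)"
    have q': "?q \<in> polys n" using q S(1) by (intro polys_mult polys_prod polys_shift_var) auto
    have eq: "q * (\<Prod>i\<in>S. shift_var a i) = shift_var a j * ?q"
      using fin j(1) by (subst prod.remove[of _ j]) (auto simp: mult_ac)
    have "perm_poly \<sigma> (shift_var a j) = shift_var a j" if \<sigma>: "\<sigma> permutes {1..d}" for \<sigma>
      using j(2) permutes_not_in[OF \<sigma>, of j] permutes_bij[OF \<sigma>] by (simp add: perm_poly_shift_var)
    then have alt: "alt d (shift_var a j * ?q) = shift_var a j * alt d ?q" by (rule alt_sym_mult)
    have "shift_var a j \<in> polys n" using j(2) by (intro polys_shift_var) auto
    from key[OF this a[OF j(2)] q'] show ?thesis unfolding eq alt .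
  qed
qed

text \<open>The largest stable ideal whose elements all alternate to zero in the first \<open>d\<close> variables modulo \<open>I\<close>.\<close>

definition alt_core :: "mpoly set" where
  "alt_core = {p \<in> polys n. \<forall>q\<in>polys n. \<forall>\<sigma>. \<sigma> permutes {1..n} \<longrightarrow> alt d (q * perm_poly \<sigma> p) \<in> I}"

lemma alt_core_submod: "submod n alt_core"
  unfolding submod_def
proof (intro conjI ballI)
  show "0 \<in> alt_core"
    unfolding alt_core_def by (simp add: perm_poly_0 permutes_bij submod_0[OF J])
  fix p q assume "p \<in> alt_core" "q \<in> alt_core"
  then show "p + q \<in> alt_core"
    unfolding alt_core_def
    by (auto simp: polys_add perm_poly_add permutes_bij distrib_left alt_add submod_add[OF J])
next
  fix q p :: mpoly assume q: "q \<in> polys n" and p: "p \<in> alt_core"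
  show "q * p \<in> alt_core"
    unfolding alt_core_def
  proof (intro CollectI conjI ballI allI impI)
    show "q * p \<in> polys n" using p q by (simp add: alt_core_def polys_mult)
    fix q' :: mpoly and \<sigma> assume q': "q' \<in> polys n" and \<sigma>: "\<sigma> permutes {1..n}"
    have "q' * perm_poly \<sigma> q \<in> polys n" using q q' perm_poly_polys[OF \<sigma>] by (intro polys_mult) auto
    then have "alt d ((q' * perm_poly \<sigma> q) * perm_poly \<sigma> p) \<in> I" using p \<sigma> by (simp add: alt_core_def)
    then show "alt d (q' * perm_poly \<sigma> (q * p)) \<in> I"
      using permutes_bij[OF \<sigma>] by (simp add: perm_poly_mult mult.assoc)
  qed
qed

lemma alt_core_stable: "stable n alt_core"
  unfolding stable_def
proof (intro allI impI)
  fix \<sigma> p assume \<sigma>: "\<sigma> permutes {1..n}" and p: "p \<in> alt_core"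
  show "perm_poly \<sigma> p \<in> alt_core"
    unfolding alt_core_def
  proof (intro CollectI conjI ballI allI impI)
    show "perm_poly \<sigma> p \<in> polys n" using p perm_poly_polys[OF \<sigma>] by (simp add: alt_core_def)
    fix q :: mpoly and \<tau> assume q: "q \<in> polys n" and \<tau>: "\<tau> permutes {1..n}"
    have "\<tau> \<circ> \<sigma> permutes {1..n}" using \<sigma> \<tau> by (rule permutes_compose)
    then have "alt d (q * perm_poly (\<tau> \<circ> \<sigma>) p) \<in> I" using p q unfolding alt_core_def by blast
    then show "alt d (q * perm_poly \<tau> (perm_poly \<sigma> p)) \<in> I"
      using permutes_bij[OF \<sigma>] permutes_bij[OF \<tau>] by (simp add: perm_poly_comp)
  qed
qed

lemma alt_core_superset: "I \<subseteq> alt_core"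
proof
  fix p assume p: "p \<in> I"
  show "p \<in> alt_core"
    unfolding alt_core_def
  proof (intro CollectI conjI ballI allI impI)
    show "p \<in> polys n" using p sub by blast
    fix q :: mpoly and \<sigma> assume q: "q \<in> polys n" and \<sigma>: "\<sigma> permutes {1..n}"
    show "alt d (q * perm_poly \<sigma> p) \<in> I"
      using submod_mult[OF J q stableD[OF \<sigma> p]] by (rule alt_in_stable[OF J stab d_le])
  qed
qed

lemma vandermonde_notin_core: "vandermonde a d \<notin> alt_core"
proof
  assume "vandermonde a d \<in> alt_core"
  then have "alt d (1 * perm_poly id (vandermonde a d)) \<in> I"
    unfolding alt_core_def using permutes_id polys_1 by blast
  moreover have "alt d (vandermonde a d) = Const (fact d) * vandermonde a d"
    by (rule alt_of_antisym, rule vandermonde_antisym)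
  ultimately have "Const (fact d) * vandermonde a d \<in> I" by simp
  then show False using submod_cancel_Const[OF J] vandermonde_notin by force
qed

text \<open>The ideal \<open>alt_core\<close> contains \<open>I\<close> and satisfies the hook relations, but does not contain the Vandermonde determinant; so the
  hook monomials are independent modulo it. As there are at least \<open>N\<close> of them, they span modulo
  \<open>I\<close> already, and the two ideals agree.\<close>

theorem hook_relations_hold:
  assumes dim: "has_dim (quot_rep n I) N" and card: "N \<le> card (hook_monoms k r)"
  obtains a bs where "length bs = r" "hook_relations a bs k I 1"
    "\<And>s. Poly_Mapping.keys s \<subseteq> hook_monoms k r \<Longrightarrow> s \<in> I \<Longrightarrow> s = 0" "card (hook_monoms k r) = N"
proof -
  obtain a where a: "\<And>j. j \<in> {d<..n} \<Longrightarrow> shift_var a j * E \<in> I" and w: "front_prod a * E \<in> I"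
    using head_value by blast
  obtain bs where bs: "length bs = r"
    "coeffs_in I (smult E (root_poly a n - Polynomial.monom 1 k * const_roots bs))"
    using alternating_relation[OF a w] by blast
  have T1: "coeffs_in I (root_poly a n - Polynomial.monom 1 k * const_roots bs)"
    by (rule symmetric_relation[OF bs(2)])
  have rel: "hook_relations a bs k alt_core 1"
    unfolding hook_relations_def bs(1) n[symmetric]
  proof (intro conjI allI impI)
    show "coeffs_in alt_core (smult 1 (root_poly a n - Polynomial.monom 1 k * const_roots bs))"
      using T1 alt_core_superset by (auto simp: coeffs_in_def)
    fix S assume S: "S \<subseteq> {1..n}" "card S = Suc r"
    have "(\<Prod>i\<in>S. shift_var a i) \<in> alt_core"
      unfolding alt_core_def
    proof (intro CollectI conjI ballI allI impI)
      show "(\<Prod>i\<in>S. shift_var a i) \<in> polys n" using S by (intro polys_prod polys_shift_var) auto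
      fix q :: mpoly and \<sigma> assume q: "q \<in> polys n" and \<sigma>: "\<sigma> permutes {1..n}"
      have inj: "inj_on \<sigma> S" using permutes_inj[OF \<sigma>] inj_on_subset by blast
      have "perm_poly \<sigma> (\<Prod>i\<in>S. shift_var a i) = (\<Prod>i\<in>\<sigma> ` S. shift_var a i)"
        using permutes_bij[OF \<sigma>] prod.reindex[OF inj, of "shift_var a"]
        by (simp add: perm_poly_prod perm_poly_shift_var comp_def)
      moreover have "\<sigma> ` S \<subseteq> {1..n}" using S(1) permutes_image[OF \<sigma>] by blast
      moreover have "card (\<sigma> ` S) = d" using S(2) card_image[OF inj] by (simp add: d_def)
      ultimately show "alt d (q * perm_poly \<sigma> (\<Prod>i\<in>S. shift_var a i)) \<in> I"
        using alt_product_mem[OF a w _ _ q, of "\<sigma> ` S"] by simp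
    qed
    then show "1 * (\<Prod>i\<in>S. shift_var a i) \<in> alt_core" by simp
  qed
  have num: "num_layers k r = d" using k by (simp add: num_layers_def d_def)
  have ind: "s = 0" if "Poly_Mapping.keys s \<subseteq> hook_monoms k r" "s \<in> alt_core" for s
  proof (rule hook_monoms_indep[OF bs(1) _ _ _ rel])
    show "submod (k + r) alt_core" using alt_core_submod n by simp
    show "stable (k + r) alt_core" using alt_core_stable n by simp
    show "perm_poly \<sigma> 1 = 1" if "\<sigma> permutes {1..k + r}" for \<sigma> using that by (simp add: perm_poly_1 permutes_bij)
    show "1 * vandermonde a (num_layers k r) \<notin> alt_core" using vandermonde_notin_core num by simp
  qed (use that in auto)
  have indI: "s = 0" if "Poly_Mapping.keys s \<subseteq> hook_monoms k r" "s \<in> I" for s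
    using ind that alt_core_superset by blast
  have B: "finite (hook_monoms k r)" "hook_monoms k r \<subseteq> monoms n"
    using finite_hook_monoms hook_monoms_monoms n by auto
  have "alt_core \<subseteq> I"
  proof
    fix p assume p: "p \<in> alt_core"
    then have "p \<in> polys n" by (simp add: alt_core_def)
    then obtain s where s: "Poly_Mapping.keys s \<subseteq> hook_monoms k r" "p - s \<in> I"
      using quot_indep_span[OF sub J dim B indI card] by blast
    have "p - (p - s) \<in> alt_core"
      by (rule submod_diff[OF alt_core_submod p subsetD[OF alt_core_superset s(2)]])
    then have "s = 0" using ind[OF s(1)] by simp
    then show "p \<in> I" using s(2) by simp
  qed
  then have "alt_core = I" using alt_core_superset by blast
  with rel have "hook_relations a bs k I 1" by simp
  moreover have "card (hook_monoms k r) = N"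
    using quot_indep_card[OF sub J dim B indI] card by simp
  ultimately show ?thesis using that[OF bs(1) _ indI] by simp
qed

end


section \<open>Generic orbits\<close>

lemma poly_eval_Const: "poly_eval v (Const c) = c"
  by (simp add: Const_def poly_eval_single monom_eval_def)

lemma poly_eval_Var: "poly_eval v (Var i) = v i"
  by (simp add: Var_def poly_eval_single monom_eval_def)

lemma poly_eval_diff: "poly_eval v (p - q) = poly_eval v p - poly_eval v q"
  by (metis poly_eval_add add_diff_cancel diff_add_cancel)

lemma poly_eval_uminus: "poly_eval v (- p) = - poly_eval v p"
  using poly_eval_diff[of v 0 p] by (simp add: poly_eval_zero)

lemma poly_eval_prod: "poly_eval v (prod f A) = (\<Prod>a\<in>A. poly_eval v (f a))"
  by (induction A rule: infinite_finite_induct) (simp_all add: poly_eval_one poly_eval_mult)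

lemma poly_eval_shift_var: "poly_eval v (shift_var a i) = v i - a"
  by (simp add: shift_var_def poly_eval_diff poly_eval_Var poly_eval_Const)

lemma poly_eval_perm_poly:
  assumes "bij \<sigma>" "p \<in> polys n"
  shows "poly_eval v (perm_poly \<sigma> p) = poly_eval (v \<circ> \<sigma>) p"
  using assms(2)
  by (induction p rule: polys_induct)
    (simp_all add: assms(1) perm_poly_Const perm_poly_add perm_poly_mult perm_poly_Var
      poly_eval_Const poly_eval_add poly_eval_mult poly_eval_Var)

text \<open>Finitely many points separated by their first \<open>n\<close> coordinates impose independent conditions (Lagrange).\<close>

lemma interpolation:
  assumes fin: "finite V" and sep: "\<And>v w. v \<in> V \<Longrightarrow> w \<in> V \<Longrightarrow> v \<noteq> w \<Longrightarrow> \<exists>i\<in>{1..n}. v i \<noteq> w i"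
  shows "\<exists>p\<in>polys n. \<forall>v\<in>V. poly_eval v p = F v"
proof -
  have "\<forall>v\<in>V. \<forall>w\<in>V. \<exists>i. v \<noteq> w \<longrightarrow> i \<in> {1..n} \<and> v i \<noteq> w i" using sep by blast
  then obtain f where f: "\<And>v w. v \<in> V \<Longrightarrow> w \<in> V \<Longrightarrow> v \<noteq> w \<Longrightarrow> f v w \<in> {1..n} \<and> v (f v w) \<noteq> w (f v w)"
    by metis
  define L where "L v = (\<Prod>w\<in>V - {v}. Const (1 / (v (f v w) - w (f v w))) * (Var (f v w) - Const (w (f v w))))" for v
  have L: "L v \<in> polys n" if "v \<in> V" for v
    unfolding L_def using f that by (intro polys_prod polys_mult polys_diff polys_Const polys_Var) blast
  have ev: "poly_eval u (L v) = (if u = v then 1 else 0)" if "u \<in> V" "v \<in> V" for u v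
  proof -
    have e: "poly_eval u (L v) = (\<Prod>w\<in>V - {v}. (1 / (v (f v w) - w (f v w))) * (u (f v w) - w (f v w)))"
      by (simp add: L_def poly_eval_prod poly_eval_mult poly_eval_Const poly_eval_diff poly_eval_Var)
    show ?thesis
    proof (cases "u = v")
      case True
      have "(1 / (v (f v w) - w (f v w))) * (v (f v w) - w (f v w)) = 1" if "w \<in> V - {v}" for w
        using f[of v w] that \<open>v \<in> V\<close> by auto
      then have "(\<Prod>w\<in>V - {v}. (1 / (v (f v w) - w (f v w))) * (v (f v w) - w (f v w))) = 1"
        by (intro prod.neutral) blast
      then show ?thesis unfolding e unfolding True by simp
    next
      case False
      then show ?thesis unfolding e using that fin by (auto intro!: prod_zero bexI[of _ u])
    qed
  qed
  have "poly_eval u (\<Sum>v\<in>V. Const (F v) * L v) = F u" if u: "u \<in> V" for u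
  proof -
    have "poly_eval u (\<Sum>v\<in>V. Const (F v) * L v) = (\<Sum>v\<in>V. F v * (if u = v then 1 else 0))"
      unfolding poly_eval_sum using ev[OF u] by (intro sum.cong) (auto simp: poly_eval_mult poly_eval_Const)
    also have "\<dots> = F u" using fin u by (simp add: if_distrib cong: if_cong)
    finally show ?thesis .
  qed
  moreover have "(\<Sum>v\<in>V. Const (F v) * L v) \<in> polys n"
    by (intro polys_sum polys_mult polys_Const L)
  ultimately show ?thesis by blast
qed

text \<open>The point \<open>(a, \<dots>, a, c\<^sub>1, \<dots>, c\<^sub>r)\<close> and the vanishing ideal of its orbit.\<close>

definition base_point :: "nat \<Rightarrow> complex \<Rightarrow> complex list \<Rightarrow> nat \<Rightarrow> complex" where
  "base_point k a cs i = (if i \<le> k then a else cs ! (i - Suc k))"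

definition orbit_ideal :: "nat \<Rightarrow> nat \<Rightarrow> complex \<Rightarrow> complex list \<Rightarrow> mpoly set" where
  "orbit_ideal k n a cs = {p \<in> polys n. \<forall>\<tau>. \<tau> permutes {1..n} \<longrightarrow> poly_eval (base_point k a cs \<circ> inv' \<tau>) p = 0}"

lemma orbit_ideal_submod: "submod n (orbit_ideal k n a cs)" and orbit_ideal_sub: "orbit_ideal k n a cs \<subseteq> polys n"
  by (auto simp: submod_def orbit_ideal_def polys_add polys_mult poly_eval_add poly_eval_mult poly_eval_zero)

lemma orbit_perm:
  assumes "\<sigma> permutes {1..n}" "\<tau> permutes {1..n}" "p \<in> polys n"
  shows "poly_eval (f \<circ> inv' \<tau>) (perm_poly \<sigma> p) = poly_eval (f \<circ> inv' (inv' \<sigma> \<circ> \<tau>)) p"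
proof -
  have "inv' (inv' \<sigma> \<circ> \<tau>) = inv' \<tau> \<circ> \<sigma>"
    using o_inv_distrib[OF permutes_bij[OF permutes_inv[OF assms(1)]] permutes_bij[OF assms(2)]]
    by (simp add: permutes_inv_inv[OF assms(1)])
  then show ?thesis using poly_eval_perm_poly[OF permutes_bij[OF assms(1)] assms(3), of "f \<circ> inv' \<tau>"]
    by (simp add: comp_assoc)
qed

lemma orbit_ideal_stable:
  assumes \<sigma>: "\<sigma> permutes {1..n}"
  shows "perm_poly \<sigma> ` orbit_ideal k n a cs = orbit_ideal k n a cs"
proof -
  have sub: "perm_poly \<rho> p \<in> orbit_ideal k n a cs" if \<rho>: "\<rho> permutes {1..n}" and p: "p \<in> orbit_ideal k n a cs" for \<rho> p
  proof -
    have pP: "p \<in> polys n" using p by (simp add: orbit_ideal_def)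
    have "poly_eval (base_point k a cs \<circ> inv' \<tau>) (perm_poly \<rho> p) = 0" if \<tau>: "\<tau> permutes {1..n}" for \<tau>
    proof -
      have "inv' \<rho> \<circ> \<tau> permutes {1..n}" using \<tau> permutes_inv[OF \<rho>] by (rule permutes_compose)
      then show ?thesis using p unfolding orbit_perm[OF \<rho> \<tau> pP] orbit_ideal_def by blast
    qed
    then show ?thesis using perm_poly_polys[OF \<rho> pP] by (simp add: orbit_ideal_def)
  qed
  show ?thesis
  proof (intro equalityI subsetI)
    fix p assume p: "p \<in> orbit_ideal k n a cs"
    have "p = perm_poly \<sigma> (perm_poly (inv' \<sigma>) p)"
      using permutes_bij[OF \<sigma>] permutes_bij[OF permutes_inv[OF \<sigma>]] permutes_inv_o(1)[OF \<sigma>]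
      by (simp add: perm_poly_comp)
    then show "p \<in> perm_poly \<sigma> ` orbit_ideal k n a cs" using sub[OF permutes_inv[OF \<sigma>] p] by blast
  qed (use sub[OF \<sigma>] in blast)
qed

lemma base_point_translate:
  assumes n: "n = k + length cs" and \<tau>: "\<tau> permutes {1..n}" "\<tau>' permutes {1..n}"
    and eq: "\<And>i. i \<in> {k<..n} \<Longrightarrow> \<tau> i = \<tau>' i"
  shows "base_point k a cs \<circ> inv' \<tau> = base_point k a cs \<circ> inv' \<tau>'"
proof
  fix x
  have sub: "inv' \<rho> x \<in> {k<..n} \<Longrightarrow> inv' \<rho>' x = inv' \<rho> x"
    if "\<rho> permutes {1..n}" "\<rho>' permutes {1..n}" "\<And>i. i \<in> {k<..n} \<Longrightarrow> \<rho> i = \<rho>' i" for \<rho> \<rho>'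
    using that permutes_inverses by metis
  show "(base_point k a cs \<circ> inv' \<tau>) x = (base_point k a cs \<circ> inv' \<tau>') x"
  proof (cases "inv' \<tau> x \<in> {k<..n} \<or> inv' \<tau>' x \<in> {k<..n}")
    case True
    have "inv' \<tau>' x = inv' \<tau> x" using True
    proof
      assume "inv' \<tau> x \<in> {k<..n}"
      then show ?thesis using sub[OF \<tau> eq] by simp
    next
      assume "inv' \<tau>' x \<in> {k<..n}"
      then show ?thesis using sub[OF \<tau>(2,1)] eq by simp
    qed
    then show ?thesis by simp
  next
    case False
    show ?thesis
    proof (cases "x \<in> {1..n}")
      case True
      then have "inv' \<tau> x \<in> {1..n}" "inv' \<tau>' x \<in> {1..n}"
        using permutes_in_image[OF permutes_inv[OF \<tau>(1)]] permutes_in_image[OF permutes_inv[OF \<tau>(2)]] by blast+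
      then have "inv' \<tau> x \<le> k" "inv' \<tau>' x \<le> k" using False by auto
      then show ?thesis by (simp add: base_point_def)
    next
      case False
      then show ?thesis
        using permutes_not_in[OF permutes_inv[OF \<tau>(1)] False] permutes_not_in[OF permutes_inv[OF \<tau>(2)] False] by simp
    qed
  qed
qed

lemma orbit_model:
  assumes n: "n = k + length cs" and dist: "distinct (a # cs)"
  shows "coset_model k n (orbit_ideal k n a cs) (\<lambda>p \<tau>. poly_eval (base_point k a cs \<circ> inv' \<tau>) p)"
proof -
  let ?z = "base_point k a cs"
  have zinj: "i = j" if "i \<in> {k<..n}" "j \<in> {1..n}" "?z i = ?z j" for i j
  proof (cases "j \<le> k")
    case True
    have "i - Suc k < length cs" using that(1) n by auto
    then have "?z i \<in> set cs" using that(1) by (simp add: base_point_def)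
    then show ?thesis using that(3) True dist by (simp add: base_point_def)
  next
    case False
    have *: "i - Suc k < length cs" "j - Suc k < length cs" using that(1,2) False n by auto
    have "cs ! (i - Suc k) = cs ! (j - Suc k)" using that(1,3) False by (simp add: base_point_def)
    then have "i - Suc k = j - Suc k" using dist * by (simp add: nth_eq_iff_index_eq)
    then show ?thesis using that(1) False by auto
  qed
  have agree: "\<tau> i = \<tau>' i"
    if "\<tau> permutes {1..n}" "\<tau>' permutes {1..n}" "i \<in> {k<..n}"
      "\<And>x. x \<in> {1..n} \<Longrightarrow> (?z \<circ> inv' \<tau>) x = (?z \<circ> inv' \<tau>') x" for \<tau> \<tau>' i
  proof -
    have i: "i \<in> {1..n}" using that(3) by auto
    then have \<tau>i: "\<tau> i \<in> {1..n}" using permutes_in_image[OF that(1)] by blast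
    then have "inv' \<tau>' (\<tau> i) \<in> {1..n}" using permutes_in_image[OF permutes_inv[OF that(2)]] by blast
    moreover have "?z i = ?z (inv' \<tau>' (\<tau> i))" using that(4)[OF \<tau>i] permutes_inverses(2)[OF that(1)] by simp
    ultimately have "i = inv' \<tau>' (\<tau> i)" using zinj[OF that(3)] by blast
    then show ?thesis using permutes_inverses(1)[OF that(2)] by metis
  qed
  have surj: "\<exists>p\<in>polys n. \<forall>\<tau>. \<tau> permutes {1..n} \<longrightarrow> poly_eval (?z \<circ> inv' \<tau>) p = f \<tau>"
    if f: "\<forall>\<tau> \<tau>'. \<tau> permutes {1..n} \<longrightarrow> \<tau>' permutes {1..n} \<longrightarrow> (\<forall>i\<in>{k<..n}. \<tau> i = \<tau>' i) \<longrightarrow> f \<tau> = f \<tau>'"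
    for f :: "(nat \<Rightarrow> nat) \<Rightarrow> complex"
  proof -
    define V where "V = (\<lambda>\<tau>. ?z \<circ> inv' \<tau>) ` {\<tau>. \<tau> permutes {1..n}}"
    define F where "F v = f (SOME \<tau>. \<tau> permutes {1..n} \<and> v = ?z \<circ> inv' \<tau>)" for v
    have "\<exists>p\<in>polys n. \<forall>v\<in>V. poly_eval v p = F v"
    proof (rule interpolation)
      show "finite V" by (simp add: V_def finite_permutations)
      fix v w assume "v \<in> V" "w \<in> V" "v \<noteq> w"
      then obtain \<tau> \<tau>' where \<tau>: "\<tau> permutes {1..n}" "\<tau>' permutes {1..n}" "v = ?z \<circ> inv' \<tau>" "w = ?z \<circ> inv' \<tau>'"
        by (auto simp: V_def)
      show "\<exists>i\<in>{1..n}. v i \<noteq> w i"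
      proof (rule ccontr)
        assume "\<not> (\<exists>i\<in>{1..n}. v i \<noteq> w i)"
        then have "\<tau> i = \<tau>' i" if "i \<in> {k<..n}" for i using \<tau>(3,4) by (intro agree[OF \<tau>(1,2) that]) auto
        from base_point_translate[OF n \<tau>(1,2) this] show False using \<tau>(3,4) \<open>v \<noteq> w\<close> by simp
      qed
    qed
    then obtain p where p: "p \<in> polys n" "\<And>v. v \<in> V \<Longrightarrow> poly_eval v p = F v" by blast
    have "poly_eval (?z \<circ> inv' \<tau>) p = f \<tau>" if \<tau>: "\<tau> permutes {1..n}" for \<tau>
    proof -
      let ?\<rho> = "SOME \<rho>. \<rho> permutes {1..n} \<and> ?z \<circ> inv' \<tau> = ?z \<circ> inv' \<rho>"
      have \<rho>: "?\<rho> permutes {1..n} \<and> ?z \<circ> inv' \<tau> = ?z \<circ> inv' ?\<rho>"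
        by (rule someI[of "\<lambda>\<rho>. \<rho> permutes {1..n} \<and> ?z \<circ> inv' \<tau> = ?z \<circ> inv' \<rho>" \<tau>]) (simp add: \<tau>)
      have ag: "\<forall>i\<in>{k<..n}. ?\<rho> i = \<tau> i"
        by (intro ballI agree[OF conjunct1[OF \<rho>] \<tau>]) (simp_all only: conjunct2[OF \<rho>, symmetric])
      have "f ?\<rho> = f \<tau>" using f[rule_format, OF conjunct1[OF \<rho>] \<tau>] ag by blast
      moreover have "?z \<circ> inv' \<tau> \<in> V" using \<tau> by (auto simp: V_def)
      ultimately show ?thesis using p(2) by (simp add: F_def)
    qed
    then show ?thesis using p(1) by blast
  qed
  show ?thesis
    unfolding coset_model_def
  proof (intro conjI ballI allI impI)
    fix p \<tau> \<tau>' assume "\<tau> permutes {1..n}" "\<tau>' permutes {1..n}" "\<forall>i\<in>{k<..n}. \<tau> i = \<tau>' i"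
    then show "poly_eval (?z \<circ> inv' \<tau>) p = poly_eval (?z \<circ> inv' \<tau>') p"
      using base_point_translate[OF n, of \<tau> \<tau>' a] by simp
  next
    fix f :: "(nat \<Rightarrow> nat) \<Rightarrow> complex"
    assume "\<forall>\<tau> \<tau>'. \<tau> permutes {1..n} \<longrightarrow> \<tau>' permutes {1..n} \<longrightarrow> (\<forall>i\<in>{k<..n}. \<tau> i = \<tau>' i) \<longrightarrow> f \<tau> = f \<tau>'"
    then show "\<exists>p\<in>polys n. \<forall>\<tau>. \<tau> permutes {1..n} \<longrightarrow> poly_eval (?z \<circ> inv' \<tau>) p = f \<tau>" by (rule surj)
  next
    fix p :: mpoly and \<sigma> \<tau> assume "p \<in> polys n" "\<sigma> permutes {1..n}" "\<tau> permutes {1..n}"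
    then show "poly_eval (?z \<circ> inv' \<tau>) (perm_poly \<sigma> p) = poly_eval (?z \<circ> inv' (inv' \<sigma> \<circ> \<tau>)) p"
      by (intro orbit_perm)
  qed (simp_all add: poly_eval_add poly_eval_mult poly_eval_Const orbit_ideal_def)
qed

lemma map_poly_eval_linear_prod:
  "map_poly (poly_eval v) (\<Prod>i\<in>A. [:- shift_var a i, 1:]) = (\<Prod>i\<in>A. [:a - v i, 1:])"
  by (subst map_poly_prod_hom)
    (simp_all add: poly_eval_zero poly_eval_one poly_eval_add poly_eval_mult map_poly_linear
      poly_eval_uminus poly_eval_shift_var)

lemma map_poly_const_roots:
  fixes h :: "'a::comm_ring_1 mp \<Rightarrow> 'b::comm_ring_1"
  assumes "h 0 = 0" "h 1 = 1" "\<And>x y. h (x + y) = h x + h y" "\<And>x y. h (x * y) = h x * h y"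
    "\<And>x. h (- x) = - h x"
  shows "map_poly h (const_roots bs) = (\<Prod>b\<leftarrow>bs. [:- h (Const b), 1:])"
proof (induction bs)
  case Nil
  then show ?case using assms by (simp add: const_roots_def map_poly_1)
next
  case (Cons b bs)
  have "const_roots (b # bs) = [:- Const b, 1:] * const_roots bs" by (simp add: const_roots_def)
  then have "map_poly h (const_roots (b # bs)) = map_poly h [:- Const b, 1:] * map_poly h (const_roots bs)"
    using assms by (simp only:) (rule map_poly_mult_hom)
  then show ?case using Cons assms by (simp add: map_poly_linear del: mult_pCons_left)
qed

lemma orbit_relations:
  assumes n: "n = k + length cs"
  shows "hook_relations a (map (\<lambda>c. c - a) cs) k (orbit_ideal k n a cs) 1"
proof -
  let ?z = "base_point k a cs"
  let ?bs = "map (\<lambda>c. c - a) cs"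
  let ?F = "root_poly a n - Polynomial.monom 1 k * const_roots ?bs"
  have Fz: "poly_eval (?z \<circ> inv' \<tau>) (coeff ?F i) = 0" if \<tau>: "\<tau> permutes {1..n}" for \<tau> i
  proof -
    let ?v = "?z \<circ> inv' \<tau>"
    have inv: "inv' \<tau> permutes {1..n}" using \<tau> by (rule permutes_inv)
    have "map_poly (poly_eval ?v) (root_poly a n) = (\<Prod>i\<in>{1..n}. [:a - ?z (inv' \<tau> i), 1:])"
      unfolding root_poly_def map_poly_eval_linear_prod by simp
    also have "\<dots> = (\<Prod>i\<in>{1..n}. [:a - ?z i, 1:])"
      using prod.permute[OF inv, of "\<lambda>i. [:a - ?z i, 1:]"] by (simp add: comp_def)
    also have "{1..n} = {1..k} \<union> {k<..n}" using n by auto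
    also have "(\<Prod>i\<in>{1..k} \<union> {k<..n}. [:a - ?z i, 1:]) =
        (\<Prod>i\<in>{1..k}. [:a - ?z i, 1:]) * (\<Prod>i\<in>{k<..n}. [:a - ?z i, 1:])"
      by (intro prod.union_disjoint) auto
    also have "(\<Prod>i\<in>{1..k}. [:a - ?z i, 1:]) = [:0, 1:] ^ k"
      by (simp add: base_point_def)
    also have "\<dots> = Polynomial.monom 1 k" by (induction k) (simp_all add: monom_Suc monom_0)
    also have "(\<Prod>i\<in>{k<..n}. [:a - ?z i, 1:]) = (\<Prod>l<length cs. [:- (cs ! l - a), 1:])"
      using n by (intro prod.reindex_bij_witness[of _ "\<lambda>l. Suc (k + l)" "\<lambda>i. i - Suc k"]) (auto simp: base_point_def)
    also have "\<dots> = (\<Prod>b\<leftarrow>?bs. [:- b, 1:])"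
      by (simp add: prod.list_conv_set_nth comp_def atLeast0LessThan)
    finally have 1: "map_poly (poly_eval ?v) (root_poly a n) = Polynomial.monom 1 k * (\<Prod>b\<leftarrow>?bs. [:- b, 1:])" .
    have "map_poly (poly_eval ?v) (const_roots ?bs) = (\<Prod>b\<leftarrow>?bs. [:- b, 1:])"
      by (subst map_poly_const_roots)
        (simp_all add: poly_eval_zero poly_eval_one poly_eval_add poly_eval_mult poly_eval_uminus poly_eval_Const)
    moreover have "map_poly (poly_eval ?v) (Polynomial.monom 1 k * const_roots ?bs) =
        map_poly (poly_eval ?v) (Polynomial.monom 1 k) * map_poly (poly_eval ?v) (const_roots ?bs)"
      by (rule map_poly_mult_hom) (simp_all add: poly_eval_zero poly_eval_add poly_eval_mult)
    moreover have "map_poly (poly_eval ?v) (Polynomial.monom 1 k) = Polynomial.monom 1 k"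
      by (simp add: map_poly_monom poly_eval_zero poly_eval_one)
    ultimately have "map_poly (poly_eval ?v) (root_poly a n) = map_poly (poly_eval ?v) (Polynomial.monom 1 k * const_roots ?bs)"
      using 1 by simp
    then have "coeff (map_poly (poly_eval ?v) (root_poly a n)) i =
        coeff (map_poly (poly_eval ?v) (Polynomial.monom 1 k * const_roots ?bs)) i" by simp
    then show ?thesis by (simp add: coeff_map_poly poly_eval_zero poly_eval_diff)
  qed
  have "coeffs_in (polys n) ?F"
  proof (intro coeffs_in_diff[OF submod_polys] coeffs_in_root_poly order_refl)
    have "coeffs_in (polys n) (const_roots bs)" for bs :: "complex list"
    proof (induction bs)
      case Nil then show ?case by (simp add: const_roots_def coeffs_in_def one_pCons coeff_pCons split: nat.split)
    next
      case (Cons b bs)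
      have "coeffs_in (polys n) ([:- Const b, 1:] * const_roots bs)"
        by (intro coeffs_in_mult[OF submod_polys] coeffs_in_linear polys_uminus polys_Const Cons)
      then show ?case by (simp add: const_roots_def)
    qed
    then show "coeffs_in (polys n) (Polynomial.monom 1 k * const_roots ?bs)"
      by (intro coeffs_in_mult[OF submod_polys]) (auto simp: coeffs_in_def)
  qed
  then have T1: "coeffs_in (orbit_ideal k n a cs) (smult 1 ?F)"
    using Fz by (simp add: coeffs_in_def orbit_ideal_def)
  have T2: "(\<Prod>i\<in>S. shift_var a i) \<in> orbit_ideal k n a cs" if S: "S \<subseteq> {1..n}" "card S = Suc (length cs)" for S
    unfolding orbit_ideal_def
  proof (intro CollectI conjI allI impI)
    show "(\<Prod>i\<in>S. shift_var a i) \<in> polys n" using S(1) by (intro polys_prod polys_shift_var) auto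
    fix \<tau> assume \<tau>: "\<tau> permutes {1..n}"
    have fin: "finite S" using S(1) finite_subset by blast
    have "\<not> S \<subseteq> \<tau> ` {k<..n}"
    proof
      assume "S \<subseteq> \<tau> ` {k<..n}"
      then have "card S \<le> card (\<tau> ` {k<..n})" by (intro card_mono) auto
      also have "\<dots> \<le> card {k<..n}" by (intro card_image_le) auto
      finally show False using S(2) n by simp
    qed
    then obtain i where i: "i \<in> S" "i \<notin> \<tau> ` {k<..n}" by blast
    have "inv' \<tau> i \<in> {1..n}" using i(1) S(1) permutes_in_image[OF permutes_inv[OF \<tau>]] by blast
    moreover have "inv' \<tau> i \<notin> {k<..n}"
    proof
      assume "inv' \<tau> i \<in> {k<..n}"
      then have "\<tau> (inv' \<tau> i) \<in> \<tau> ` {k<..n}" by (rule imageI)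
      then show False using i(2) permutes_inverses(1)[OF \<tau>] by simp
    qed
    ultimately have "?z (inv' \<tau> i) = a" by (simp add: base_point_def)
    then show "poly_eval (?z \<circ> inv' \<tau>) (\<Prod>i\<in>S. shift_var a i) = 0"
      using i(1) fin by (auto simp: poly_eval_prod poly_eval_shift_var intro!: prod_zero bexI[of _ i])
  qed
  show ?thesis unfolding hook_relations_def using T1 T2 n by simp
qed

lemma orbit_ideal_in_inv_hilb:
  assumes n: "n = k + r" and r: "length cs = r" and dist: "distinct (a # cs)"
  shows "orbit_ideal k n a cs \<in> inv_hilb_ideals n (perm_module n (k # replicate r 1))"
  using model_imp_rep_iso[OF n orbit_ideal_sub orbit_ideal_submod orbit_ideal_stable orbit_model]
    n r dist orbit_ideal_sub orbit_ideal_submod orbit_ideal_stable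
  by (auto simp: inv_hilb_ideals_def ideal_poly_ring_iff sym_group_carrier)


section \<open>Specialization of families along a curve\<close>

text \<open>Specialization of the parameter, for polynomials with coefficients in \<open>\<complex>[t]\<close>.\<close>

definition specialize :: "complex \<Rightarrow> complex poly mp \<Rightarrow> mpoly" where
  "specialize t p = Poly_Mapping.map (\<lambda>q. poly q t) p"

lemma lookup_spec: "Poly_Mapping.lookup (specialize t p) m = poly (Poly_Mapping.lookup p m) t"
  by (simp add: specialize_def Poly_Mapping.map.rep_eq when_def)

lemma spec_add: "specialize t (p + q) = specialize t p + specialize t q"
  and spec_diff: "specialize t (p - q) = specialize t p - specialize t q"
  and spec_uminus: "specialize t (- p) = - specialize t p"
  and spec_0: "specialize t 0 = 0"
  by (auto intro!: poly_mapping_eqI simp: lookup_spec lookup_add lookup_minus)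

lemma spec_single: "specialize t (Poly_Mapping.single m c) = Poly_Mapping.single m (poly c t)"
  by (rule poly_mapping_eqI) (simp add: lookup_spec lookup_single when_def)

lemma spec_Const: "specialize t (Const c) = Const (poly c t)"
  by (simp add: Const_def spec_single)

lemma spec_1: "specialize t 1 = 1"
  using spec_Const[of t 1] by simp

lemma spec_Var: "specialize t (Var i) = Var i"
  by (simp add: Var_def spec_single)

lemma spec_sum: "specialize t (sum f A) = (\<Sum>x\<in>A. specialize t (f x))"
  by (induction A rule: infinite_finite_induct) (auto simp: spec_0 spec_add)

lemma spec_mult: "specialize t (p * q) = specialize t p * specialize t q"
proof -
  have pq: "p * q = (\<Sum>s\<in>Poly_Mapping.keys p. \<Sum>u\<in>Poly_Mapping.keys q.
      Poly_Mapping.single s (Poly_Mapping.lookup p s) * Poly_Mapping.single u (Poly_Mapping.lookup q u))"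
    using arg_cong2[OF single_sum_keys[of p] single_sum_keys[of q], of "(*)"] by (simp only: sum_product)
  have "specialize t (p * q) = (\<Sum>s\<in>Poly_Mapping.keys p. \<Sum>u\<in>Poly_Mapping.keys q.
      specialize t (Poly_Mapping.single s (Poly_Mapping.lookup p s)) * specialize t (Poly_Mapping.single u (Poly_Mapping.lookup q u)))"
    unfolding pq by (simp add: spec_sum spec_single mult_single)
  also have "\<dots> = specialize t (\<Sum>s\<in>Poly_Mapping.keys p. Poly_Mapping.single s (Poly_Mapping.lookup p s)) *
      specialize t (\<Sum>u\<in>Poly_Mapping.keys q. Poly_Mapping.single u (Poly_Mapping.lookup q u))"
    by (simp add: spec_sum sum_product)
  finally show ?thesis by (simp only: single_sum_keys[symmetric])
qed

lemma spec_prod: "specialize t (prod f A) = (\<Prod>x\<in>A. specialize t (f x))"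
  by (induction A rule: infinite_finite_induct) (auto simp: spec_1 spec_mult)

lemma spec_shift_var: "specialize t (shift_var a i) = shift_var (poly a t) i"
  by (simp add: shift_var_def spec_diff spec_Var spec_Const)

lemma keys_spec: "Poly_Mapping.keys (specialize t p) \<subseteq> Poly_Mapping.keys p"
  by (auto simp: in_keys_iff lookup_spec)

lemma spec_polys: "p \<in> polys n \<Longrightarrow> specialize t p \<in> polys n"
  using keys_spec[of t p] by (auto simp: polys_def)

lemma spec_root_poly: "map_poly (specialize t) (root_poly a n) = root_poly (poly a t) n"
  unfolding root_poly_def
  by (subst map_poly_prod_hom)
    (simp_all add: spec_0 spec_1 spec_add spec_mult map_poly_linear spec_uminus spec_shift_var)

lemma spec_const_roots: "map_poly (specialize t) (const_roots bs) = const_roots (map (\<lambda>b. poly b t) bs)"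
  by (subst map_poly_const_roots)
    (simp_all add: spec_0 spec_1 spec_add spec_mult spec_uminus spec_Const const_roots_def comp_def)

text \<open>A family of ideals satisfying the hook relations along a polynomial curve has normal forms
  depending polynomially on the parameter.\<close>

lemma family_normal_forms:
  fixes A :: "complex poly" and Bs :: "complex poly list"
  assumes n: "n = k + length Bs"
    and I: "\<And>t. t \<in> T \<Longrightarrow> submod n (I t)"
    and rel: "\<And>t. t \<in> T \<Longrightarrow> hook_relations (poly A t) (map (\<lambda>b. poly b t) Bs) k (I t) 1"
    and m: "m \<in> monoms n"
  shows "\<exists>s. Poly_Mapping.keys s \<subseteq> hook_monoms k (length Bs) \<and>
    (\<forall>t\<in>T. Poly_Mapping.single m 1 - specialize t s \<in> I t)"
proof -
  define K where "K = {p :: complex poly mp. \<forall>t\<in>T. specialize t p \<in> I t}"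
  have sub: "submod n K"
    unfolding submod_def K_def
  proof (intro conjI ballI CollectI; (elim CollectE)?)
    fix t assume t: "t \<in> T"
    show "specialize t 0 \<in> I t" using submod_0[OF I[OF t]] by (simp add: spec_0)
    fix p q :: "complex poly mp"
    show "specialize t (p + q) \<in> I t" if "\<forall>t\<in>T. specialize t p \<in> I t" "\<forall>t\<in>T. specialize t q \<in> I t"
      using that t submod_add[OF I[OF t]] by (simp add: spec_add)
    show "specialize t (q * p) \<in> I t" if "q \<in> polys n" "\<forall>t\<in>T. specialize t p \<in> I t"
      using that t submod_mult[OF I[OF t] spec_polys] by (simp add: spec_mult)
  qed
  have relK: "hook_relations A Bs k K 1"
    unfolding hook_relations_def n[symmetric]
  proof (intro conjI allI impI)
    let ?F = "root_poly A n - Polynomial.monom 1 k * const_roots Bs"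
    show "coeffs_in K (smult 1 ?F)"
      unfolding coeffs_in_def K_def
    proof (intro allI CollectI ballI)
      fix i t assume t: "t \<in> T"
      have mm: "map_poly (specialize t) (Polynomial.monom 1 k * const_roots Bs) =
          map_poly (specialize t) (Polynomial.monom 1 k) * map_poly (specialize t) (const_roots Bs)"
        by (rule map_poly_mult_hom) (simp_all add: spec_0 spec_add spec_mult)
      have "specialize t (coeff ?F i) = coeff (map_poly (specialize t) (root_poly A n)) i -
          coeff (map_poly (specialize t) (Polynomial.monom 1 k * const_roots Bs)) i"
        by (simp add: coeff_map_poly spec_0 spec_diff)
      also have "\<dots> = coeff (root_poly (poly A t) n - Polynomial.monom 1 k * const_roots (map (\<lambda>b. poly b t) Bs)) i"
        unfolding mm spec_root_poly spec_const_roots by (simp add: map_poly_monom spec_0 spec_1)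
      also have "\<dots> \<in> I t" using rel[OF t] by (simp add: hook_relations_def coeffs_in_def n)
      finally show "specialize t (coeff (smult 1 ?F) i) \<in> I t" by simp
    qed
    fix S assume S: "S \<subseteq> {1..n}" "card S = Suc (length Bs)"
    have "(\<Prod>i\<in>S. shift_var (poly A t) i) \<in> I t" if "t \<in> T" for t
      using rel[OF that] S unfolding hook_relations_def n by simp
    then show "1 * (\<Prod>i\<in>S. shift_var A i) \<in> K" by (simp add: K_def spec_prod spec_shift_var)
  qed
  have "Poly_Mapping.single m 1 \<in> (polys n :: complex poly mp set)" using m by (simp add: polys_def)
  then obtain s where "Poly_Mapping.keys s \<subseteq> hook_monoms k (length Bs)" "1 * (Poly_Mapping.single m 1 - s) \<in> K"
    using hook_monoms_span[OF refl _ relK] sub n by blast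
  then show ?thesis by (intro exI[of _ s]) (simp add: K_def spec_diff spec_single)
qed

section \<open>Closed sets restricted to a curve\<close>

lemma vanishing_infinitely_often:
  fixes f :: "'a \<Rightarrow> complex poly"
  assumes "infinite {t \<in> T. \<forall>F\<in>S. poly (f F) t = 0}" and "F \<in> S"
  shows "f F = 0"
proof (rule ccontr)
  assume "f F \<noteq> 0"
  then have "finite {t. poly (f F) t = 0}" by (rule poly_roots_finite)
  moreover have "{t \<in> T. \<forall>F\<in>S. poly (f F) t = 0} \<subseteq> {t. poly (f F) t = 0}" using assms(2) by blast
  ultimately show False using assms(1) finite_subset by blast
qed

text \<open>In a chart, a closed set is cut out by polynomials in the coordinates, which are polynomials in \<open>t\<close> along the family.\<close>

lemma closed_along_curve:
  assumes Z: "hilb_closed n N Z" and B: "B \<subseteq> monoms n" "finite B" "card B = N"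
    and chart: "\<And>t. t \<in> T \<Longrightarrow> I t \<in> hilb_chart n N B"
    and coord: "\<And>m. m \<in> monoms n \<Longrightarrow> \<exists>s. \<forall>b\<in>B. \<forall>t\<in>T. chart_coord (I t) B (m, b) = poly (s b) t"
    and inf: "infinite {t \<in> T. I t \<in> Z}" and t: "t \<in> T"
  shows "I t \<in> Z"
proof -
  obtain S where S: "S \<subseteq> chart_polys n B"
    "Z \<inter> hilb_chart n N B = {I \<in> hilb_chart n N B. \<forall>F\<in>S. poly_eval (chart_coord I B) F = 0}"
    using hilb_closedD[OF Z B] by (elim exE conjE)
  obtain s where s: "\<And>m b t. m \<in> monoms n \<Longrightarrow> b \<in> B \<Longrightarrow> t \<in> T \<Longrightarrow> chart_coord (I t) B (m, b) = poly (s m b) t"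
    using coord by metis
  define f :: "((monom \<times> monom \<Rightarrow>\<^sub>0 nat) \<Rightarrow>\<^sub>0 complex) \<Rightarrow> complex poly" where
    "f F = (\<Sum>u\<in>Poly_Mapping.keys F. smult (Poly_Mapping.lookup F u)
      (\<Prod>x\<in>Poly_Mapping.keys u. s (fst x) (snd x) ^ Poly_Mapping.lookup u x))" for F
  have ev: "poly_eval (chart_coord (I t) B) F = poly (f F) t" if F: "F \<in> S" and t: "t \<in> T" for F t
  proof -
    have "chart_coord (I t) B x = poly (s (fst x) (snd x)) t"
      if "u \<in> Poly_Mapping.keys F" "x \<in> Poly_Mapping.keys u" for u x
    proof -
      have "x \<in> monoms n \<times> B" using S(1) F that unfolding chart_polys_def by blast
      then show ?thesis using s[of "fst x" "snd x" t] t by auto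
    qed
    then show ?thesis
      unfolding poly_eval_def monom_eval_def f_def poly_sum poly_smult poly_prod poly_power
      by (intro sum.cong prod.cong refl arg_cong2[where f = "(*)"] arg_cong2[where f = "(^)"])
  qed
  have mem: "I t \<in> Z \<longleftrightarrow> (\<forall>F\<in>S. poly (f F) t = 0)" if t: "t \<in> T" for t
  proof -
    have "I t \<in> Z \<longleftrightarrow> I t \<in> Z \<inter> hilb_chart n N B" using chart[OF t] by blast
    also have "\<dots> \<longleftrightarrow> (\<forall>F\<in>S. poly_eval (chart_coord (I t) B) F = 0)" unfolding S(2) using chart[OF t] by blast
    finally show ?thesis using ev[OF _ t] by simp
  qed
  have "{t \<in> T. I t \<in> Z} = {t \<in> T. \<forall>F\<in>S. poly (f F) t = 0}" using mem by blast
  then have "f F = 0" if "F \<in> S" for F using vanishing_infinitely_often[of T S f, OF _ that] inf by simp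
  then show ?thesis using mem[OF t] by simp
qed

section \<open>Irreducibility\<close>

text \<open>A closed set of points of the scheme that contains the generic point contains all points.\<close>

lemma irreducible_scheme_space:
  assumes irr: "irreducible_space X"
  shows "irreducible_space (scheme_space X)"
proof -
  have nonempty: "C \<noteq> {}" "C \<subseteq> topspace X" if "C \<in> scheme_points X" for C
  proof -
    have C: "closedin X C" "irreducible_space (subtopology X C)" using that by (auto simp: scheme_points_def)
    then show "C \<subseteq> topspace X" using closedin_subset by blast
    then show "C \<noteq> {}" using C(2) by (auto simp: irreducible_space_def)
  qed
  have generic: "topspace X \<in> scheme_points X" using irr by (simp add: scheme_points_def)
  have top: "topspace (scheme_space X) = scheme_points X"
  proof
    show "topspace (scheme_space X) \<subseteq> scheme_points X"
      using openin_topspace[of "scheme_space X"] unfolding openin_scheme_space by blast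
    have "scheme_points X = {C \<in> scheme_points X. C \<inter> topspace X \<noteq> {}}" using nonempty by blast
    then have "openin (scheme_space X) (scheme_points X)"
      unfolding openin_scheme_space using openin_topspace by blast
    then show "scheme_points X \<subseteq> topspace (scheme_space X)" by (rule openin_subset)
  qed
  have closed: "\<exists>Z. closedin X Z \<and> A = {C \<in> scheme_points X. C \<subseteq> Z}" if A: "closedin (scheme_space X) A" for A
  proof -
    have "A \<subseteq> scheme_points X" using closedin_subset[OF A] top by simp
    moreover obtain U where U: "openin X U" "scheme_points X - A = {C \<in> scheme_points X. C \<inter> U \<noteq> {}}"
      using A unfolding closedin_def top openin_scheme_space by blast
    ultimately have "A = {C \<in> scheme_points X. C \<inter> U = {}}" by blast
    also have "\<dots> = {C \<in> scheme_points X. C \<subseteq> topspace X - U}" using nonempty by blast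
    finally show ?thesis using U(1) by blast
  qed
  show ?thesis
    unfolding irreducible_space_def top
  proof (intro conjI allI impI)
    show "scheme_points X \<noteq> {}" using generic by blast
    fix A B assume AB: "closedin (scheme_space X) A" "closedin (scheme_space X) B" "A \<union> B = scheme_points X"
    obtain Y where Y: "closedin X Y" "A = {C \<in> scheme_points X. C \<subseteq> Y}" using closed[OF AB(1)] by blast
    obtain Z where Z: "closedin X Z" "B = {C \<in> scheme_points X. C \<subseteq> Z}" using closed[OF AB(2)] by blast
    have "topspace X \<subseteq> Y \<or> topspace X \<subseteq> Z" using generic AB(3) Y(2) Z(2) by blast
    then show "A = scheme_points X \<or> B = scheme_points X" using nonempty Y(2) Z(2) by blast
  qed
qed

text \<open>A quadratic curve through the points \<open>u\<close> (at \<open>0\<close>) and \<open>v\<close> (at \<open>1\<close>). Its coordinates have the distinct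
  leading coefficients \<open>0, 1, 2, \<dots>\<close>, so that all but finitely many of its points have distinct coordinates.\<close>

definition quad_curve :: "complex list \<Rightarrow> complex list \<Rightarrow> nat \<Rightarrow> complex poly" where
  "quad_curve u v j = [:u ! j, v ! j - u ! j - of_nat j, of_nat j:]"

lemma quad_curve_ends: "poly (quad_curve u v j) 0 = u ! j" "poly (quad_curve u v j) 1 = v ! j"
  by (simp_all add: quad_curve_def)

lemma quad_curve_generic: "finite {t. \<not> distinct (map (\<lambda>j. poly (quad_curve u v j) t) [0..<l])}"
proof -
  have sub: "{t. \<not> distinct (map (\<lambda>j. poly (quad_curve u v j) t) [0..<l])} \<subseteq>
      (\<Union>i<l. \<Union>j\<in>{..<l} - {i}. {t. poly (quad_curve u v i - quad_curve u v j) t = 0})"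
  proof
    fix t assume "t \<in> {t. \<not> distinct (map (\<lambda>j. poly (quad_curve u v j) t) [0..<l])}"
    then obtain i j where "i < l" "j < l" "i \<noteq> j" "poly (quad_curve u v i) t = poly (quad_curve u v j) t"
      by (auto simp: distinct_map inj_on_def)
    then show "t \<in> (\<Union>i<l. \<Union>j\<in>{..<l} - {i}. {t. poly (quad_curve u v i - quad_curve u v j) t = 0})"
      by (intro UN_I[of i] UN_I[of j]) auto
  qed
  have fin: "finite {t. poly (quad_curve u v i - quad_curve u v j) t = 0}" if "i \<noteq> j" for i j
  proof (rule poly_roots_finite)
    have "coeff (quad_curve u v i - quad_curve u v j) 2 = of_nat i - of_nat j"
      by (simp add: quad_curve_def numeral_2_eq_2)
    moreover have "(of_nat i :: complex) - of_nat j \<noteq> 0" using that by simp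
    ultimately show "quad_curve u v i - quad_curve u v j \<noteq> 0" by (metis coeff_0)
  qed
  show ?thesis by (rule finite_subset[OF sub]) (use fin in auto)
qed

lemma inv_hilb_ideals_model:
  assumes n: "n = k + r" and k: "k \<ge> 1" and I: "I \<in> inv_hilb_ideals n (perm_module n (k # replicate r 1))"
  shows "I \<subseteq> polys n" "submod n I" "\<exists>\<Phi>. hook_quotient k r n I \<Phi>"
proof -
  have *: "I \<subseteq> polys n" "submod n I" "\<And>\<sigma>. \<sigma> permutes {1..n} \<Longrightarrow> perm_poly \<sigma> ` I = I"
    "rep_iso n (quot_rep n I) (perm_module n (k # replicate r 1))"
    using I by (auto simp: inv_hilb_ideals_def ideal_poly_ring_iff sym_group_carrier)
  show "I \<subseteq> polys n" "submod n I" by (rule *)+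
  obtain \<Phi> where "coset_model k n I \<Phi>" using rep_iso_imp_model[OF n *] by blast
  moreover have "stable n I" using *(3) unfolding stable_def by blast
  ultimately show "\<exists>\<Phi>. hook_quotient k r n I \<Phi>" using n k * by (auto simp: hook_quotient_def)
qed

theorem irreducible_closed_points:
  assumes n: "n = k + r" and k: "k \<ge> 1"
  shows "irreducible_space (inv_hilb_closed_points n (perm_module n (k # replicate r 1)))"
proof -
  let ?M = "perm_module n (k # replicate r 1)"
  define H where "H = inv_hilb_ideals n ?M"
  define B where "B = hook_monoms k r"
  obtain N where N: "has_dim ?M N" "rep_dim ?M = N" by (rule has_dim_perm_module[OF n])
  have B: "B \<subseteq> monoms n" "finite B"
    using hook_monoms_monoms finite_hook_monoms n by (auto simp: B_def)
  have HI: "I \<subseteq> polys n" "submod n I" "\<exists>\<Phi>. hook_quotient k r n I \<Phi>" if "I \<in> H" for I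
    using inv_hilb_ideals_model[OF n k] that by (auto simp: H_def)
  have dim: "has_dim (quot_rep n I) N" if "I \<in> H" for I
    using that N(1) has_dim_rep_iso unfolding H_def inv_hilb_ideals_def by blast
  have gen: "orbit_ideal k n (hd zs) (tl zs) \<in> H" if "length zs = Suc r" "distinct zs" for zs
    using orbit_ideal_in_inv_hilb[OF n, of "tl zs" "hd zs"] that by (cases zs) (auto simp: H_def)
  have span: "\<exists>s. Poly_Mapping.keys s \<subseteq> B \<and> p - s \<in> I"
    if "submod n I" "length bs = r" "hook_relations a bs k I 1" "p \<in> polys n" for I p a and bs :: "complex list"
    using hook_monoms_span[OF that(2) _ that(3), of p] that(1,4) n by (simp add: B_def)
  \<comment> \<open>A generic orbit bounds the number of hook monomials from below, without counting them.\<close>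
  have cardN: "N \<le> card B"
  proof -
    define zs :: "complex list" where "zs = map of_nat [0..<Suc r]"
    have zs: "length zs = Suc r" "distinct zs" by (simp_all add: zs_def distinct_map inj_on_def del: upt_Suc)
    let ?I = "orbit_ideal k n (hd zs) (tl zs)"
    have rel: "hook_relations (hd zs) (map (\<lambda>c. c - hd zs) (tl zs)) k ?I 1"
      using zs(1) n by (intro orbit_relations) simp
    show ?thesis
      by (rule quot_span_card[OF orbit_ideal_sub orbit_ideal_submod dim[OF gen[OF zs]] B(2,1)])
        (rule span[OF orbit_ideal_submod _ rel], use zs in auto)
  qed
  have struct: "\<exists>zs. length zs = Suc r \<and> hook_relations (hd zs) (map (\<lambda>c. c - hd zs) (tl zs)) k I 1 \<and>
      (\<forall>s. Poly_Mapping.keys s \<subseteq> B \<longrightarrow> s \<in> I \<longrightarrow> s = 0) \<and> card B = N" if I: "I \<in> H" for I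
  proof -
    obtain \<Phi> where "hook_quotient k r n I \<Phi>" using HI(3)[OF I] by blast
    then interpret hook_quotient k r n I \<Phi> .
    obtain a bs where *: "length bs = r" "hook_relations a bs k I 1"
      "\<And>s. Poly_Mapping.keys s \<subseteq> hook_monoms k r \<Longrightarrow> s \<in> I \<Longrightarrow> s = 0" "card (hook_monoms k r) = N"
      using hook_relations_hold[OF dim[OF I] cardN[unfolded B_def]] by metis
    have "map (\<lambda>c. c - a) (map (\<lambda>b. b + a) bs) = bs" by (simp add: comp_def)
    then show ?thesis using * unfolding B_def by (intro exI[of _ "a # map (\<lambda>b. b + a) bs"]) simp
  qed
  obtain I0 where I0: "I0 \<in> H"
    using gen[of "map of_nat [0..<Suc r]"] by (force simp: distinct_map inj_on_def simp del: upt_Suc)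
  have cardB: "card B = N" using struct[OF I0] by blast
  have pts: "H \<subseteq> hilb_points n N"
    using dim by (auto simp: hilb_points_def H_def inv_hilb_ideals_def)
  have indep: "s = 0" if "I \<in> H" "Poly_Mapping.keys s \<subseteq> B" "s \<in> I" for I s
    using struct[OF that(1)] that(2,3) by blast
  have uniq: "r1 = r2" if I: "I \<in> H" and "Poly_Mapping.keys r1 \<subseteq> B" "p - r1 \<in> I" "Poly_Mapping.keys r2 \<subseteq> B" "p - r2 \<in> I"
    for I p r1 r2
  proof -
    have "r2 - r1 \<in> I" using submod_diff[OF HI(2)[OF I] that(3,5)] by simp
    moreover have "Poly_Mapping.keys (r2 - r1) \<subseteq> B" using keys_diff[of r2 r1] that(2,4) by blast
    ultimately show ?thesis using indep[OF I] by force
  qed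
  have chart: "I \<in> hilb_chart n N B" if I: "I \<in> H" for I
  proof -
    obtain zs where zs: "length zs = Suc r" "hook_relations (hd zs) (map (\<lambda>c. c - hd zs) (tl zs)) k I 1"
      using struct[OF I] by blast
    have "\<exists>!r. Poly_Mapping.keys r \<subseteq> B \<and> p - r \<in> I" if "p \<in> polys n" for p
      using span[OF HI(2)[OF I] _ zs(2) that] zs(1) uniq[OF I] by auto
    then show ?thesis using pts I by (auto simp: hilb_chart_def carrier_poly_ring)
  qed
  let ?X = "inv_hilb_closed_points n ?M"
  have X: "?X = subtopology (hilb_topology n N) H" by (simp add: inv_hilb_closed_points_def N(2) H_def)
  have top: "topspace ?X = H" using pts by (auto simp: X topspace_hilb_topology)
  have key: "A = H \<or> A' = H" if A: "closedin ?X A" "closedin ?X A'" "A \<union> A' = H" for A A'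
  proof (rule ccontr)
    assume neg: "\<not> (A = H \<or> A' = H)"
    obtain Z where Z: "hilb_closed n N Z" "A = H \<inter> Z"
      using A(1) unfolding X closedin_subtopology closedin_hilb_topology by blast
    obtain Z' where Z': "hilb_closed n N Z'" "A' = H \<inter> Z'"
      using A(2) unfolding X closedin_subtopology closedin_hilb_topology by blast
    obtain P where P: "P \<in> H" "P \<notin> Z" using neg Z(2) by blast
    obtain Q where Q: "Q \<in> H" "Q \<notin> Z'" using neg Z'(2) by blast
    obtain us where us: "length us = Suc r" "hook_relations (hd us) (map (\<lambda>c. c - hd us) (tl us)) k P 1"
      using struct[OF P(1)] by blast
    obtain vs where vs: "length vs = Suc r" "hook_relations (hd vs) (map (\<lambda>c. c - hd vs) (tl vs)) k Q 1"
      using struct[OF Q(1)] by blast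
    define zs where "zs t = map (\<lambda>j. poly (quad_curve us vs j) t) [0..<Suc r]" for t
    have zs0: "zs 0 = us" "zs 1 = vs"
      unfolding zs_def quad_curve_ends using us(1) vs(1) map_nth[of us] map_nth[of vs] by (simp_all del: upt_Suc)
    have lzs: "length (zs t) = Suc r" for t by (simp add: zs_def del: upt_Suc)
    define G where "G = {t. distinct (zs t)}"
    define T where "T = G \<union> {0, 1}"
    define I where "I t = (if t = 0 then P else if t = 1 then Q else orbit_ideal k n (hd (zs t)) (tl (zs t)))" for t
    have cofin: "finite (- G)"
      using quad_curve_generic[of us vs "Suc r"] by (simp add: G_def zs_def Collect_neg_eq del: upt_Suc)
    have infT: "infinite T"
    proof
      assume "finite T"
      then have "finite (T \<union> - G)" using cofin by simp
      moreover have "T \<union> - G = UNIV" by (auto simp: T_def)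
      ultimately show False using infinite_UNIV_char_0 by metis
    qed
    \<comment> \<open>For other \<open>t\<close> outside \<open>G\<close> the orbit degenerates and its ideal need not be a point of the scheme.\<close>
    have IH: "I t \<in> H" if "t \<in> T" for t
      using that P(1) Q(1) gen[OF lzs, of t] by (auto simp: I_def T_def G_def)
    have relI: "hook_relations (hd (zs t)) (map (\<lambda>c. c - hd (zs t)) (tl (zs t))) k (I t) 1" for t
      using us(2) vs(2) zs0 orbit_relations[of n k "tl (zs t)" "hd (zs t)"] n lzs[of t] by (auto simp: I_def)
    define Ap where "Ap = quad_curve us vs 0"
    define Bs where "Bs = map (\<lambda>j. quad_curve us vs j - Ap) [1..<Suc r]"
    have zsA: "zs t = poly Ap t # map (\<lambda>j. poly (quad_curve us vs j) t) [1..<Suc r]" for t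
      by (simp add: zs_def Ap_def upt_conv_Cons[of 0 "Suc r"] One_nat_def del: upt_Suc)
    have rel: "hook_relations (poly Ap t) (map (\<lambda>b. poly b t) Bs) k (I t) 1" for t
      using relI[of t] unfolding zsA by (simp add: Bs_def comp_def del: upt_Suc)
    have lB: "length Bs = r" by (simp add: Bs_def)
    have coord: "\<exists>s. \<forall>b\<in>B. \<forall>t\<in>T. chart_coord (I t) B (m, b) = poly (s b) t" if m: "m \<in> monoms n" for m
    proof -
      have "n = k + length Bs" using n lB by simp
      from family_normal_forms[OF this HI(2)[OF IH] rel m, of T] obtain s where
        s: "Poly_Mapping.keys s \<subseteq> B" "\<And>t. t \<in> T \<Longrightarrow> Poly_Mapping.single m 1 - specialize t s \<in> I t"
        using lB by (auto simp: B_def)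
      have "normal_form (I t) B (Poly_Mapping.single m 1) = specialize t s" if t: "t \<in> T" for t
        unfolding normal_form_def
      proof (rule the_equality)
        show 1: "Poly_Mapping.keys (specialize t s) \<subseteq> B \<and> Poly_Mapping.single m 1 - specialize t s \<in> I t"
          using s keys_spec[of t s] t by blast
        show "r' = specialize t s" if "Poly_Mapping.keys r' \<subseteq> B \<and> Poly_Mapping.single m 1 - r' \<in> I t" for r'
          using uniq[OF IH[OF t]] that 1 by blast
      qed
      then show ?thesis by (intro exI[of _ "Poly_Mapping.lookup s"]) (simp add: chart_coord_def lookup_spec)
    qed
    have all: "I t \<in> Y" if "hilb_closed n N Y" "infinite {t \<in> T. I t \<in> Y}" "t \<in> T" for Y t
      using closed_along_curve[OF that(1) B cardB chart[OF IH] coord that(2,3)] .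
    have "T \<subseteq> {t \<in> T. I t \<in> Z} \<union> {t \<in> T. I t \<in> Z'}" using IH A(3) Z(2) Z'(2) by blast
    then have "infinite ({t \<in> T. I t \<in> Z} \<union> {t \<in> T. I t \<in> Z'})" using infT by (rule infinite_super)
    then have "infinite {t \<in> T. I t \<in> Z} \<or> infinite {t \<in> T. I t \<in> Z'}" unfolding finite_Un by blast
    then show False
    proof
      assume "infinite {t \<in> T. I t \<in> Z}"
      from all[OF Z(1) this, of 0] show False using P(2) by (simp add: T_def I_def)
    next
      assume "infinite {t \<in> T. I t \<in> Z'}"
      from all[OF Z'(1) this, of 1] show False using Q(2) by (simp add: T_def I_def)
    qed
  qed
  show ?thesis unfolding irreducible_space_def top using key I0 by blast
qed

theorem corollary3p5:
  fixes n :: nat and lam :: "nat list"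
  assumes "is_partition lam n" and "is_hook lam"
  shows "irreducible_space (inv_hilb n (perm_module n lam))"
proof -
  obtain k r where lam: "lam = k # replicate r 1" using assms(2) by (auto simp: is_hook_def)
  have "k \<ge> 1" "n = k + r" using assms(1) by (auto simp: is_partition_def lam sum_list_replicate)
  then show ?thesis
    unfolding inv_hilb_def lam by (intro irreducible_scheme_space irreducible_closed_points)
qed

end
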